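(* For every integer $d\ge1$, $$\delta(0,d)=\frac1d\prod_{p\mid d}\frac{1}{1-p^{-2}},\qquad \delta(d,2d)=\begin{cases}\tfrac12\,\delta(0,2d)&\text{if $d$ is odd},\\ \delta(0,2d)&\text{if $d$ is even}.\end{cases}$$ Moreover, for every integer $s\ge1$ and every integer $a$, $$\delta(a,2^s)=\begin{cases}2^{2-s}/3&\text{if $a$ is even},\\ 2^{1-s}/3&\text{if $a$ is odd}.\end{cases}$$
   Context: $p$ always denotes a prime, $\pi(x)$ the number of primes $\le x$. For a prime $p$ and integers $a$, $d\ge1$, let $\delta(p;a,d)=\frac{1}{p-1}\#\{x\in\mathbb F_p^*:\ \mathrm{ord}(x)\equiv a \pmod d\}$, where $\mathrm{ord}(x)$ is the multiplicative order of $x$. Set $N(a,d)(x)=\sum_{p\le x}\delta(p;a,d)$ and $\delta(a,d)=\lim_{x\to\infty}N(a,d)(x)/\pi(x)$ (this limit exists). *)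

theory Defs
  imports "HOL-Analysis.Analysis" "HOL-Number_Theory.Number_Theory"
begin

definition prime_pi :: "real \<Rightarrow> nat" where
  "prime_pi x = card {p::nat. prime p \<and> real p \<le> x}"

text \<open>delta(p;a,d): proportion of x in F_p^* (represented by 1..p-1) whose
  multiplicative order (ord p x, from Pocklington) is congruent to a mod d.\<close>
definition delta_p :: "nat \<Rightarrow> int \<Rightarrow> nat \<Rightarrow> real" where
  "delta_p p a d =
     real (card {x::nat \<in> {1..p-1}. [int (ord p x) = a] (mod int d)}) / real (p - 1)"

definition N_count :: "int \<Rightarrow> nat \<Rightarrow> real \<Rightarrow> real" where
  "N_count a d x = (\<Sum>p\<in>{p::nat. prime p \<and> real p \<le> x}. delta_p p a d)"

definition delta :: "int \<Rightarrow> nat \<Rightarrow> real" where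
  "delta a d = Lim at_top (\<lambda>x::real. N_count a d x / real (prime_pi x))"

definition has_delta :: "int \<Rightarrow> nat \<Rightarrow> real \<Rightarrow> bool" where
  "has_delta a d L \<longleftrightarrow> ((\<lambda>x::real. N_count a d x / real (prime_pi x)) \<longlongrightarrow> L) at_top"

end

theory Submission
  imports Defs "HOL-Complex_Analysis.Complex_Analysis" "HOL-Real_Asymp.Real_Asymp" "HOL-Computational_Algebra.Squarefree"
begin

text \<open>
  Since the multiplicative group mod p is cyclic, delta_p p a d is the sum of totient j / (p - 1) over the
  divisors j of p - 1 congruent to a mod d. For a = 0 this equals the sum of totient d / n over those
  multiples n of d dividing p - 1 that have the same prime factors as d; in general it is the sum of
  mu e / (t e) over the pairs (t, e) such that t e divides p - 1 and (p - 1) / t is congruent to a.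
  Each condition on p is a condition modulo a fixed number, so that the prime number theorem in
  arithmetic progressions gives its density. A bound of Chebyshev type for the primes congruent
  to 1 mod u, uniform in u, makes the sums dominated, and limit and sum may be exchanged. The first sum
  is then an Euler product. An order congruent to d mod 2 d is one that is divisible by d but not by 2 d.
  Modulo a power of two the limit does not change when a is multiplied by an odd number, so it
  follows from the previous cases.

  The prime number theorem in progressions is proved with Dirichlet characters. If L(s, chi) vanished
  at 1 + i alpha, the product of the principal L-function with the shifted one would be holomorphic
  for Re s > 0; Landau's argument for the product G of this function with its conjugate then makes
  the series of ln p / p over the primes converge. Nonvanishing is turned into asymptotics by a
  Tauberian theorem of Wiener-Ikehara type, proved by averaging against the Fejer kernel.
\<close>

section \<open>Dirichlet characters\<close>

text \<open>The trivial count n / u for the progression 1 mod u, compared with the number of primes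
  up to n, is ln n / u, which is not bounded in n. The Chebyshev bound saves this logarithm for all
  u at once and loses only a small power of u. Any saving u powr -c with c > 0 is enough, since the
  weights already carry a factor 1 / n or 1 / (t e).

  The two expansions have different strengths. The one for a = 0 has positive terms and an Euler
  product. The one for general a is never evaluated: it gives the existence of the limits and their
  invariance under odd multipliers. The values follow because the classes with the same power of 2
  are equally dense and add up to a known difference.

  Landau's argument is used at exponent 1/2, where a square n^2 contributes a multiple of 1 / n. The
  coefficient at n may vanish, but then the one at n^2 does not; this treats complex characters,
  real characters and the point s = 1 alike.

  Everything asked of a residue class is linear in its indicator, so it suffices to reach indicators
  from characters by sums and multiples.\<close>

definition unit_function :: "nat \<Rightarrow> (nat \<Rightarrow> complex) \<Rightarrow> bool" where
  "unit_function m f \<longleftrightarrow> (\<forall>x. f (x mod m) = f x) \<and> (\<forall>x. \<not> coprime x m \<longrightarrow> f x = 0)"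

definition dchar :: "nat \<Rightarrow> (nat \<Rightarrow> complex) \<Rightarrow> bool" where
  "dchar m \<psi> \<longleftrightarrow> unit_function m \<psi> \<and> \<psi> 1 = 1 \<and> (\<forall>x y. \<psi> (x * y) = \<psi> x * \<psi> y)"

lemma unit_function_cong:
  assumes "unit_function m f" "[x = y] (mod m)"
  shows "f x = f y"
  using assms unfolding unit_function_def cong_def by metis

text \<open>Orthogonality on the cyclic group of order n. In \<open>unit_function_induct\<close> it
  shows that a function is the sum of its projections.\<close>

lemma sum_roots_of_unity:
  fixes n k :: nat
  assumes "k < n"
  shows "(\<Sum>j<n. cis (2 * pi * real j / real n) ^ k) = (if k = 0 then of_nat n else 0)"
proof (cases "k = 0")
  case False
  define z where "z = cis (2 * pi * real k / real n)"
  have n: "n > 0" using assms by auto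
  have inj: "inj_on (\<lambda>k. cis (2 * pi * real k / real n)) {..<n}"
    using Complex.bij_betw_roots_unity[OF n] by (rule bij_betw_imp_inj_on)
  have "z \<noteq> cis (2 * pi * real 0 / real n)"
    unfolding z_def using inj_onD[OF inj, of k 0] assms False by auto
  hence z1: "z \<noteq> 1" by simp
  have zn: "z ^ n = 1"
    using Complex.bij_betw_roots_unity[OF n] assms unfolding z_def bij_betw_def by blast
  have "(\<Sum>j<n. cis (2 * pi * real j / real n) ^ k) = (\<Sum>j<n. z ^ j)"
    unfolding z_def Complex.DeMoivre by (intro sum.cong) (auto simp: field_simps)
  also have "\<dots> = (z ^ n - 1) / (z - 1)"
    using z1 by (rule geometric_sum)
  finally show ?thesis using zn False by simp
qed auto

lemma cis_root_power: "n > 0 \<Longrightarrow> cis (2 * pi * real j / real n) ^ n = 1"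
  using cis_multiple_2pi[of "real j"] by (simp add: Complex.DeMoivre mult_ac)

text \<open>The eigenvalue equation at 1 gives c = f g / f 1, so the eigenvalues are the normalised
  values themselves and multiplicativity follows.\<close>

lemma unit_function_eigen_eq_dchar:
  assumes m: "m \<ge> 1" and f: "unit_function m f" and f1: "f 1 \<noteq> 0"
    and eig: "\<And>g. coprime g m \<Longrightarrow> \<exists>c. \<forall>x. f (g * x) = c * f x"
  shows "dchar m (\<lambda>x. f x / f 1)"
proof -
  have "f (g * x) / f 1 = f g / f 1 * (f x / f 1)" for g x
  proof (cases "coprime g m")
    case True
    then obtain c where c: "\<And>x. f (g * x) = c * f x" using eig by blast
    have "f g = c * f 1" using c[of 1] by simp
    thus ?thesis using f1 c[of x] by simp
  next
    case False
    hence "\<not> coprime (g * x) m" by simp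
    with False f show ?thesis by (simp add: unit_function_def)
  qed
  thus ?thesis using f f1 by (auto simp: dchar_def unit_function_def)
qed

text \<open>Averaging over the powers of a unit g against roots of unity splits a function on the units
  into eigenfunctions of translation by g. Doing this for every g leaves multiples of characters.\<close>

lemma unit_function_induct [consumes 2, case_names add scale char]:
  assumes m: "m \<ge> 1" and f: "unit_function m f"
    and add: "\<And>f g. P f \<Longrightarrow> P g \<Longrightarrow> P (\<lambda>x. f x + g x)"
    and scale: "\<And>c f. P f \<Longrightarrow> P (\<lambda>x. c * f x)"
    and char: "\<And>\<psi>. dchar m \<psi> \<Longrightarrow> P \<psi>"
  shows "P f"
proof -
  define U where "U = {x. x < m \<and> coprime x m}"
  have [simp]: "finite U" unfolding U_def by auto
  define eig where "eig g f \<longleftrightarrow> (\<exists>c. \<forall>x. f (g * x) = c * f x)" for g and f :: "nat \<Rightarrow> complex"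
  have P0: "P (\<lambda>x. 0)"
  proof -
    have "dchar m (\<lambda>x. if coprime x m then 1 else 0)"
      using m by (auto simp: dchar_def unit_function_def)
    from scale[OF char[OF this], of 0] show ?thesis by simp
  qed
  have Psum: "P (\<lambda>x. \<Sum>i\<in>I. h i x)" if "finite I" "\<And>i. i \<in> I \<Longrightarrow> P (h i)" for I and h :: "nat \<Rightarrow> nat \<Rightarrow> complex"
    using that by (induction I rule: finite_induct) (auto intro: P0 add)
  \<comment> \<open>\<open>S\<close> holds the units for which f is not yet known to be an
    eigenfunction: all units at the start, none in the base case, where f is a multiple of a
    character.\<close>
  have "unit_function m f \<Longrightarrow> (\<And>g. g \<in> U - S \<Longrightarrow> eig g f) \<Longrightarrow> P f" if "finite S" "S \<subseteq> U" for S f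
    using that
  proof (induction S arbitrary: f rule: finite_induct)
    case empty
    have eigs: "eig g f" if "coprime g m" for g
    proof -
      have "g mod m \<in> U" using that m by (auto simp: U_def)
      hence "eig (g mod m) f" using empty by auto
      then obtain c where c: "\<And>x. f (g mod m * x) = c * f x" by (auto simp: eig_def)
      have "f (g * x) = c * f x" for x
        using c[of x] unit_function_cong[OF empty(1), of "g * x" "g mod m * x"]
        by (simp add: cong_def mod_mult_left_eq)
      thus ?thesis by (auto simp: eig_def)
    qed
    show ?case
    proof (cases "f 1 = 0")
      case True
      \<comment> \<open>The eigenvalue equation for x, taken at 1, makes f x a multiple of f
        1.\<close>
      have "f x = 0" for x
      proof (cases "coprime x m")
        case cop: True
        then obtain c where "\<And>y. f (x * y) = c * f y" using eigs by (auto simp: eig_def)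
        from this[of 1] True show ?thesis by simp
      qed (use empty in \<open>auto simp: unit_function_def\<close>)
      hence "f = (\<lambda>x. 0)" by auto
      with P0 show ?thesis by simp
    next
      case False
      have "dchar m (\<lambda>x. f x / f 1)"
        using unit_function_eigen_eq_dchar[OF m empty(1) False] eigs by (auto simp: eig_def)
      from scale[OF char[OF this], of "f 1"] False show ?thesis by simp
    qed
  next
    case (insert g S)
    define n where "n = totient m"
    have n: "n > 0" using m by (simp add: n_def)
    have cop: "coprime g m" using insert by (auto simp: U_def)
    define w where "w j = cis (2 * pi * real j / real n)" for j :: nat
    \<comment> \<open>The projection to the functions on which translation by g acts as inverse (w
      j). Any n with g ^ n = 1 in the unit group would do; \<open>totient m\<close> is one by
      Euler's theorem.\<close>
    define p where "p j x = (1 / of_nat n) * (\<Sum>k<n. w j ^ k * f (g ^ k * x))" for j x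
    have feq: "f = (\<lambda>x. \<Sum>j<n. p j x)"
    proof
      fix x
      have "(\<Sum>j<n. p j x) = (1 / of_nat n) * (\<Sum>k<n. (\<Sum>j<n. w j ^ k) * f (g ^ k * x))"
        unfolding p_def sum_distrib_left[symmetric] by (subst sum.swap) (simp add: sum_distrib_right)
      also have "(\<Sum>k<n. (\<Sum>j<n. w j ^ k) * f (g ^ k * x)) = (\<Sum>k<n. if k = 0 then of_nat n * f x else 0)"
        unfolding w_def by (intro sum.cong) (auto simp: sum_roots_of_unity)
      finally show "f x = (\<Sum>j<n. p j x)" using n by simp
    qed
    have "P (p j)" if "j < n" for j
    proof (rule insert.IH)
      show "S \<subseteq> U" using insert by auto
      show "unit_function m (p j)"
        unfolding unit_function_def
      proof safe
        fix x
        have "f (g ^ k * (x mod m)) = f (g ^ k * x)" for k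
          by (rule unit_function_cong[OF insert.prems(1)]) (simp add: cong_def mod_mult_right_eq)
        thus "p j (x mod m) = p j x" by (simp add: p_def)
      next
        fix x assume "\<not> coprime x m"
        hence "f (g ^ k * x) = 0" for k using insert.prems(1) by (simp add: unit_function_def)
        thus "p j x = 0" by (simp add: p_def)
      qed
      fix h assume h: "h \<in> U - S"
      show "eig h (p j)"
      proof (cases "h = g")
        case False
        hence "eig h f" using h insert by auto
        then obtain c where c: "\<And>x. f (h * x) = c * f x" by (auto simp: eig_def)
        \<comment> \<open>Translations commute, so the projection keeps the eigenfunction property
          already known for h.\<close>
        have "p j (h * x) = c * p j x" for x
        proof -
          have "f (g ^ k * (h * x)) = c * f (g ^ k * x)" for k
            using c[of "g ^ k * x"] by (simp add: mult_ac)
          thus ?thesis by (simp add: p_def sum_distrib_left mult_ac)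
        qed
        thus ?thesis by (auto simp: eig_def)
      next
        case True
        have wn: "w j ^ n = 1" using n by (simp add: w_def cis_root_power)
        have w0: "w j \<noteq> 0" by (simp add: w_def)
        have "p j (g * x) = inverse (w j) * p j x" for x
        proof -
          define F where "F k = w j ^ k * f (g ^ k * x)" for k
          have "[g ^ n * x = 1 * x] (mod m)"
            unfolding n_def by (intro cong_mult euler_theorem cop cong_refl)
          hence "f (g ^ n * x) = f x" using unit_function_cong[OF insert.prems(1)] by fastforce
          hence Fn: "F n = F 0" using wn by (simp add: F_def)
          have "(\<Sum>k<n. F (Suc k)) + F 0 = (\<Sum>k<n. F k) + F n"
            using sum.lessThan_Suc[of F n] sum.lessThan_Suc_shift[of F n] by (simp add: add.commute)
          hence sh: "(\<Sum>k<n. F (Suc k)) = (\<Sum>k<n. F k)" using Fn by simp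
          have "(\<Sum>k<n. w j ^ k * f (g ^ k * (g * x))) = inverse (w j) * (\<Sum>k<n. F (Suc k))"
            unfolding sum_distrib_left F_def using w0 by (intro sum.cong) (auto simp: mult_ac)
          thus ?thesis unfolding p_def sh by (simp add: F_def)
        qed
        thus ?thesis using True by (auto simp: eig_def)
      qed
    qed
    thus ?case by (subst feq, intro Psum) auto
  qed
  from this[of U f] f show ?thesis by simp
qed

lemma dchar_mult: "dchar m \<psi> \<Longrightarrow> \<psi> (x * y) = \<psi> x * \<psi> y"
  and dchar_1: "dchar m \<psi> \<Longrightarrow> \<psi> 1 = 1"
  and dchar_mod: "dchar m \<psi> \<Longrightarrow> \<psi> (x mod m) = \<psi> x"
  and dchar_eq_0: "dchar m \<psi> \<Longrightarrow> \<not> coprime x m \<Longrightarrow> \<psi> x = 0"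
  by (auto simp: dchar_def unit_function_def)

lemma dchar_cong: "dchar m \<psi> \<Longrightarrow> [x = y] (mod m) \<Longrightarrow> \<psi> x = \<psi> y"
  using unit_function_cong unfolding dchar_def by blast

lemma dchar_power: "dchar m \<psi> \<Longrightarrow> \<psi> (x ^ k) = \<psi> x ^ k"
  by (induction k) (auto simp: dchar_mult dchar_1[unfolded One_nat_def])

text \<open>By Euler's theorem the value is a root of unity.\<close>

lemma norm_dchar:
  assumes "dchar m \<psi>" "m \<ge> 1" "coprime x m"
  shows "norm (\<psi> x) = 1"
proof -
  have "\<psi> x ^ totient m = \<psi> (x ^ totient m)" using assms by (simp add: dchar_power)
  also have "\<dots> = \<psi> 1" by (rule dchar_cong[OF assms(1) euler_theorem[OF assms(3)]])
  finally have "\<psi> x ^ totient m = 1" using assms by (simp add: dchar_def)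
  thus ?thesis using assms(2) power_eq_1_iff by fastforce
qed

lemma norm_dchar_le_1:
  assumes "dchar m \<psi>" "m \<ge> 1"
  shows "norm (\<psi> x) \<le> 1"
  using norm_dchar[OF assms, of x] dchar_eq_0[OF assms(1), of x] by (cases "coprime x m") auto

definition pchar :: "nat \<Rightarrow> nat \<Rightarrow> complex" where
  "pchar m x = (if coprime x m then 1 else 0)"

lemma dchar_pchar: "m \<ge> 1 \<Longrightarrow> dchar m (pchar m)"
  by (auto simp: dchar_def unit_function_def pchar_def)

lemma sum_pchar: "m \<ge> 1 \<Longrightarrow> (\<Sum>r=1..m. pchar m r) = of_nat (totient m)"
proof -
  assume "m \<ge> 1"
  have "(\<Sum>r=1..m. pchar m r) = (\<Sum>r\<in>totatives m. 1)"
    by (intro sum.mono_neutral_cong_right) (auto simp: pchar_def totatives_def)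
  thus ?thesis by (simp add: totient_def)
qed

text \<open>Multiplication by a unit g with \<psi> g different from 1 permutes the residues and
  multiplies the sum by \<psi> g. The range starts at 1 because the continuation below needs
  progressions with a positive first term.\<close>

lemma sum_dchar_nonprincipal:
  assumes \<psi>: "dchar m \<psi>" and m: "m \<ge> 1" and ne: "\<psi> \<noteq> pchar m"
  shows "(\<Sum>r=1..m. \<psi> r) = 0"
proof -
  obtain g where g: "\<psi> g \<noteq> pchar m g" using ne by blast
  hence cop: "coprime g m" using dchar_eq_0[OF \<psi>, of g] by (auto simp: pchar_def split: if_splits)
  hence g1: "\<psi> g \<noteq> 1" using g by (simp add: pchar_def)
  have eq: "(\<Sum>r=1..m. \<psi> r) = (\<Sum>r<m. \<psi> r)"
  proof -
    have "(\<Sum>r<m. \<psi> r) + \<psi> m = (\<Sum>r=1..m. \<psi> r) + \<psi> 0"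
      using sum.atLeast_Suc_atMost[of 0 m \<psi>]
      by (simp add: lessThan_Suc_atMost[symmetric] atLeast0AtMost add.commute)
    moreover have "\<psi> m = \<psi> 0" using dchar_cong[OF \<psi>, of m 0] by (simp add: cong_def)
    ultimately show ?thesis by simp
  qed
  have inj: "inj_on (\<lambda>r. g * r mod m) {..<m}"
  proof (rule inj_onI)
    fix x y assume xy: "x \<in> {..<m}" "y \<in> {..<m}" "g * x mod m = g * y mod m"
    hence "[g * x = g * y] (mod m)" by (simp add: cong_def)
    hence "[x = y] (mod m)" using cop cong_mult_lcancel_nat by blast
    thus "x = y" using xy by (simp add: cong_def)
  qed
  have "(\<lambda>r. g * r mod m) ` {..<m} = {..<m}"
    by (rule endo_inj_surj) (use m inj in auto)
  hence "(\<Sum>r<m. \<psi> r) = (\<Sum>r<m. \<psi> (g * r mod m))"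
    using sum.reindex[OF inj, of \<psi>] by simp
  also have "\<dots> = \<psi> g * (\<Sum>r<m. \<psi> r)"
    using \<psi> by (simp add: dchar_mod dchar_mult sum_distrib_left)
  finally have "(1 - \<psi> g) * (\<Sum>r<m. \<psi> r) = 0" by (simp add: algebra_simps)
  with g1 eq show ?thesis by simp
qed

section \<open>Dirichlet series and their continuation\<close>

text \<open>The sum may start at 0 because \<open>0 powr z\<close> is 0, so the coefficient at 0
  contributes nothing.\<close>

definition dseries :: "(nat \<Rightarrow> complex) \<Rightarrow> complex \<Rightarrow> complex" where
  "dseries a s = (\<Sum>n. a n * of_nat n powr (-s))"

text \<open>Growth below every positive power suffices for absolute convergence in Re s > 1 and,
  unlike boundedness, survives the factors ln n that differentiation and \<open>mangoldt\<close>
  bring in.\<close>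

definition subpoly :: "(nat \<Rightarrow> complex) \<Rightarrow> bool" where
  "subpoly a \<longleftrightarrow> (\<forall>\<delta>>0. (\<lambda>n. norm (a n)) \<in> O(\<lambda>n. real n powr \<delta>))"

lemma norm_of_nat_powr: "norm (of_nat n powr z :: complex) = real n powr Re z"
  by (subst norm_powr_real_powr) auto

lemma subpoly_bounded:
  assumes "\<And>n. norm (a n) \<le> M"
  shows "subpoly a"
  unfolding subpoly_def
proof safe
  fix \<delta> :: real assume "\<delta> > 0"
  hence "(\<lambda>n. real n powr 0) \<in> O(\<lambda>n. real n powr \<delta>)" by real_asymp
  moreover have "(\<lambda>n. norm (a n)) \<in> O(\<lambda>n. real n powr 0)"
    using assms by (intro bigoI[of _ M] eventually_mono[OF eventually_gt_at_top[of 0]]) auto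
  ultimately show "(\<lambda>n. norm (a n)) \<in> O(\<lambda>n. real n powr \<delta>)" by (rule landau_o.big_trans[rotated])
qed

lemma subpoly_mult:
  assumes "subpoly a" "subpoly b"
  shows "subpoly (\<lambda>n. a n * b n)"
  unfolding subpoly_def
proof safe
  fix \<delta> :: real assume "\<delta> > 0"
  hence "(\<lambda>n. norm (a n) * norm (b n)) \<in> O(\<lambda>n. real n powr (\<delta>/2) * real n powr (\<delta>/2))"
    using assms unfolding subpoly_def by (intro landau_o.big.mult) auto
  thus "(\<lambda>n. norm (a n * b n)) \<in> O(\<lambda>n. real n powr \<delta>)"
    by (simp add: norm_mult flip: powr_add)
qed

lemma subpoly_add:
  assumes "subpoly a" "subpoly b"
  shows "subpoly (\<lambda>n. a n + b n)"
  unfolding subpoly_def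
proof safe
  fix \<delta> :: real assume "\<delta> > 0"
  hence "(\<lambda>n. norm (a n) + norm (b n)) \<in> O(\<lambda>n. real n powr \<delta>)"
    using assms unfolding subpoly_def by (intro sum_in_bigo) auto
  moreover have "(\<lambda>n. norm (a n + b n)) \<in> O(\<lambda>n. norm (a n) + norm (b n))"
    by (intro bigoI[of _ 1] always_eventually allI) (simp add: norm_triangle_ineq)
  ultimately show "(\<lambda>n. norm (a n + b n)) \<in> O(\<lambda>n. real n powr \<delta>)" by (rule landau_o.big_trans[rotated])
qed

lemma subpoly_ln: "subpoly (\<lambda>n. of_real (ln (real n)))"
  unfolding subpoly_def
proof safe
  fix \<delta> :: real assume "\<delta> > 0"
  hence "(\<lambda>n. ln (real n)) \<in> O(\<lambda>n. real n powr \<delta>)" by real_asymp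
  thus "(\<lambda>n. norm (of_real (ln (real n)) :: complex)) \<in> O(\<lambda>n. real n powr \<delta>)" by simp
qed

lemma subpoly_le:
  assumes "subpoly b" "\<And>n. norm (a n) \<le> norm (b n)"
  shows "subpoly a"
  unfolding subpoly_def
proof safe
  fix \<delta> :: real assume "\<delta> > 0"
  have "(\<lambda>n. norm (a n)) \<in> O(\<lambda>n. norm (b n))"
    by (intro bigoI[of _ 1]) (use assms in auto)
  with assms \<open>\<delta> > 0\<close> show "(\<lambda>n. norm (a n)) \<in> O(\<lambda>n. real n powr \<delta>)"
    unfolding subpoly_def using landau_o.big_trans by blast
qed

lemma subpoly_mangoldt: "subpoly mangoldt"
proof (rule subpoly_le[OF subpoly_ln])
  fix n :: nat
  show "norm (mangoldt n :: complex) \<le> norm (of_real (ln (real n)) :: complex)"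
    using mangoldt_le[of n] by (cases "n = 0") auto
qed

lemma dseries_summable_norm:
  assumes "subpoly a" "Re s > 1"
  shows "summable (\<lambda>n. norm (a n * of_nat n powr (-s)))"
proof -
  define \<delta> where "\<delta> = (Re s - 1) / 2"
  have \<delta>: "\<delta> > 0" using assms by (simp add: \<delta>_def)
  have "(\<lambda>n. norm (a n) * real n powr (-Re s)) \<in> O(\<lambda>n. real n powr \<delta> * real n powr (-Re s))"
    using assms \<delta> by (intro landau_o.big.mult) (auto simp: subpoly_def)
  hence "(\<lambda>n. norm (a n * of_nat n powr (-s))) \<in> O(\<lambda>n. real n powr (\<delta> - Re s))"
    by (simp add: norm_mult norm_of_nat_powr flip: powr_add)
  moreover have "summable (\<lambda>n. norm (real n powr (\<delta> - Re s)))"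
    using assms by (simp add: summable_real_powr_iff \<delta>_def field_simps)
  ultimately show ?thesis by (rule summable_comparison_test_bigo[rotated])
qed

lemma dseries_summable: "subpoly a \<Longrightarrow> Re s > 1 \<Longrightarrow> summable (\<lambda>n. a n * of_nat n powr (-s))"
  by (rule summable_norm_cancel) (rule dseries_summable_norm)

lemma dseries_has_sum:
  "subpoly a \<Longrightarrow> Re s > 1 \<Longrightarrow> ((\<lambda>n. a n * of_nat n powr (-s)) has_sum dseries a s) UNIV"
  unfolding dseries_def
  by (intro norm_summable_imp_has_sum dseries_summable_norm summable_sums dseries_summable)

text \<open>Termwise differentiation. The local majorant is the series at abscissa Re x - d, with d
  half the distance to the line Re s = 1, where it still converges absolutely.\<close>

lemma dseries_has_field_derivative:
  assumes a: "subpoly a" and s: "Re s > 1"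
  shows "(dseries a has_field_derivative dseries (\<lambda>n. - (of_real (ln (real n)) * a n)) s) (at s)"
proof -
  define S where "S = {s. Re s > 1}"
  have S: "open S" unfolding S_def by (rule open_halfspace_Re_gt)
  have "\<exists>g g'. \<forall>x \<in> S. ((\<lambda>n. a n * of_nat n powr (-x)) sums g x) \<and>
     ((\<lambda>n. - (of_real (ln (real n)) * a n) * of_nat n powr (-x)) sums g' x) \<and> (g has_field_derivative g' x) (at x)"
  proof (rule series_and_derivative_comparison_complex[OF S])
    fix n x assume "x \<in> S"
    show "((\<lambda>x. a n * of_nat n powr (-x)) has_field_derivative - (of_real (ln (real n)) * a n) * of_nat n powr (-x)) (at x)"
    proof (cases "n = 0")
      case False
      have "((\<lambda>x. of_nat n powr (-x)) has_field_derivative (Ln (of_nat n) * of_nat n powr (-x)) * (-1)) (at x)"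
        by (rule DERIV_chain2[OF has_field_derivative_powr_right])
           (use False in \<open>auto intro!: derivative_eq_intros\<close>)
      from DERIV_cmult[OF this, of "a n"] show ?thesis using False by (simp add: mult_ac)
    qed auto
  next
    fix x assume x: "x \<in> S"
    define d where "d = (Re x - 1) / 2"
    define h where "h n = norm (a n * of_nat n powr (-of_real (Re x - d)))" for n
    have d: "d > 0" "Re x - d > 1" using x by (auto simp: d_def S_def field_simps)
    have sh: "summable h" unfolding h_def using d a by (intro dseries_summable_norm) auto
    have le: "norm (a n * of_nat n powr (-y)) \<le> h n" if "y \<in> ball x d" for n y
    proof (cases "n = 0")
      case False
      have "\<bar>Re (x - y)\<bar> < d" using that abs_Re_le_cmod[of "x - y"] by (auto simp: dist_norm)
      hence "Re x - d \<le> Re y" by auto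
      hence "real n powr (-Re y) \<le> real n powr (-(Re x - d))" using False by (intro powr_mono) auto
      thus ?thesis by (simp add: h_def norm_mult norm_of_nat_powr mult_left_mono)
    qed (auto simp: h_def)
    have h0: "h n \<ge> 0" for n by (simp add: h_def)
    have "norm (a n * of_nat n powr (-y)) \<le> norm (complex_of_real (h n))" if "y \<in> ball x d \<inter> S" for n y
    proof -
      have "norm (a n * of_nat n powr (-y)) \<le> h n" using le that by blast
      with h0[of n] show ?thesis by simp
    qed
    hence f1: "\<forall>\<^sub>F n in sequentially. \<forall>y\<in>ball x d \<inter> S. norm (a n * of_nat n powr (-y)) \<le> norm (complex_of_real (h n))"
      by simp
    have f2: "range (\<lambda>n. complex_of_real (h n)) \<subseteq> \<real>\<^sub>\<ge>\<^sub>0" using h0 by auto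
    have f3: "summable (\<lambda>n. complex_of_real (h n))" using sh by simp
    show "\<exists>d (h :: nat \<Rightarrow> complex). 0 < d \<and> summable h \<and> range h \<subseteq> \<real>\<^sub>\<ge>\<^sub>0 \<and>
        (\<forall>\<^sub>F n in sequentially. \<forall>y\<in>ball x d \<inter> S. norm (a n * of_nat n powr (-y)) \<le> norm (h n))"
      by (rule exI[of _ d], rule exI[of _ "\<lambda>n. complex_of_real (h n)"]) (intro conjI d(1) f1 f2 f3)
  qed
  then obtain g g' where g: "\<And>x. x \<in> S \<Longrightarrow> ((\<lambda>n. a n * of_nat n powr (-x)) sums g x)"
    "\<And>x. x \<in> S \<Longrightarrow> ((\<lambda>n. - (of_real (ln (real n)) * a n) * of_nat n powr (-x)) sums g' x)"
    "\<And>x. x \<in> S \<Longrightarrow> (g has_field_derivative g' x) (at x)" by blast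
  have "(g has_field_derivative g' s) (at s)" using s by (intro g) (auto simp: S_def)
  moreover have "g' s = dseries (\<lambda>n. - (of_real (ln (real n)) * a n)) s"
    using g(2)[of s] s unfolding dseries_def S_def by (simp add: sums_iff)
  moreover have "eventually (\<lambda>x. x \<in> S) (nhds s)" using S s by (intro eventually_nhds_in_open) (auto simp: S_def)
  hence "eventually (\<lambda>x. g x = dseries a x) (nhds s)"
    by eventually_elim (use g(1) in \<open>auto simp: sums_iff dseries_def\<close>)
  ultimately show ?thesis using DERIV_cong_ev by fastforce
qed

lemma dseries_holomorphic: "subpoly a \<Longrightarrow> dseries a holomorphic_on {s. Re s > 1}"
  by (rule holomorphic_onI) (auto simp: field_differentiable_def
    intro: has_field_derivative_at_within dseries_has_field_derivative)

text \<open>Absolute convergence turns the product into a double series, which is regrouped by the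
  value n = i * j.\<close>

lemma dseries_mult:
  assumes a: "subpoly a" and b: "subpoly b" and s: "Re s > 1" and ab: "a 0 = 0 \<or> b 0 = 0"
  shows "dseries a s * dseries b s = dseries (\<lambda>n. \<Sum>d | d dvd n. a d * b (n div d)) s"
proof -
  define A where "A n = a n * of_nat n powr (-s)" for n
  define B where "B n = b n * of_nat n powr (-s)" for n
  have A0: "A 0 = 0" and B0: "B 0 = 0" by (auto simp: A_def B_def)
  have sA: "(A has_sum dseries a s) UNIV" and sB: "(B has_sum dseries b s) UNIV"
    unfolding A_def B_def using a b s by (auto intro!: dseries_has_sum)
  have abs: "(\<lambda>n. norm (A n)) summable_on UNIV" "(\<lambda>n. norm (B n)) summable_on UNIV"
    unfolding A_def B_def using norm_summable_imp_summable_on[of "\<lambda>n. norm (a n * of_nat n powr (-s))"]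
       norm_summable_imp_summable_on[of "\<lambda>n. norm (b n * of_nat n powr (-s))"] dseries_summable_norm[OF a s] dseries_summable_norm[OF b s]
    by auto
  have "(\<lambda>p. norm (A (fst p) * B (snd p))) summable_on (SIGMA i:UNIV. UNIV)"
  proof (rule Infinite_Sum.abs_summable_on_Sigma_iff[THEN iffD2], intro conjI ballI)
    show "(\<lambda>y. norm (A (fst (x, y)) * B (snd (x, y)))) summable_on UNIV" for x
      using summable_on_cmult_right[OF abs(2), of "norm (A x)"] by (simp add: norm_mult)
    show "(\<lambda>x. norm (\<Sum>\<^sub>\<infinity>y. norm (A (fst (x, y)) * B (snd (x, y))))) summable_on UNIV"
      using summable_on_cmult_left[OF abs(1), of "\<bar>\<Sum>\<^sub>\<infinity>y. norm (B y)\<bar>"]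
      by (simp add: norm_mult infsum_cmult_right' abs_mult)
  qed
  hence "(\<lambda>(i,j). A i * B j) summable_on UNIV \<times> UNIV"
    using abs_summable_summable by (simp add: case_prod_unfold)
  moreover have "((\<lambda>j. A i * B j) has_sum A i * dseries b s) UNIV" for i
    by (intro has_sum_cmult_right sB)
  moreover have "((\<lambda>i. A i * dseries b s) has_sum dseries a s * dseries b s) UNIV"
    by (intro has_sum_cmult_left sA)
  ultimately have prod: "((\<lambda>(i,j). A i * B j) has_sum dseries a s * dseries b s) (UNIV \<times> UNIV)"
    by (intro has_sum_SigmaI[where g = "\<lambda>i. A i * dseries b s"]) auto
  \<comment> \<open>Index 0 has to be removed first: 0 has infinitely many divisors, and (i, j) is
    recovered from (i * j, i) only for positive i.\<close>
  have "((\<lambda>(i,j). A i * B j) has_sum dseries a s * dseries b s) (UNIV \<times> UNIV) \<longleftrightarrow>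
    ((\<lambda>(i,j). A i * B j) has_sum dseries a s * dseries b s) ({1..} \<times> {1..})"
    by (rule has_sum_cong_neutral) (use A0 B0 in \<open>auto simp: Suc_le_eq intro!: Nat.gr0I\<close>)
  with prod have "((\<lambda>(i,j). A i * B j) has_sum dseries a s * dseries b s) ({1..} \<times> {1..})"
    by simp
  moreover have "((\<lambda>(i,j). A i * B j) has_sum dseries a s * dseries b s) ({1..} \<times> {1..}) \<longleftrightarrow>
     ((\<lambda>(n,d). A d * B (n div d)) has_sum dseries a s * dseries b s) (SIGMA n:{1..}. {d. d dvd n})"
    by (rule has_sum_reindex_bij_witness[of _ "\<lambda>(n,d). (d, n div d)" "\<lambda>(i,j). (i * j, i)"])
       (auto simp: Suc_le_eq div_greater_zero_iff intro: dvd_imp_le dvd_pos_nat)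
  ultimately have "((\<lambda>(n,d). A d * B (n div d)) has_sum dseries a s * dseries b s) (SIGMA n:{1..}. {d. d dvd n})"
    by simp
  hence "((\<lambda>n. \<Sum>d | d dvd n. A d * B (n div d)) has_sum dseries a s * dseries b s) {1..}"
    by (rule has_sum_SigmaD) (simp add: has_sum_finite)
  moreover have "((\<lambda>n. \<Sum>d | d dvd n. A d * B (n div d)) has_sum dseries a s * dseries b s) {1..} \<longleftrightarrow>
    ((\<lambda>n. (\<Sum>d | d dvd n. a d * b (n div d)) * of_nat n powr (-s)) has_sum dseries a s * dseries b s) UNIV"
  proof (rule has_sum_cong_neutral)
    fix n :: nat assume n: "n \<in> {1..} \<inter> UNIV"
    have "A d * B (n div d) = a d * b (n div d) * of_nat n powr (-s)" if "d dvd n" for d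
    proof -
      obtain e where e: "n = d * e" using \<open>d dvd n\<close> by blast
      have "(of_nat n :: complex) powr (-s) = of_nat d powr (-s) * of_nat e powr (-s)"
        unfolding e by (simp add: powr_times_real)
      thus ?thesis using n e by (auto simp: A_def B_def)
    qed
    thus "(\<Sum>d | d dvd n. A d * B (n div d)) = (\<Sum>d | d dvd n. a d * b (n div d)) * of_nat n powr (-s)"
      by (simp add: sum_distrib_right)
  qed (auto simp: not_less_eq_eq)
  ultimately have "((\<lambda>n. (\<Sum>d | d dvd n. a d * b (n div d)) * of_nat n powr (-s)) has_sum dseries a s * dseries b s) UNIV"
    by simp
  from sums_unique[OF has_sum_imp_sums[OF this]] show ?thesis
    by (simp only: dseries_def[of "\<lambda>n. \<Sum>d | d dvd n. a d * b (n div d)"])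
qed

lemma subpoly_dchar: "dchar m \<psi> \<Longrightarrow> m \<ge> 1 \<Longrightarrow> subpoly \<psi>"
  by (rule subpoly_bounded[of _ 1]) (simp add: norm_dchar_le_1)

text \<open>The logarithmic derivative without an Euler product: \<open>mangoldt\<close> summed over
  the divisors of n is ln n, and complete multiplicativity lets the twist by \<psi> pass through the
  convolution.\<close>

lemma dseries_dchar_deriv:
  assumes \<psi>: "dchar m \<psi>" and m: "m \<ge> 1" and s: "Re s > 1"
  shows "(dseries \<psi> has_field_derivative - (dseries \<psi> s * dseries (\<lambda>n. mangoldt n * \<psi> n) s)) (at s)"
proof -
  have sub: "subpoly (\<lambda>n. mangoldt n * \<psi> n)" "subpoly \<psi>"
    "subpoly (\<lambda>n. of_real (ln (real n)) * \<psi> n)"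
    by (rule subpoly_mult subpoly_mangoldt subpoly_ln subpoly_dchar[OF \<psi> m])+
  have "dseries (\<lambda>n. mangoldt n * \<psi> n) s * dseries \<psi> s =
    dseries (\<lambda>n. \<Sum>d | d dvd n. mangoldt d * \<psi> d * \<psi> (n div d)) s"
    by (rule dseries_mult) (use sub s in auto)
  also have "\<dots> = dseries (\<lambda>n. of_real (ln (real n)) * \<psi> n) s"
    unfolding dseries_def
  proof (intro suminf_cong)
    fix n :: nat
    show "(\<Sum>d | d dvd n. mangoldt d * \<psi> d * \<psi> (n div d)) * of_nat n powr - s =
         of_real (ln (real n)) * \<psi> n * of_nat n powr - s"
    proof (cases "n = 0")
      case False
      have "(\<Sum>d | d dvd n. mangoldt d * \<psi> d * \<psi> (n div d)) = (\<Sum>d | d dvd n. mangoldt d) * \<psi> n"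
        unfolding sum_distrib_right
      proof (intro sum.cong refl)
        fix d assume "d \<in> {d. d dvd n}"
        thus "mangoldt d * \<psi> d * \<psi> (n div d) = mangoldt d * \<psi> n"
          using dchar_mult[OF \<psi>, of d "n div d"] by simp
      qed
      thus ?thesis using False by (simp add: mangoldt_sum)
    qed auto
  qed
  finally have eq: "dseries \<psi> s * dseries (\<lambda>n. mangoldt n * \<psi> n) s = dseries (\<lambda>n. of_real (ln (real n)) * \<psi> n) s"
    by (simp add: mult.commute)
  have "dseries (\<lambda>n. - (of_real (ln (real n)) * \<psi> n)) s = - dseries (\<lambda>n. of_real (ln (real n)) * \<psi> n) s"
    using suminf_minus[OF dseries_summable[OF sub(3) s]] by (simp add: dseries_def)
  with dseries_has_field_derivative[OF sub(2) s] eq show ?thesis by simp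
qed

section \<open>Analytic continuation of L-functions to Re s > 0\<close>

lemma dominated_series_holomorphic:
  fixes f :: "nat \<Rightarrow> complex \<Rightarrow> complex"
  assumes S: "open S" and f: "\<And>n. f n holomorphic_on S"
    and dom: "\<And>x. x \<in> S \<Longrightarrow> \<exists>d>0. \<exists>h. summable h \<and> (\<forall>n. \<forall>y\<in>ball x d \<inter> S. norm (f n y) \<le> h n)"
  shows "(\<lambda>s. \<Sum>n. f n s) holomorphic_on S" and "\<And>x. x \<in> S \<Longrightarrow> summable (\<lambda>n. f n x)"
proof -
  obtain g where g: "\<forall>x \<in> S. ((\<lambda>n. f n x) sums g x) \<and> g field_differentiable (at x)"
  proof (rule series_differentiable_comparison_complex[OF S])
    show "f n field_differentiable at x" if "x \<in> S" for n x
      using f S that holomorphic_on_imp_differentiable_at by blast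
  next
    fix x assume x: "x \<in> S"
    obtain d h where d: "d > 0" and h: "summable h" "\<And>n y. y \<in> ball x d \<inter> S \<Longrightarrow> norm (f n y) \<le> h n"
      using dom[OF x] by blast
    have h0: "h n \<ge> 0" for n
      using order_trans[OF norm_ge_zero h(2)[of x n]] x d by simp
    have f1: "\<forall>\<^sub>F n in sequentially. \<forall>y\<in>ball x d \<inter> S. norm (f n y) \<le> norm (complex_of_real (h n))"
    proof (intro always_eventually allI ballI)
      fix n y assume "y \<in> ball x d \<inter> S"
      from h(2)[OF this, of n] h0[of n] show "norm (f n y) \<le> norm (complex_of_real (h n))" by simp
    qed
    have f2: "range (\<lambda>n. complex_of_real (h n)) \<subseteq> \<real>\<^sub>\<ge>\<^sub>0" using h0 by auto
    have f3: "summable (\<lambda>n. complex_of_real (h n))" using h(1) by simp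
    show "\<exists>d (h :: nat \<Rightarrow> complex). 0 < d \<and> summable h \<and> range h \<subseteq> \<real>\<^sub>\<ge>\<^sub>0 \<and>
        (\<forall>\<^sub>F n in sequentially. \<forall>y\<in>ball x d \<inter> S. norm (f n y) \<le> norm (h n))"
      by (rule exI[of _ d], rule exI[of _ "\<lambda>n. complex_of_real (h n)"]) (intro conjI d f1 f2 f3)
  qed
  have eq: "(\<Sum>n. f n s) = g s" if "s \<in> S" for s
    using g that by (auto simp: sums_iff)
  show "summable (\<lambda>n. f n x)" if "x \<in> S" for x
    using g that by (auto simp: sums_iff)
  have "g holomorphic_on S"
    unfolding holomorphic_on_def
  proof
    fix x assume "x \<in> S"
    hence "g field_differentiable at x" using g by blast
    thus "g field_differentiable at x within S" by (rule field_differentiable_at_within)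
  qed
  thus "(\<lambda>s. \<Sum>n. f n s) holomorphic_on S" by (simp add: eq cong: holomorphic_cong)
qed

text \<open>Mean value inequality on a real segment; Re s > -1 makes the bound for the derivative
  largest at the left end u.\<close>

lemma norm_powr_diff_le:
  fixes u x :: real and s :: complex
  assumes u: "0 < u" and x: "u \<le> x" and s: "Re s > -1"
  shows "norm (of_real x powr (-s) - of_real u powr (-s)) \<le> norm s * u powr (-Re s - 1) * (x - u)"
proof -
  define S where "S = closed_segment (complex_of_real u) (complex_of_real x)"
  have S: "\<exists>t. z = of_real t \<and> t \<ge> u" if "z \<in> S" for z
    using that u x unfolding S_def by (auto simp: closed_segment_of_real closed_segment_eq_real_ivl)
  have "norm (of_real x powr (-s) - of_real u powr (-s)) \<le> norm s * u powr (-Re s - 1) * norm (complex_of_real x - of_real u)"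
  proof (rule field_differentiable_bound[of S])
    show "convex S" "of_real x \<in> S" "of_real u \<in> S" by (auto simp: S_def)
    fix z assume "z \<in> S"
    then obtain t where t: "z = of_real t" "t \<ge> u" using S by blast
    have "z \<notin> \<real>\<^sub>\<le>\<^sub>0" unfolding t(1) using t(2) u by simp
    thus "((\<lambda>z. z powr (-s)) has_field_derivative -s * z powr (-s - 1)) (at z within S)"
      by (rule has_field_derivative_at_within[OF has_field_derivative_powr])
    have "norm (z powr (-s - 1)) = t powr (-Re s - 1)"
      using t u by (subst norm_powr_real_powr) auto
    also have "\<dots> \<le> u powr (-Re s - 1)" using t u s by (intro powr_mono2') auto
    finally show "norm (-s * z powr (-s - 1)) \<le> norm s * u powr (-Re s - 1)"
      by (simp add: norm_mult mult_left_mono)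
  qed
  thus ?thesis using x by (simp flip: of_real_diff)
qed

text \<open>The integral of (s - 1) (u powr -s - x powr -s) over [u, u + m], divided by m.\<close>

definition hterm :: "nat \<Rightarrow> nat \<Rightarrow> complex \<Rightarrow> complex" where
  "hterm m u s = (s - 1) * of_nat u powr (-s)
     - (of_nat u powr (1 - s) - of_nat (u + m) powr (1 - s)) / of_nat m"

text \<open>The increment of \<open>F\<close> over [u, u + m] is m times \<open>hterm\<close>, and
  its derivative is s - 1 times a difference of nearby powers. That difference gains one power of u,
  which makes the series converge for Re s > 0 and not only for Re s > 1.\<close>

lemma norm_hterm_le:
  assumes u: "u > 0" and m: "m > 0" and s: "Re s > -1"
  shows "norm (hterm m u s) \<le> norm (s - 1) * norm s * real m * real u powr (-Re s - 1)"
proof -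
  define F where "F z = (s - 1) * of_nat u powr (-s) * z + z powr (1 - s)" for z :: complex
  define S where "S = closed_segment (complex_of_real u) (complex_of_real (u + m))"
  have S: "\<exists>t. z = of_real t \<and> t \<ge> real u \<and> t \<le> real (u + m)" if "z \<in> S" for z
    using that u m unfolding S_def
    by (simp add: closed_segment_of_real closed_segment_eq_real_ivl del: of_nat_add of_real_of_nat_eq) auto
  have "norm (F (of_real (u + m)) - F (of_real u))
     \<le> (norm (s - 1) * norm s * real m * real u powr (-Re s - 1)) * norm (complex_of_real (u + m) - of_real u)"
  proof (rule field_differentiable_bound[of S])
    show "convex S" "complex_of_real (u + m) \<in> S" "complex_of_real u \<in> S" by (auto simp: S_def)
    fix z assume "z \<in> S"
    then obtain t where t: "z = of_real t" "t \<ge> u" "t \<le> real (u + m)" using S by blast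
    have z: "z \<notin> \<real>\<^sub>\<le>\<^sub>0" unfolding t(1) using t(2) u by simp
    have "(F has_field_derivative (s - 1) * of_nat u powr (-s) * 1 + (1 - s) * z powr (1 - s - 1)) (at z)"
      unfolding F_def by (intro DERIV_add DERIV_cmult DERIV_ident has_field_derivative_powr z)
    also have "(s - 1) * of_nat u powr (-s) * 1 + (1 - s) * z powr (1 - s - 1) = (s - 1) * (of_nat u powr (-s) - z powr (-s))"
      by (simp add: algebra_simps)
    finally show "(F has_field_derivative (s - 1) * (of_nat u powr (-s) - z powr (-s))) (at z within S)"
      by (rule has_field_derivative_at_within)
    have "norm (z powr (-s) - of_real (real u) powr (-s)) \<le> norm s * real u powr (-Re s - 1) * (t - real u)"
      unfolding t(1) using t u s by (intro norm_powr_diff_le) auto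
    also have "\<dots> \<le> norm s * real u powr (-Re s - 1) * real m"
      using t by (intro mult_left_mono) auto
    finally have "norm (of_nat u powr (-s) - z powr (-s)) \<le> norm s * real u powr (-Re s - 1) * real m"
      by (simp add: norm_minus_commute)
    from mult_left_mono[OF this, of "norm (s - 1)"]
    show "norm ((s - 1) * (of_nat u powr (-s) - z powr (-s))) \<le> norm (s - 1) * norm s * real m * real u powr (-Re s - 1)"
      by (simp add: norm_mult mult_ac)
  qed
  moreover have "F (of_real (u + m)) - F (of_real u) = of_nat m * hterm m u s"
    using m by (simp add: F_def hterm_def field_simps)
  ultimately show ?thesis using m by (simp add: norm_mult mult_ac)
qed

lemma hterm_holomorphic: "u > 0 \<Longrightarrow> hterm m u holomorphic_on A"
  unfolding hterm_def by (intro holomorphic_intros) auto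

text \<open>This continues s - 1 times the Hurwitz-type series of (k m + r) powr -s; the factor s -
  1 removes the pole at 1. The first term is the telescoped sum of the parts that
  \<open>hterm\<close> subtracts.\<close>

definition Wfun :: "nat \<Rightarrow> nat \<Rightarrow> complex \<Rightarrow> complex" where
  "Wfun m r s = of_nat r powr (1 - s) / of_nat m + (\<Sum>k. hterm m (k * m + r) s)"

lemma
  assumes m: "m > 0" and r: "r > 0"
  shows Wfun_holomorphic: "Wfun m r holomorphic_on {s. Re s > 0}"
    and hterm_summable: "\<And>s. Re s > 0 \<Longrightarrow> summable (\<lambda>k. hterm m (k * m + r) s)"
proof -
  define S where "S = {s. Re s > 0}"
  have S: "open S" unfolding S_def by (rule open_halfspace_Re_gt)
  have holo: "hterm m (k * m + r) holomorphic_on S" for k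
    using r by (intro hterm_holomorphic) auto
  have dom: "\<exists>d>0. \<exists>h. summable h \<and> (\<forall>n. \<forall>y\<in>ball x d \<inter> S. norm (hterm m (n * m + r) y) \<le> h n)"
    if x: "x \<in> S" for x
  proof -
    define d where "d = Re x / 2"
    define M where "M = (norm x + d + 1) * (norm x + d) * real m"
    define h where "h n = M * real (n * m + r) powr (-1 - d)" for n
    have d: "d > 0" using x by (auto simp: d_def S_def)
    have M: "M \<ge> 0" using d by (auto simp: M_def)
    have "summable (\<lambda>n. real (n * m + r) powr (-1 - d))"
    proof (rule summable_comparison_test'[of "\<lambda>n. real n powr (-1 - d)" 1])
      show "summable (\<lambda>n. real n powr (-1 - d))" using d by (simp add: summable_real_powr_iff)
      fix n :: nat assume n: "n \<ge> 1"
      have "n \<le> n * m + r" using m by (cases m) auto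
      hence "real (n * m + r) powr (-1 - d) \<le> real n powr (-1 - d)"
        using n d by (intro powr_mono2') (auto simp del: of_nat_add of_nat_mult)
      thus "norm (real (n * m + r) powr (-1 - d)) \<le> real n powr (-1 - d)" by simp
    qed
    hence sh: "summable h" unfolding h_def by (rule summable_mult)
    have le: "norm (hterm m (n * m + r) y) \<le> h n" if "y \<in> ball x d \<inter> S" for n y
    proof -
      have "norm (y - x) < d" using that by (auto simp: dist_norm norm_minus_commute)
      hence y: "norm y \<le> norm x + d" "norm (y - 1) \<le> norm x + d + 1" "\<bar>Re (y - x)\<bar> < d"
        using norm_triangle_ineq[of "y - x" x] norm_triangle_ineq4[of y 1] abs_Re_le_cmod[of "y - x"] by auto
      have Rey: "Re y \<ge> d" using y(3) by (simp add: d_def abs_if split: if_splits)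
      have "norm (hterm m (n * m + r) y) \<le> norm (y - 1) * norm y * real m * real (n * m + r) powr (-Re y - 1)"
        using Rey d r m by (intro norm_hterm_le) auto
      also have "\<dots> \<le> M * real (n * m + r) powr (-1 - d)"
      proof (intro mult_mono)
        show "norm (y - 1) * norm y * real m \<le> M" unfolding M_def using y d by (intro mult_mono) auto
        have "real (n * m + r) \<ge> 1" using r by linarith
        thus "real (n * m + r) powr (-Re y - 1) \<le> real (n * m + r) powr (-1 - d)"
          using Rey by (intro powr_mono) (auto simp del: of_nat_add of_nat_mult)
      qed (use M in auto)
      finally show ?thesis by (simp only: h_def)
    qed
    show ?thesis
      by (rule exI[of _ d], rule conjI[OF d], rule exI[of _ h]) (use sh le in blast)
  qed
  show "summable (\<lambda>k. hterm m (k * m + r) s)" if "Re s > 0" for s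
    by (rule dominated_series_holomorphic(2)[OF S holo dom]) (use that in \<open>auto simp: S_def\<close>)
  have "(\<lambda>s. \<Sum>k. hterm m (k * m + r) s) holomorphic_on S"
    by (rule dominated_series_holomorphic(1)[OF S holo dom])
  thus "Wfun m r holomorphic_on {s. Re s > 0}"
    unfolding Wfun_def S_def[symmetric] using r m by (intro holomorphic_intros) auto
qed

lemma Wfun_sums:
  assumes m: "m > 0" and r: "r > 0" and s: "Re s > 1"
  shows "(\<lambda>k. (s - 1) * of_nat (k * m + r) powr (-s)) sums Wfun m r s"
proof -
  define f where "f k = of_nat (k * m + r) powr (1 - s) / of_nat m" for k
  have "f \<longlonglongrightarrow> 0"
  proof (rule tendsto_norm_zero_cancel)
    have "(\<lambda>k. (real k * real m + real r) powr (1 - Re s) / real m) \<longlonglongrightarrow> 0"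
      using m r s by real_asymp
    thus "(\<lambda>k. norm (f k)) \<longlonglongrightarrow> 0"
      by (simp add: f_def norm_divide norm_of_nat_powr flip: of_nat_mult of_nat_add)
  qed
  from telescope_sums'[OF this] have "(\<lambda>k. f k - f (Suc k)) sums f 0" by simp
  moreover have "(\<lambda>k. hterm m (k * m + r) s) sums (\<Sum>k. hterm m (k * m + r) s)"
    using hterm_summable[OF m r, of s] s by (intro summable_sums) auto
  ultimately have "(\<lambda>k. (f k - f (Suc k)) + hterm m (k * m + r) s) sums (f 0 + (\<Sum>k. hterm m (k * m + r) s))"
    by (rule sums_add)
  moreover have "(f k - f (Suc k)) + hterm m (k * m + r) s = (s - 1) * of_nat (k * m + r) powr (-s)" for k
    by (simp add: f_def hterm_def diff_divide_distrib algebra_simps)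
  ultimately show ?thesis by (simp add: Wfun_def f_def)
qed

lemma Wfun_1:
  assumes m: "m > 0" and r: "r > 0"
  shows "Wfun m r 1 = 1 / of_nat m"
proof -
  have "hterm m (k * m + r) 1 = 0" for k
    using r by (simp add: hterm_def flip: of_nat_mult of_nat_add)
  thus ?thesis using r by (simp add: Wfun_def)
qed

lemma Wfun_cnj:
  assumes m: "m > 0" and r: "r > 0" and s: "Re s > 0"
  shows "Wfun m r (cnj s) = cnj (Wfun m r s)"
proof -
  have cnj_powr_nat: "cnj (of_nat n powr z) = of_nat n powr cnj z" for n z
    by (subst cnj_powr) auto
  have "cnj (hterm m u s) = hterm m u (cnj s)" for u
    by (simp add: hterm_def cnj_powr_nat del: of_nat_add)
  hence "cnj (\<Sum>k. hterm m (k * m + r) s) = (\<Sum>k. hterm m (k * m + r) (cnj s))"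
    using bounded_linear.suminf[OF bounded_linear_cnj hterm_summable[OF m r s]] by simp
  thus ?thesis by (simp add: Wfun_def cnj_powr_nat)
qed

text \<open>For a character this is s - 1 times its L-function. The value at 1 is the mean of \<psi>
  over the residues and decides whether the L-function has a pole there.\<close>

definition Lam :: "nat \<Rightarrow> (nat \<Rightarrow> complex) \<Rightarrow> complex \<Rightarrow> complex" where
  "Lam m \<psi> s = (\<Sum>r=1..m. \<psi> r * Wfun m r s)"

lemma Lam_holomorphic: "m > 0 \<Longrightarrow> Lam m \<psi> holomorphic_on {s. Re s > 0}"
  unfolding Lam_def by (intro holomorphic_intros Wfun_holomorphic) auto

lemma Lam_1: "m > 0 \<Longrightarrow> Lam m \<psi> 1 = (\<Sum>r=1..m. \<psi> r) / of_nat m"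
  unfolding Lam_def sum_divide_distrib by (intro sum.cong) (auto simp: Wfun_1)

lemma Lam_cnj: "m > 0 \<Longrightarrow> Re s > 0 \<Longrightarrow> Lam m (\<lambda>x. cnj (\<psi> x)) (cnj s) = cnj (Lam m \<psi> s)"
  by (simp add: Lam_def Wfun_cnj)

lemma Lam_eq_dseries:
  assumes \<psi>: "dchar m \<psi>" and m: "m > 0" and s: "Re s > 1"
  shows "Lam m \<psi> s = (s - 1) * dseries \<psi> s"
proof -
  define f where "f n = \<psi> (Suc n) * of_nat (Suc n) powr (-s)" for n
  have "(\<lambda>n. \<psi> n * of_nat n powr (-s)) sums dseries \<psi> s"
    unfolding dseries_def using \<psi> m s by (intro summable_sums dseries_summable subpoly_dchar[of m]) auto
  hence "f sums dseries \<psi> s" unfolding f_def by (subst sums_Suc_iff) simp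
  hence "(\<lambda>k. sum f {k * m..<k * m + m}) sums dseries \<psi> s" using m by (rule sums_group)
  hence 1: "(\<lambda>k. (s - 1) * sum f {k * m..<k * m + m}) sums ((s - 1) * dseries \<psi> s)" by (rule sums_mult)
  have "(\<lambda>k. \<Sum>r=1..m. \<psi> r * ((s - 1) * of_nat (k * m + r) powr (-s))) sums Lam m \<psi> s"
    unfolding Lam_def using m s by (intro sums_sum sums_mult Wfun_sums) auto
  moreover have "(\<Sum>r=1..m. \<psi> r * ((s - 1) * of_nat (k * m + r) powr (-s))) = (s - 1) * sum f {k * m..<k * m + m}" for k
    unfolding sum_distrib_left
  proof (rule sum.reindex_bij_witness[of _ "\<lambda>n. n + 1 - k * m" "\<lambda>r. k * m + r - 1"])
    fix r assume r: "r \<in> {1..m}"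
    have "\<psi> (k * m + r) = \<psi> r" by (rule dchar_cong[OF \<psi>]) (simp add: cong_def)
    thus "(s - 1) * f (k * m + r - 1) = \<psi> r * ((s - 1) * of_nat (k * m + r) powr - s)"
      using r by (simp add: f_def algebra_simps)
  qed auto
  ultimately show ?thesis using 1 sums_unique2 by simp
qed

text \<open>With g a primitive of the series of mangoldt n * \<psi> n, the product of
  \<open>dseries \<psi>\<close> and exp g has derivative 0, so one zero would force a zero at 2.
  There the terms after the first sum to at most pi^2 / 6 - 1 < 1 in norm.\<close>

lemma dseries_dchar_nonzero:
  assumes \<psi>: "dchar m \<psi>" and m: "m \<ge> 1" and s: "Re s > 1"
  shows "dseries \<psi> s \<noteq> 0"
proof
  assume zero: "dseries \<psi> s = 0"
  define S where "S = {s. Re s > 1}"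
  have S: "open S" "convex S" unfolding S_def by (rule open_halfspace_Re_gt convex_halfspace_Re_gt)+
  have "subpoly (\<lambda>n. mangoldt n * \<psi> n)"
    by (rule subpoly_mult subpoly_mangoldt subpoly_dchar[OF \<psi> m])+
  hence "dseries (\<lambda>n. mangoldt n * \<psi> n) holomorphic_on S" unfolding S_def by (rule dseries_holomorphic)
  then obtain g where "\<And>x. x \<in> S \<Longrightarrow> (g has_field_derivative dseries (\<lambda>n. mangoldt n * \<psi> n) x) (at x within S)"
    using holomorphic_convex_primitive'[OF S(2) S(1)] by blast
  hence g: "(g has_field_derivative dseries (\<lambda>n. mangoldt n * \<psi> n) x) (at x)" if "x \<in> S" for x
    using that S at_within_open by metis
  have "((\<lambda>x. dseries \<psi> x * exp (g x)) has_field_derivative 0) (at x within S)" if "x \<in> S" for x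
  proof (rule has_field_derivative_at_within)
    show "((\<lambda>x. dseries \<psi> x * exp (g x)) has_field_derivative 0) (at x)"
      using that dseries_dchar_deriv[OF \<psi> m, of x] g[OF that]
      by (auto intro!: derivative_eq_intros simp: S_def)
  qed
  hence "\<exists>c. \<forall>x\<in>S. dseries \<psi> x * exp (g x) = c"
    by (rule has_field_derivative_zero_constant[OF S(2)])
  then obtain c where c: "\<And>x. x \<in> S \<Longrightarrow> dseries \<psi> x * exp (g x) = c" by blast
  from c[of s] zero s have "c = 0" by (simp add: S_def)
  with c[of 2] have zero2: "dseries \<psi> 2 = 0" by (simp add: S_def)
  define f where "f n = \<psi> (Suc n) * of_nat (Suc n) powr (-2)" for n
  have "(\<lambda>n. \<psi> n * of_nat n powr (-2)) sums dseries \<psi> 2"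
    unfolding dseries_def using \<psi> m s by (intro summable_sums dseries_summable subpoly_dchar[of m]) auto
  hence "f sums 0" unfolding f_def zero2 by (subst sums_Suc_iff) simp
  hence "(\<lambda>n. f (Suc n)) sums (-1)"
    using dchar_1[OF \<psi>] by (subst sums_Suc_iff) (simp add: f_def)
  moreover have sq: "(\<lambda>n. 1 / (real (Suc n) + 1)^2) sums (pi\<^sup>2 / 6 - 1)"
    using inverse_squares_sums by (subst sums_Suc_iff) (simp add: add.commute)
  moreover have "norm (f (Suc n)) \<le> 1 / (real (Suc n) + 1)^2" for n
  proof -
    have "norm (f (Suc n)) \<le> 1 * (real (Suc (Suc n))) powr (-2)"
      unfolding f_def norm_mult norm_of_nat_powr using norm_dchar_le_1[OF \<psi> m]
      by (intro mult_mono) auto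
    also have "\<dots> = 1 / (real (Suc n) + 1)^2"
      by (simp add: powr_minus divide_simps add.commute flip: powr_numeral)
    finally show ?thesis .
  qed
  ultimately have "norm (-1 :: complex) \<le> pi\<^sup>2 / 6 - 1"
    using norm_suminf_le[of "\<lambda>n. f (Suc n)" "\<lambda>n. 1 / (real (Suc n) + 1)^2"] by (simp add: sums_iff)
  hence "12 \<le> pi\<^sup>2" by simp
  moreover have "pi\<^sup>2 \<le> 3.2\<^sup>2" using pi_approx(2) by (intro power_mono) (auto simp: pi_ge_zero)
  ultimately show False by (simp add: power2_eq_square)
qed

section \<open>Nonvanishing on the line Re s = 1\<close>

lemma dseries_minus_has_field_derivative:
  assumes "subpoly a" "Re (2 - w) > 1"
  shows "((\<lambda>w. dseries a (2 - w)) has_field_derivative dseries (\<lambda>n. of_real (ln (real n)) * a n) (2 - w)) (at w)"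
proof -
  have "((\<lambda>w. dseries a (2 - w)) has_field_derivative dseries (\<lambda>n. - (of_real (ln (real n)) * a n)) (2 - w) * (-1)) (at w)"
    by (rule DERIV_chain2[where g = "\<lambda>w. 2 - w" and x = w, OF dseries_has_field_derivative[OF assms]]) (auto intro!: derivative_eq_intros)
  moreover have "subpoly (\<lambda>n. of_real (ln (real n)) * a n)" by (rule subpoly_mult subpoly_ln assms)+
  from suminf_minus[OF dseries_summable[OF this assms(2)]]
  have "dseries (\<lambda>n. - (of_real (ln (real n)) * a n)) (2 - w) = - dseries (\<lambda>n. of_real (ln (real n)) * a n) (2 - w)"
    by (simp add: dseries_def)
  ultimately show ?thesis by simp
qed

lemma subpoly_ln_power: "subpoly a \<Longrightarrow> subpoly (\<lambda>n. of_real (ln (real n)) ^ k * a n)"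
proof (induction k)
  case (Suc k)
  hence "subpoly (\<lambda>n. of_real (ln (real n)) * (of_real (ln (real n)) ^ k * a n))"
    by (intro subpoly_mult[OF subpoly_ln]) auto
  thus ?case by (simp add: mult.assoc)
qed auto

text \<open>In the variable w = 2 - s every derivative multiplies the coefficients by + ln n, so
  nonnegative coefficients give nonnegative derivatives without alternating signs.\<close>

lemma higher_deriv_dseries_minus:
  assumes "subpoly a" "w \<in> ball 0 1"
  shows "(deriv ^^ k) (\<lambda>w. dseries a (2 - w)) w = dseries (\<lambda>n. of_real (ln (real n)) ^ k * a n) (2 - w)"
  using assms(2)
proof (induction k arbitrary: w)
  case (Suc k)
  have "Re w < 1" using Suc.prems abs_Re_le_cmod[of w] by auto
  hence w: "Re (2 - w) > 1" by simp
  have "(deriv ^^ Suc k) (\<lambda>w. dseries a (2 - w)) w = deriv ((deriv ^^ k) (\<lambda>w. dseries a (2 - w))) w" by simp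
  also have "\<dots> = deriv (\<lambda>w. dseries (\<lambda>n. of_real (ln (real n)) ^ k * a n) (2 - w)) w"
  proof (rule deriv_cong_ev)
    have "eventually (\<lambda>w. w \<in> ball 0 1) (nhds w)" using Suc.prems by (intro eventually_nhds_in_open) auto
    thus "eventually (\<lambda>w. (deriv ^^ k) (\<lambda>w. dseries a (2 - w)) w = dseries (\<lambda>n. of_real (ln (real n)) ^ k * a n) (2 - w)) (nhds w)"
      by eventually_elim (use Suc.IH in auto)
  qed auto
  also have "\<dots> = dseries (\<lambda>n. of_real (ln (real n)) * (of_real (ln (real n)) ^ k * a n)) (2 - w)"
    by (rule DERIV_imp_deriv[OF dseries_minus_has_field_derivative[OF subpoly_ln_power[OF assms(1)] w]])
  finally show ?case by (simp add: mult.assoc)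
qed auto

text \<open>Landau's argument: all Taylor coefficients at 2 of the logarithmic derivative (in the variable 2 - s)
  are nonnegative and dominated by those of the derivative of G, so they converge as far as G is holomorphic.\<close>

lemma landau_summable:
  fixes a :: "nat \<Rightarrow> real"
  assumes a0: "\<And>n. a n \<ge> 0" and sub: "subpoly (\<lambda>n. of_real (a n))"
    and G: "G holomorphic_on {s. Re s > 0}" and G2: "G 2 = of_real c" "c > 0"
    and deriv: "\<And>s. Re s > 1 \<Longrightarrow> (G has_field_derivative - (dseries (\<lambda>n. of_real (a n)) s * G s)) (at s)"
  shows "summable (\<lambda>n. a n * real n powr (-1/2))"
proof -
  define A where "A n = complex_of_real (a n)" for n
  define g where "g w = G (2 - w)" for w
  define q where "q w = dseries A (2 - w)" for w
  have subA: "subpoly A" using sub by (simp add: A_def[abs_def])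
  have g_holo: "g holomorphic_on ball 0 2"
    unfolding g_def
  proof (rule holomorphic_on_compose_gen[OF _ G, unfolded o_def])
    show "(\<lambda>w. 2 - w) holomorphic_on ball 0 2" by (intro holomorphic_intros)
    show "(\<lambda>w. 2 - w) ` ball 0 2 \<subseteq> {s. 0 < Re s}"
    proof safe
      fix w :: complex assume "w \<in> ball 0 2"
      thus "Re (2 - w) > 0" using abs_Re_le_cmod[of w] by auto
    qed
  qed
  have Re_ball: "Re (2 - w) > 1" if "w \<in> ball 0 1" for w
    using that abs_Re_le_cmod[of w] by auto
  have q_holo: "q holomorphic_on ball 0 1"
    unfolding q_def holomorphic_on_def field_differentiable_def
    using dseries_minus_has_field_derivative[OF subA Re_ball] has_field_derivative_at_within by blast
  define FG where "FG = fps_expansion g 0"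
  define FQ where "FQ = fps_expansion q 0"
  have FG: "g has_fps_expansion FG" unfolding FG_def
    by (rule has_fps_expansion_fps_expansion[OF _ _ g_holo]) auto
  have FQ: "q has_fps_expansion FQ" unfolding FQ_def
    by (rule has_fps_expansion_fps_expansion[OF _ _ q_holo]) auto
  have dg: "deriv g w = q w * g w" if "w \<in> ball 0 1" for w
  proof -
    have "(g has_field_derivative - (dseries A (2 - w) * G (2 - w)) * (-1)) (at w)"
      unfolding g_def A_def
      by (rule DERIV_chain2[where g = "\<lambda>w. 2 - w" and x = w, OF deriv[OF Re_ball[OF that]]]) (auto intro!: derivative_eq_intros)
    thus ?thesis by (simp add: DERIV_imp_deriv q_def g_def)
  qed
  have "eventually (\<lambda>w. w \<in> ball 0 1) (nhds (0 :: complex))" by (intro eventually_nhds_in_open) auto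
  hence ev: "eventually (\<lambda>w. deriv g w = q w * g w) (nhds 0)" by eventually_elim (rule dg)
  have "deriv g has_fps_expansion fps_deriv FG" by (rule has_fps_expansion_deriv[OF FG])
  hence "(\<lambda>w. q w * g w) has_fps_expansion fps_deriv FG"
    using has_fps_expansion_cong[OF ev refl] by simp
  moreover have "(\<lambda>w. q w * g w) has_fps_expansion FQ * FG" by (rule has_fps_expansion_mult[OF FQ FG])
  ultimately have ode: "fps_deriv FG = FQ * FG" by (rule fps_expansion_unique_complex)
  define e where "e k = (\<Sum>n. ln (real n) ^ k * a n * real n powr (-2)) / fact k" for k
  have sume: "summable (\<lambda>n. ln (real n) ^ k * a n * real n powr (-2))" for k
  proof -
    have "summable (\<lambda>n. norm (of_real (ln (real n)) ^ k * A n * of_nat n powr (-2)))"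
      by (rule dseries_summable_norm[OF subpoly_ln_power[OF subA]]) auto
    moreover have "norm (of_real (ln (real n)) ^ k * A n * of_nat n powr (-2)) = ln (real n) ^ k * a n * real n powr (-2)" for n
      using a0[of n] by (cases "n = 0") (simp_all add: norm_mult norm_power norm_of_nat_powr A_def)
    ultimately show ?thesis by simp
  qed
  have e0: "e k \<ge> 0" for k
  proof -
    have "ln (real n) ^ k * a n * real n powr (-2) \<ge> 0" for n
      using a0[of n] by (cases "n = 0") auto
    thus ?thesis unfolding e_def by (intro divide_nonneg_pos suminf_nonneg sume) auto
  qed
  have FQ_nth: "fps_nth FQ k = of_real (e k)" for k
  proof -
    have "fps_nth FQ k = dseries (\<lambda>n. of_real (ln (real n)) ^ k * A n) 2 / fact k"
      unfolding FQ_def fps_expansion_def q_def using higher_deriv_dseries_minus[OF subA, of 0 k] by simp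
    also have "dseries (\<lambda>n. of_real (ln (real n)) ^ k * A n) 2 =
        (\<Sum>n. complex_of_real (ln (real n) ^ k * a n * real n powr (-2)))"
      unfolding dseries_def A_def
    proof (intro suminf_cong)
      fix n
      have "complex_of_nat n powr (-2) = of_real (real n powr (-2))"
        using powr_of_real[of "real n" "-2"] by simp
      thus "of_real (ln (real n)) ^ k * complex_of_real (a n) * of_nat n powr (-2) =
        of_real (ln (real n) ^ k * a n * real n powr (-2))" by simp
    qed
    also have "\<dots> = of_real (\<Sum>n. ln (real n) ^ k * a n * real n powr (-2))"
      by (rule suminf_of_real[OF sume, symmetric])
    finally show ?thesis by (simp add: e_def)
  qed
  define d where "d k = Re (fps_nth FG k)" for k
  have FG0: "fps_nth FG 0 = of_real c" unfolding FG_def fps_expansion_def by (simp add: g_def G2)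
  have rec: "of_nat (Suc k) * fps_nth FG (Suc k) = (\<Sum>i=0..k. of_real (e i) * fps_nth FG (k - i))" for k
    using arg_cong[OF ode, of "\<lambda>F. fps_nth F k"] by (simp add: fps_mult_nth FQ_nth)
  \<comment> \<open>The formal equation determines each coefficient of \<open>FG\<close> from the
    previous ones: starting from c > 0, they are sums of products of nonnegative numbers.\<close>
  have FG_d: "fps_nth FG k = of_real (d k) \<and> d k \<ge> 0" for k
  proof (induction k rule: less_induct)
    case (less k)
    show ?case
    proof (cases k)
      case 0
      thus ?thesis using FG0 G2 by (simp add: d_def)
    next
      case (Suc j)
      define S where "S = (\<Sum>i=0..j. e i * d (j - i))"
      have "of_nat (Suc j) * fps_nth FG (Suc j) = (\<Sum>i=0..j. of_real (e i) * fps_nth FG (j - i))" by (rule rec)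
      also have "\<dots> = of_real S" unfolding S_def of_real_sum of_real_mult
        by (intro sum.cong refl) (use less Suc in simp)
      finally have "fps_nth FG (Suc j) = of_real (S / real (Suc j))"
        by (simp add: field_simps del: of_nat_Suc)
      moreover have "S \<ge> 0" unfolding S_def using less Suc e0 by (intro sum_nonneg mult_nonneg_nonneg) auto
      ultimately show ?thesis using Suc by (simp add: d_def)
    qed
  qed
  \<comment> \<open>Only the summand i = k of the recursion, which is e k * d 0, is kept.\<close>
  have dom: "e k * c \<le> real (Suc k) * d (Suc k)" for k
  proof -
    have "of_real (real (Suc k) * d (Suc k)) = complex_of_real (\<Sum>i=0..k. e i * d (k - i))"
      using rec[of k] FG_d by simp
    hence "real (Suc k) * d (Suc k) = (\<Sum>i=0..k. e i * d (k - i))" by (simp only: of_real_eq_iff)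
    moreover have "(\<Sum>i\<in>{k}. e i * d (k - i)) \<le> (\<Sum>i=0..k. e i * d (k - i))"
      using e0 FG_d by (intro sum_mono2) auto
    moreover have "d 0 = c" using FG0 by (simp add: d_def)
    ultimately show ?thesis by simp
  qed
  have "eball 0 (ereal 2) = (ball 0 2 :: complex set)" by (auto simp: eball_def)
  hence "ereal 2 \<le> fps_conv_radius FG"
    unfolding FG_def using conv_radius_fps_expansion[of g 0 "ereal 2"] g_holo by simp
  also have "\<dots> \<le> fps_conv_radius (fps_deriv FG)" by (rule fps_conv_radius_deriv)
  \<comment> \<open>The point w = 3/2 lies in the disc of radius 2 on which \<open>g\<close> is
    holomorphic. It is s = 1/2, whence the exponent -1/2 of the conclusion.\<close>
  finally have "norm (3/2 :: complex) < fps_conv_radius (fps_deriv FG)" by (rule less_le_trans[rotated]) simp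
  hence "summable (\<lambda>k. fps_nth (fps_deriv FG) k * (3/2) ^ k)" by (rule summable_fps)
  hence "summable (\<lambda>k. Re (fps_nth (fps_deriv FG) k * (3/2) ^ k))" by (rule summable_Re)
  also have "(\<lambda>k. Re (fps_nth (fps_deriv FG) k * (3/2) ^ k)) = (\<lambda>k. real (Suc k) * d (Suc k) * (3/2) ^ k)"
  proof
    fix k
    have "fps_nth (fps_deriv FG) k * (3/2) ^ k = of_real (real (Suc k) * d (Suc k) * (3/2) ^ k)"
      using FG_d by simp
    thus "Re (fps_nth (fps_deriv FG) k * (3/2) ^ k) = real (Suc k) * d (Suc k) * (3/2) ^ k"
      by (simp only: Re_complex_of_real)
  qed
  finally have "summable (\<lambda>k. real (Suc k) * d (Suc k) * (3/2) ^ k)" .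
  hence "summable (\<lambda>k. (e k * c) * (3/2) ^ k)"
  proof (rule summable_comparison_test'[of _ 0])
    fix k
    show "norm (e k * c * (3/2) ^ k) \<le> real (Suc k) * d (Suc k) * (3/2) ^ k"
      using dom[of k] e0[of k] G2 by (simp add: mult_right_mono)
  qed
  from summable_mult[OF this, of "1 / c"] have sum_e: "summable (\<lambda>k. e k * (3/2) ^ k)"
    using G2 by simp
  show ?thesis
  proof (rule summableI_nonneg_bounded)
    show "0 \<le> a n * real n powr (-1/2)" for n using a0 by simp
    fix N
    \<comment> \<open>Terms of the exponential series of n powr (3/2), times a n * n powr -2. Summed
      over k they give a n * n powr (-1/2); summed over n they stay below e k * (3/2) ^ k.\<close>
    define t where "t n k = ln (real n) ^ k * a n * real n powr (-2) / fact k * (3/2) ^ k" for n k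
    have t: "t n sums (a n * real n powr (-1/2))" for n
    proof (cases "n = 0")
      case False
      have "(\<lambda>k. (3/2 * ln (real n)) ^ k /\<^sub>R fact k) sums exp (3/2 * ln (real n))" by (rule exp_converges)
      from sums_mult[OF this, of "a n * real n powr (-2)"]
      have "t n sums (a n * real n powr (-2) * exp (3/2 * ln (real n)))"
        by (simp only: t_def[abs_def] power_mult_distrib divide_inverse real_scaleR_def mult_ac)
      also have "a n * real n powr (-2) * exp (3/2 * ln (real n)) = a n * (real n powr (-2) * real n powr (3/2))"
        using False by (simp add: powr_def)
      finally show ?thesis by (simp flip: powr_add)
    qed (simp add: t_def[abs_def])
    have "(\<Sum>n<N. a n * real n powr (-1/2)) = (\<Sum>k. \<Sum>n<N. t n k)"
      using sums_sum[of "{..<N}" t "\<lambda>n. a n * real n powr (-1/2)"] t by (simp add: sums_iff)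
    also have "\<dots> \<le> (\<Sum>k. e k * (3/2) ^ k)"
    proof (rule suminf_le[OF _ _ sum_e])
      show "summable (\<lambda>k. \<Sum>n<N. t n k)" using t by (intro summable_sum) (auto simp: sums_iff)
      fix k
      have "(\<Sum>n<N. ln (real n) ^ k * a n * real n powr (-2)) \<le> (\<Sum>n. ln (real n) ^ k * a n * real n powr (-2))"
      proof (intro sum_le_suminf sume)
        fix n show "0 \<le> ln (real n) ^ k * a n * real n powr (-2)" using a0[of n] by (cases "n = 0") auto
      qed auto
      hence "(\<Sum>n<N. ln (real n) ^ k * a n * real n powr (-2)) / fact k * (3/2) ^ k \<le> e k * (3/2) ^ k"
        unfolding e_def by (intro mult_right_mono divide_right_mono) auto
      thus "(\<Sum>n<N. t n k) \<le> e k * (3/2) ^ k" by (simp add: t_def sum_distrib_right sum_divide_distrib)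
    qed
    finally show "(\<Sum>n<N. a n * real n powr (-1/2)) \<le> (\<Sum>k. e k * (3/2) ^ k)" .
  qed
qed

lemma DERIV_transfer_nhds:
  assumes "(f has_field_derivative D) (at x)" "eventually (\<lambda>x. g x = f x) (nhds x)"
  shows "(g has_field_derivative D) (at x)"
  using DERIV_cong_ev[OF refl assms(2) refl, of D] assms(1) by blast

lemma dseries_shift: "dseries a (s + c) = dseries (\<lambda>n. a n * of_nat n powr (-c)) s"
  unfolding dseries_def
proof (intro suminf_cong)
  fix n :: nat
  show "a n * of_nat n powr (- (s + c)) = a n * of_nat n powr (-c) * of_nat n powr (-s)"
    by (cases "n = 0") (auto simp: powr_add[symmetric] algebra_simps)
qed

lemma dseries_add:
  "subpoly a \<Longrightarrow> subpoly b \<Longrightarrow> Re s > 1 \<Longrightarrow> dseries (\<lambda>n. a n + b n) s = dseries a s + dseries b s"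
  using suminf_add[OF dseries_summable dseries_summable, of a s b s] by (simp add: dseries_def algebra_simps)

lemma dseries_cmult: "subpoly a \<Longrightarrow> Re s > 1 \<Longrightarrow> dseries (\<lambda>n. c * a n) s = c * dseries a s"
  using suminf_mult[OF dseries_summable, of a s c] by (simp add: dseries_def mult.assoc)

lemma dseries_cnj:
  assumes "subpoly a" "Re s > 1"
  shows "cnj (dseries a (cnj s)) = dseries (\<lambda>n. cnj (a n)) s"
proof -
  have "cnj (dseries a (cnj s)) = (\<Sum>n. cnj (a n * of_nat n powr (-cnj s)))"
    unfolding dseries_def using assms by (intro bounded_linear.suminf[OF bounded_linear_cnj] dseries_summable) auto
  moreover have "cnj (a n * of_nat n powr (-cnj s)) = cnj (a n) * of_nat n powr (-s)" for n
    by (subst complex_cnj_mult, subst cnj_powr) auto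
  ultimately show ?thesis unfolding dseries_def by (simp only:)
qed

lemma mangoldt_power2:
  fixes n :: nat
  assumes "primepow n"
  shows "mangoldt (n ^ 2) = (mangoldt n :: real)"
proof -
  obtain p k where "prime p" "k > 0" "n = p ^ k" using assms unfolding primepow_def by blast
  thus ?thesis by (simp flip: power_mult)
qed

text \<open>This reflects the pole of the principal L-function. Convergence would bound
  \<open>Q\<close> as s tends to 1 from the right, and the identity (s - 1) L' = L - (s - 1) L Q,
  with \<open>L\<close> the L-function times s - 1, would give L 1 = 0; but L 1 = totient m /
  m.\<close>

lemma mangoldt_pchar_not_summable:
  assumes m: "m \<ge> 1"
  shows "\<not> summable (\<lambda>n. mangoldt n * Re (pchar m n) / real n)"
proof
  assume summ: "summable (\<lambda>n. mangoldt n * Re (pchar m n) / real n)"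
  define C where "C = (\<Sum>n. mangoldt n * Re (pchar m n) / real n)"
  define L where "L = Lam m (pchar m)"
  define Q where "Q = dseries (\<lambda>n. mangoldt n * pchar m n)"
  have p: "dchar m (pchar m)" using m by (rule dchar_pchar)
  have QC: "norm (Q (of_real \<sigma>)) \<le> C" if "\<sigma> > 1" for \<sigma>
    unfolding Q_def C_def dseries_def
  proof (intro norm_suminf_le summ)
    fix n :: nat
    show "norm (mangoldt n * pchar m n * of_nat n powr - complex_of_real \<sigma>) \<le> mangoldt n * Re (pchar m n) / real n"
    proof (cases "n = 0")
      case False
      have "real n powr (-\<sigma>) \<le> real n powr (-1)" using that False by (intro powr_mono) auto
      hence "real n powr (-\<sigma>) \<le> 1 / real n" by (simp add: powr_minus field_simps)
      hence "mangoldt n * Re (pchar m n) * real n powr (-\<sigma>) \<le> mangoldt n * Re (pchar m n) * (1 / real n)"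
        by (intro mult_left_mono) (auto simp: pchar_def mangoldt_nonneg)
      thus ?thesis by (cases "coprime n m") (simp_all add: norm_mult norm_of_nat_powr pchar_def)
    qed auto
  qed
  have holo: "L holomorphic_on {s. Re s > 0}" unfolding L_def using m by (intro Lam_holomorphic) auto
  have holo': "deriv L holomorphic_on {s. Re s > 0}"
    by (rule holomorphic_deriv[OF holo open_halfspace_Re_gt])
  have eq: "(of_real \<sigma> - 1) * deriv L (of_real \<sigma>) = L (of_real \<sigma>) - (of_real \<sigma> - 1) * L (of_real \<sigma>) * Q (of_real \<sigma>)"
    if "\<sigma> > 1" for \<sigma>
  proof -
    have Re: "Re (complex_of_real \<sigma>) > 1" using that by simp
    have "((\<lambda>s. (s - 1) * dseries (pchar m) s) has_field_derivative
       (1 * dseries (pchar m) (of_real \<sigma>) + - (dseries (pchar m) (of_real \<sigma>) * Q (of_real \<sigma>)) * (of_real \<sigma> - 1))) (at (of_real \<sigma>))"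
      unfolding Q_def by (intro DERIV_mult dseries_dchar_deriv[OF p m Re]) (auto intro!: derivative_eq_intros)
    moreover have "eventually (\<lambda>s. s \<in> {s. Re s > 1}) (nhds (complex_of_real \<sigma>))"
      using that by (intro eventually_nhds_in_open open_halfspace_Re_gt) auto
    hence "eventually (\<lambda>s. L s = (s - 1) * dseries (pchar m) s) (nhds (of_real \<sigma>))"
      by eventually_elim (use Lam_eq_dseries[OF p] m in \<open>auto simp: L_def\<close>)
    ultimately have "(L has_field_derivative
       (1 * dseries (pchar m) (of_real \<sigma>) + - (dseries (pchar m) (of_real \<sigma>) * Q (of_real \<sigma>)) * (of_real \<sigma> - 1))) (at (of_real \<sigma>))"
      by (rule DERIV_transfer_nhds)
    hence A: "deriv L (of_real \<sigma>) = dseries (pchar m) (of_real \<sigma>) + - (dseries (pchar m) (of_real \<sigma>) * Q (of_real \<sigma>)) * (of_real \<sigma> - 1)"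
      by (simp add: DERIV_imp_deriv)
    have B: "L (of_real \<sigma>) = (of_real \<sigma> - 1) * dseries (pchar m) (of_real \<sigma>)"
      unfolding L_def using Lam_eq_dseries[OF p _ Re] m by auto
    show ?thesis unfolding A B by (simp add: algebra_simps)
  qed
  define x where "x n = complex_of_real (1 + 1 / real (Suc n))" for n
  have x: "x \<longlonglongrightarrow> 1"
  proof -
    have "(\<lambda>n. 1 + 1 / real (Suc n)) \<longlonglongrightarrow> 1" by real_asymp
    from tendsto_of_real[OF this, where 'a = complex] show ?thesis by (simp only: x_def[abs_def] of_real_1)
  qed
  have Lx: "(\<lambda>n. L (x n)) \<longlonglongrightarrow> L 1" and dLx: "(\<lambda>n. deriv L (x n)) \<longlonglongrightarrow> deriv L 1"
    by (intro continuous_on_tendsto_compose[OF holomorphic_on_imp_continuous_on[OF holo] x]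
          continuous_on_tendsto_compose[OF holomorphic_on_imp_continuous_on[OF holo'] x];
        simp add: x_def add_pos_pos del: of_real_add)+
  have x1: "(\<lambda>n. x n - 1) \<longlonglongrightarrow> 0" using tendsto_diff[OF x tendsto_const[of 1]] by simp
  have Qb: "eventually (\<lambda>n. norm (Q (x n)) \<le> C) sequentially"
    using QC by (intro always_eventually) (auto simp: x_def simp del: of_real_add)
  have "(\<lambda>n. (x n - 1) * L (x n)) \<longlonglongrightarrow> 0" using tendsto_mult[OF x1 Lx] by simp
  from lim_null_mult_right_bounded[OF this Qb]
  have "(\<lambda>n. (x n - 1) * L (x n) * Q (x n)) \<longlonglongrightarrow> 0" .
  hence "(\<lambda>n. L (x n) - (x n - 1) * L (x n) * Q (x n)) \<longlonglongrightarrow> L 1 - 0" by (intro tendsto_diff Lx)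
  moreover have "(\<lambda>n. L (x n) - (x n - 1) * L (x n) * Q (x n)) = (\<lambda>n. (x n - 1) * deriv L (x n))"
    using eq by (auto simp: x_def simp del: of_real_add)
  moreover have "(\<lambda>n. (x n - 1) * deriv L (x n)) \<longlonglongrightarrow> 0" using tendsto_mult[OF x1 dLx] by simp
  ultimately have "L 1 = 0" using LIMSEQ_unique by fastforce
  thus False using m sum_pchar[OF m] by (simp add: L_def Lam_1)
qed

text \<open>That \<open>H\<close> has no singularities means that zeros have cancelled all poles of
  the product. Adding the conjugate of the logarithmic derivative makes its coefficients real, and
  they are nonnegative because z n has norm at most 1. Landau's argument gives convergence at 1/2,
  and the terms at n and n^2 together dominate the divergent series of
  \<open>mangoldt_pchar_not_summable\<close>.\<close>

lemma no_pole_cancellation: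
  assumes \<psi>: "dchar m \<psi>" and m: "m \<ge> 1"
    and H: "H holomorphic_on {s. Re s > 0}"
    and H_eq: "\<And>s. Re s > 1 \<Longrightarrow> H s = dseries (pchar m) s * dseries \<psi> (s + \<i> * of_real \<alpha>)"
  shows False
proof -
  \<comment> \<open>Coefficients of the shifted series: completely multiplicative, and of norm 1 at
    positive n coprime to m.\<close>
  define z where "z n = \<psi> n * of_nat n powr (-\<i> * of_real \<alpha>)" for n
  define b where "b n = mangoldt n * (pchar m n + z n)" for n
  define a where "a n = mangoldt n * (2 * Re (pchar m n) + 2 * Re (z n))" for n
  have p: "dchar m (pchar m)" using m by (rule dchar_pchar)
  have z_le: "norm (z n) \<le> 1" for n
    using norm_dchar_le_1[OF \<psi> m, of n] by (cases "n = 0") (auto simp: z_def norm_mult norm_of_nat_powr)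
  have z_not: "z n = 0" if "\<not> coprime n m" for n using dchar_eq_0[OF \<psi> that] by (simp add: z_def)
  have z1: "norm (z n) = 1" if "coprime n m" "n > 0" for n
    using norm_dchar[OF \<psi> m that(1)] that(2) by (simp add: z_def norm_mult norm_of_nat_powr)
  have z_sq: "z (n ^ 2) = z n ^ 2" for n
  proof -
    have "(of_nat (n ^ 2) :: complex) powr (-\<i> * of_real \<alpha>) = (of_nat n powr (-\<i> * of_real \<alpha>)) ^ 2"
      by (simp add: power2_eq_square powr_times_real)
    thus ?thesis using dchar_power[OF \<psi>, of n 2] by (simp add: z_def power_mult_distrib)
  qed
  have sz: "subpoly z" using z_le by (rule subpoly_bounded)
  have sp: "subpoly (pchar m)" using p m by (rule subpoly_dchar)
  have sb: "subpoly b" unfolding b_def by (rule subpoly_mult subpoly_mangoldt subpoly_add sp sz)+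
  have sb': "subpoly (\<lambda>n. cnj (b n))" by (rule subpoly_le[OF sb]) simp
  have ab: "complex_of_real (a n) = b n + cnj (b n)" for n
    by (simp add: complex_eq_iff a_def b_def algebra_simps)
  have sa: "subpoly (\<lambda>n. of_real (a n))" unfolding ab by (rule subpoly_add[OF sb sb'])
  have a_nonneg: "a n \<ge> 0" for n
  proof (cases "coprime n m")
    case True
    have "Re (z n) \<ge> -1" using z_le[of n] abs_Re_le_cmod[of "z n"] by linarith
    thus ?thesis using True by (simp add: a_def pchar_def mangoldt_nonneg)
  qed (simp add: a_def pchar_def z_not)
  have H_deriv: "(H has_field_derivative - (H s * dseries b s)) (at s)" if s: "Re s > 1" for s
  proof -
    have s': "Re (s + \<i> * of_real \<alpha>) > 1" using s by simp
    have d2: "((\<lambda>s. dseries \<psi> (s + \<i> * of_real \<alpha>)) has_field_derivative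
       - (dseries \<psi> (s + \<i> * of_real \<alpha>) * dseries (\<lambda>n. mangoldt n * \<psi> n) (s + \<i> * of_real \<alpha>)) * 1) (at s)"
      by (rule DERIV_chain2[where g = "\<lambda>s. s + \<i> * of_real \<alpha>" and x = s, OF dseries_dchar_deriv[OF \<psi> m s']])
         (auto intro!: derivative_eq_intros)
    have "((\<lambda>s. dseries (pchar m) s * dseries \<psi> (s + \<i> * of_real \<alpha>)) has_field_derivative
        - (dseries (pchar m) s * dseries (\<lambda>n. mangoldt n * pchar m n) s) * dseries \<psi> (s + \<i> * of_real \<alpha>) +
        - (dseries \<psi> (s + \<i> * of_real \<alpha>) * dseries (\<lambda>n. mangoldt n * \<psi> n) (s + \<i> * of_real \<alpha>)) * 1 * dseries (pchar m) s) (at s)"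
      by (rule DERIV_mult[OF dseries_dchar_deriv[OF p m s] d2])
    moreover have "eventually (\<lambda>s. s \<in> {s. Re s > 1}) (nhds s)"
      using s by (intro eventually_nhds_in_open open_halfspace_Re_gt) auto
    hence "eventually (\<lambda>s. H s = dseries (pchar m) s * dseries \<psi> (s + \<i> * of_real \<alpha>)) (nhds s)"
      by eventually_elim (use H_eq in auto)
    ultimately have *: "(H has_field_derivative
        - (dseries (pchar m) s * dseries (\<lambda>n. mangoldt n * pchar m n) s) * dseries \<psi> (s + \<i> * of_real \<alpha>) +
        - (dseries \<psi> (s + \<i> * of_real \<alpha>) * dseries (\<lambda>n. mangoldt n * \<psi> n) (s + \<i> * of_real \<alpha>)) * 1 * dseries (pchar m) s) (at s)"
      by (rule DERIV_transfer_nhds)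
    have "dseries b s = dseries (\<lambda>n. mangoldt n * pchar m n + mangoldt n * z n) s"
      by (simp add: b_def[abs_def] algebra_simps)
    also have "\<dots> = dseries (\<lambda>n. mangoldt n * pchar m n) s + dseries (\<lambda>n. mangoldt n * z n) s"
      by (rule dseries_add[OF subpoly_mult[OF subpoly_mangoldt sp] subpoly_mult[OF subpoly_mangoldt sz] s])
    also have "dseries (\<lambda>n. mangoldt n * z n) s = dseries (\<lambda>n. mangoldt n * \<psi> n) (s + \<i> * of_real \<alpha>)"
      unfolding dseries_shift by (simp add: z_def mult.assoc)
    finally have b_eq: "dseries b s = dseries (\<lambda>n. mangoldt n * pchar m n) s + dseries (\<lambda>n. mangoldt n * \<psi> n) (s + \<i> * of_real \<alpha>)" .
    show ?thesis using * unfolding b_eq H_eq[OF s] by (simp add: algebra_simps)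
  qed
  \<comment> \<open>The reflected conjugate factor contributes the conjugate coefficients to the
    logarithmic derivative and makes \<open>G 2\<close> a positive real number.\<close>
  define G where "G s = H s * cnj (H (cnj s))" for s
  have "cnj ` {s. Re s > 0} = {s. Re s > 0}" by (auto simp: image_iff intro!: exI[of _ "cnj _"])
  hence "cnj \<circ> H \<circ> cnj holomorphic_on {s. Re s > 0}"
    using H by (intro holomorphic_on_compose_cnj_cnj open_halfspace_Re_gt) auto
  hence "(\<lambda>s. cnj (H (cnj s))) holomorphic_on {s. Re s > 0}" by (simp add: o_def)
  hence G_holo: "G holomorphic_on {s. Re s > 0}" unfolding G_def by (intro holomorphic_intros H)
  have G2: "G 2 = of_real ((norm (H 2))\<^sup>2)" unfolding G_def complex_norm_square by simp
  have "H 2 \<noteq> 0" using H_eq[of 2] dseries_dchar_nonzero[OF p m] dseries_dchar_nonzero[OF \<psi> m] by simp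
  hence G2_pos: "(norm (H 2))\<^sup>2 > 0" by simp
  have G_deriv: "(G has_field_derivative - (dseries (\<lambda>n. of_real (a n)) s * G s)) (at s)" if s: "Re s > 1" for s
  proof -
    have "((cnj \<circ> H \<circ> cnj) has_field_derivative cnj (- (H (cnj s) * dseries b (cnj s)))) (at s)"
      using s by (intro has_field_derivative_cnj_cnj H_deriv) auto
    hence "((\<lambda>s. cnj (H (cnj s))) has_field_derivative cnj (- (H (cnj s) * dseries b (cnj s)))) (at s)"
      by (simp add: o_def)
    from DERIV_mult[OF H_deriv[OF s] this]
    have "(G has_field_derivative - (H s * dseries b s) * cnj (H (cnj s)) + cnj (- (H (cnj s) * dseries b (cnj s))) * H s) (at s)"
      unfolding G_def .
    also have "cnj (- (H (cnj s) * dseries b (cnj s))) = - (cnj (H (cnj s)) * dseries (\<lambda>n. cnj (b n)) s)"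
      using dseries_cnj[OF sb s] by simp
    also have "- (H s * dseries b s) * cnj (H (cnj s)) + - (cnj (H (cnj s)) * dseries (\<lambda>n. cnj (b n)) s) * H s =
      - ((dseries b s + dseries (\<lambda>n. cnj (b n)) s) * G s)" by (simp add: G_def algebra_simps)
    also have "dseries b s + dseries (\<lambda>n. cnj (b n)) s = dseries (\<lambda>n. of_real (a n)) s"
      unfolding ab by (rule dseries_add[OF sb sb' s, symmetric])
    finally show ?thesis .
  qed
  define f where "f n = a n * real n powr (-1/2)" for n
  have f_summable: "summable f" unfolding f_def
    by (rule landau_summable[OF a_nonneg sa G_holo G2 G2_pos G_deriv])
  have f_nonneg: "f n \<ge> 0" for n using a_nonneg by (simp add: f_def)
  \<comment> \<open>The terms at squares form a subseries of a convergent nonnegative series. They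
    matter because (n^2) powr (-1/2) is exactly 1 / n.\<close>
  have "strict_mono (\<lambda>n::nat. n ^ 2)" by (auto intro!: strict_monoI power_strict_mono)
  hence "summable (\<lambda>n. f (n ^ 2))"
    using summable_reindex[OF f_summable, of "\<lambda>n. n ^ 2"] f_nonneg by (auto simp: o_def strict_mono_imp_inj_on)
  from summable_add[OF f_summable this] have S: "summable (\<lambda>n. f n + f (n ^ 2))" .
  have N: "norm (mangoldt n * Re (pchar m n) / real n) \<le> f n + f (n ^ 2)" for n
  proof (cases "coprime n m \<and> primepow n")
    case False
    have "mangoldt n * Re (pchar m n) = 0" using False by (auto simp: mangoldt_def pchar_def)
    thus ?thesis using f_nonneg[of n] f_nonneg[of "n ^ 2"] by (simp only:) simp
  next
    case True
    hence n: "n > 0" "coprime n m" "primepow n" by (auto intro!: Nat.gr0I)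
    define x where "x = Re (z n)"
    have "x\<^sup>2 + (Im (z n))\<^sup>2 = 1" using z1[OF n(2,1)] by (simp add: x_def cmod_def)
    hence "Re (z (n ^ 2)) = 2 * x\<^sup>2 - 1" unfolding z_sq by (simp add: x_def power2_eq_square)
    moreover have "mangoldt (n ^ 2) = (mangoldt n :: real)" by (rule mangoldt_power2[OF n(3)])
    moreover have "pchar m (n ^ 2) = 1" using n by (simp add: pchar_def)
    ultimately have a2: "a (n ^ 2) = mangoldt n * (4 * x\<^sup>2)" by (simp add: a_def)
    have a1: "a n = mangoldt n * (2 + 2 * x)" using n by (simp add: a_def x_def pchar_def)
    have half: "(-1/2 :: real) = - (1/2)" by simp
    have "real (n ^ 2) powr (-1/2) = 1 / sqrt (real n ^ 2)"
      unfolding half powr_minus by (subst powr_half_sqrt) (simp_all add: inverse_eq_divide)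
    also have "\<dots> = 1 / real n" by simp
    finally have f2: "f (n ^ 2) = mangoldt n * (4 * x\<^sup>2) / real n" by (simp add: f_def a2)
    have "real n powr (-1) \<le> real n powr (-1/2)" using n by (intro powr_mono) auto
    moreover have "real n powr (-1) = 1 / real n" using n by (simp add: powr_minus_divide)
    ultimately have "1 / real n \<le> real n powr (-1/2)" by (simp only:)
    hence "a n * (1 / real n) \<le> f n" unfolding f_def using a_nonneg by (intro mult_left_mono) auto
    hence "mangoldt n * (2 + 2 * x + 4 * x\<^sup>2) / real n \<le> f n + f (n ^ 2)"
      unfolding f2 a1 by (simp add: add_divide_distrib algebra_simps)
    \<comment> \<open>The right-hand side is (2 x + 1/2)^2 + 7/4: the coefficients at n and at n^2
      are never both small.\<close>
    moreover have "1 \<le> 2 + 2 * x + 4 * x\<^sup>2"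
      using sum_power2_ge_zero[of "2 * x + 1/2" 0] by (simp add: power2_eq_square algebra_simps)
    hence "mangoldt n * 1 / real n \<le> mangoldt n * (2 + 2 * x + 4 * x\<^sup>2) / real n"
      by (intro divide_right_mono mult_left_mono) (auto simp: mangoldt_nonneg)
    ultimately show ?thesis using n by (simp add: pchar_def mangoldt_nonneg)
  qed
  have "summable (\<lambda>n. mangoldt n * Re (pchar m n) / real n)"
    by (rule summable_comparison_test'[OF S, of 0]) (rule N)
  thus False using mangoldt_pchar_not_summable[OF m] by contradiction
qed

lemma removable_zero:
  assumes "f holomorphic_on {s. Re s > 0}" "f a = 0"
  shows "\<exists>g. g holomorphic_on {s. Re s > 0} \<and> (\<forall>s. s \<noteq> a \<longrightarrow> g s = f s / (s - a))"
  using pole_lemma_open[OF assms(1) open_halfspace_Re_gt, of a] assms(2)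
  by (intro exI[of _ "\<lambda>z. if z = a then deriv f a else (f z - f a) / (z - a)"]) auto

lemma holomorphic_compose_shift:
  assumes "f holomorphic_on {s. Re s > 0}"
  shows "(\<lambda>s. f (s + \<i> * of_real \<alpha>)) holomorphic_on {s. Re s > 0}"
  by (rule holomorphic_on_compose_gen[OF _ assms, unfolded o_def]) (auto intro!: holomorphic_intros)

lemma Re_ge_1_cases:
  assumes "Re s \<ge> 1"
  obtains "Re s > 1" | "s = 1" | \<alpha> where "\<alpha> \<noteq> 0" "s = 1 + \<i> * of_real \<alpha>"
proof (cases "Re s > 1")
  case False
  hence "s = 1 + \<i> * of_real (Im s)" using assms by (simp add: complex_eq_iff)
  thus ?thesis using that(2,3) by (cases "Im s = 0") auto
qed (use that in auto)

text \<open>For s = 1 + i \<alpha> with \<alpha> nonzero, the product of the L-function and its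
  shift has poles at 1 and at 1 - i \<alpha>. Since \<open>pchar m\<close> is real, a zero at 1 + i
  \<alpha> comes with one at 1 - i \<alpha>. The first, shifted, cancels the pole at 1; the second
  cancels the pole of the shifted factor.\<close>

lemma Lam_pchar_nonzero:
  assumes m: "m \<ge> 1" and s: "Re s \<ge> 1"
  shows "Lam m (pchar m) s \<noteq> 0"
  using s
proof (cases rule: Re_ge_1_cases)
  case 1
  have "Lam m (pchar m) s = (s - 1) * dseries (pchar m) s"
    by (rule Lam_eq_dseries) (use 1 m dchar_pchar in auto)
  thus ?thesis using dseries_dchar_nonzero[OF dchar_pchar[OF m] m 1] 1 by auto
next
  case 2
  thus ?thesis using m sum_pchar[OF m] by (simp add: Lam_1)
next
  case (3 \<alpha>)
  define L where "L = Lam m (pchar m)"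
  have holo: "L holomorphic_on {s. Re s > 0}" unfolding L_def using m by (intro Lam_holomorphic) auto
  have L_eq: "L s = (s - 1) * dseries (pchar m) s" if "Re s > 1" for s
    unfolding L_def by (rule Lam_eq_dseries) (use that m dchar_pchar in auto)
  show ?thesis
  proof
    assume "Lam m (pchar m) s = 0"
    hence zero: "L (1 + \<i> * of_real \<alpha>) = 0" using 3 by (simp add: L_def)
    have "(\<lambda>x. cnj (pchar m x)) = pchar m" by (auto simp: pchar_def fun_eq_iff)
    hence "cnj (L (1 + \<i> * of_real \<alpha>)) = L (cnj (1 + \<i> * of_real \<alpha>))"
      using Lam_cnj[of m "1 + \<i> * of_real \<alpha>" "pchar m"] m by (simp add: L_def)
    hence zero': "L (1 - \<i> * of_real \<alpha>) = 0" using zero by simp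
    obtain g where g: "g holomorphic_on {s. Re s > 0}" "\<And>s. s \<noteq> 1 - \<i> * of_real \<alpha> \<Longrightarrow> g s = L s / (s - (1 - \<i> * of_real \<alpha>))"
      using removable_zero[OF holo zero'] by blast
    obtain h where h: "h holomorphic_on {s. Re s > 0}" "\<And>s. s \<noteq> 1 \<Longrightarrow> h s = L (s + \<i> * of_real \<alpha>) / (s - 1)"
      using removable_zero[OF holomorphic_compose_shift[OF holo], of 1] zero by blast
    show False
    proof (rule no_pole_cancellation[OF dchar_pchar[OF m] m])
      show "(\<lambda>s. g s * h s) holomorphic_on {s. Re s > 0}" by (intro holomorphic_intros g h)
      fix s assume s: "Re s > 1"
      have ne: "s - (1 - \<i> * of_real \<alpha>) \<noteq> 0" "s - 1 \<noteq> 0" using s by (auto simp: complex_eq_iff)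
      have "L (s + \<i> * of_real \<alpha>) = (s - (1 - \<i> * of_real \<alpha>)) * dseries (pchar m) (s + \<i> * of_real \<alpha>)"
        using L_eq[of "s + \<i> * of_real \<alpha>"] s by (simp add: algebra_simps)
      thus "g s * h s = dseries (pchar m) s * dseries (pchar m) (s + \<i> * of_real \<alpha>)"
        using ne g(2)[of s] h(2)[of s] L_eq[OF s] by auto
    qed
  qed
qed

text \<open>Here only the principal factor has a pole, at 1, and a zero of L at 1 + i \<alpha>
  becomes a zero of the shifted function at 1. The case \<alpha> = 0 is included, so real characters
  get no separate treatment.\<close>

lemma nonprincipal_L_function:
  assumes \<psi>: "dchar m \<psi>" and m: "m \<ge> 1" and ne: "\<psi> \<noteq> pchar m"
  obtains L where "L holomorphic_on {s. Re s > 0}" "\<And>s. Re s > 1 \<Longrightarrow> L s = dseries \<psi> s"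
    "\<And>s. Re s \<ge> 1 \<Longrightarrow> L s \<noteq> 0"
proof -
  have holo: "Lam m \<psi> holomorphic_on {s. Re s > 0}" using m by (intro Lam_holomorphic) auto
  have "Lam m \<psi> 1 = 0" using m sum_dchar_nonprincipal[OF \<psi> m ne] by (simp add: Lam_1)
  from removable_zero[OF holo this]
  obtain L where L: "L holomorphic_on {s. Re s > 0}" "\<And>s. s \<noteq> 1 \<Longrightarrow> L s = Lam m \<psi> s / (s - 1)"
    by blast
  have L_eq: "L s = dseries \<psi> s" if s: "Re s > 1" for s
  proof -
    have "s \<noteq> 1" using s by auto
    thus ?thesis using L(2)[of s] Lam_eq_dseries[OF \<psi> _ s] m by auto
  qed
  have nz: "L (1 + \<i> * of_real \<alpha>) \<noteq> 0" for \<alpha>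
  proof
    assume zero: "L (1 + \<i> * of_real \<alpha>) = 0"
    obtain h where h: "h holomorphic_on {s. Re s > 0}" "\<And>s. s \<noteq> 1 \<Longrightarrow> h s = L (s + \<i> * of_real \<alpha>) / (s - 1)"
      using removable_zero[OF holomorphic_compose_shift[OF L(1)], of 1] zero by blast
    show False
    proof (rule no_pole_cancellation[OF \<psi> m])
      show "(\<lambda>s. Lam m (pchar m) s * h s) holomorphic_on {s. Re s > 0}"
        using m by (intro holomorphic_intros h Lam_holomorphic) auto
      fix s assume s: "Re s > 1"
      have "s \<noteq> 1" using s by auto
      moreover have "Lam m (pchar m) s = (s - 1) * dseries (pchar m) s"
        by (rule Lam_eq_dseries) (use s m dchar_pchar in auto)
      ultimately show "Lam m (pchar m) s * h s = dseries (pchar m) s * dseries \<psi> (s + \<i> * of_real \<alpha>)"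
        using h(2)[of s] L_eq[of "s + \<i> * of_real \<alpha>"] s by auto
    qed
  qed
  show ?thesis
  proof (rule that[OF L(1) L_eq])
    fix s assume "Re s \<ge> 1"
    thus "L s \<noteq> 0"
    proof (cases rule: Re_ge_1_cases)
      case 1
      thus ?thesis using L_eq dseries_dchar_nonzero[OF \<psi> m] by auto
    qed (use nz[of 0] nz in auto)
  qed auto
qed

section \<open>Boundary behaviour of the logarithmic derivatives\<close>

definition zeta_series :: "complex \<Rightarrow> complex" where
  "zeta_series = dseries (\<lambda>_. 1)"

lemma zeta_series_pole:
  obtains Z where "Z holomorphic_on {s. Re s > 0}" "\<And>s. Re s > 1 \<Longrightarrow> zeta_series s = 1 / (s - 1) + Z s"
proof -
  have p1: "pchar 1 = (\<lambda>_. 1)" by (auto simp: pchar_def)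
  define L where "L = Lam 1 (\<lambda>_. 1)"
  have "(\<lambda>s. L s - 1) holomorphic_on {s. Re s > 0}" unfolding L_def by (intro holomorphic_intros Lam_holomorphic) auto
  moreover have "L 1 - 1 = 0" by (simp add: L_def Lam_1)
  ultimately obtain Z where Z: "Z holomorphic_on {s. Re s > 0}" "\<And>s. s \<noteq> 1 \<Longrightarrow> Z s = (L s - 1) / (s - 1)"
    using removable_zero by blast
  show ?thesis
  proof (rule that[OF Z(1)])
    fix s assume s: "Re s > 1"
    have "L s = (s - 1) * zeta_series s"
      using Lam_eq_dseries[OF dchar_pchar[of 1], of s] s by (simp add: p1[unfolded One_nat_def] L_def zeta_series_def)
    moreover have "s - 1 \<noteq> 0" using s by auto
    ultimately show "zeta_series s = 1 / (s - 1) + Z s" using Z(2)[of s] by (simp add: field_simps)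
  qed
qed

text \<open>Up to the pole of \<open>zeta_series\<close>, taken with the mean of f over the units as
  factor, the series of mangoldt n * f n extends continuously to Re s = 1. The condition is
  preserved by sums and multiples of f, so that \<open>unit_function_induct\<close> applies to
  it.\<close>

definition boundary_regular :: "nat \<Rightarrow> (nat \<Rightarrow> complex) \<Rightarrow> bool" where
  "boundary_regular m f \<longleftrightarrow> (\<exists>M. \<forall>n. norm (f n) \<le> M) \<and> (\<exists>E. continuous_on {s. Re s \<ge> 1} E \<and>
     (\<forall>s. Re s > 1 \<longrightarrow> E s = dseries (\<lambda>n. mangoldt n * f n) s
        - (\<Sum>r=1..m. f r) / of_nat (totient m) * zeta_series s))"

text \<open>For a nonprincipal character -L'/L is itself continuous. In the principal case L
  contains the factor s - 1, whose logarithmic derivative 1 / (s - 1) is matched by the pole of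
  \<open>zeta_series\<close>.\<close>

lemma boundary_regular_dchar:
  assumes \<psi>: "dchar m \<psi>" and m: "m \<ge> 1"
  shows "boundary_regular m \<psi>"
proof -
  have sub: "{s. Re s \<ge> 1} \<subseteq> {s. Re s > 0}" by auto
  note cont = continuous_on_subset[OF holomorphic_on_imp_continuous_on sub]
  have "\<exists>E. continuous_on {s. Re s \<ge> 1} E \<and> (\<forall>s. Re s > 1 \<longrightarrow> E s = dseries (\<lambda>n. mangoldt n * \<psi> n) s
        - (\<Sum>r=1..m. \<psi> r) / of_nat (totient m) * zeta_series s)"
  proof (cases "\<psi> = pchar m")
    case False
    obtain L where L: "L holomorphic_on {s. Re s > 0}" "\<And>s. Re s > 1 \<Longrightarrow> L s = dseries \<psi> s"
      "\<And>s. Re s \<ge> 1 \<Longrightarrow> L s \<noteq> 0" using nonprincipal_L_function[OF \<psi> m False] by blast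
    show ?thesis
    proof (intro exI[of _ "\<lambda>s. - (deriv L s / L s)"] conjI allI impI)
      show "continuous_on {s. Re s \<ge> 1} (\<lambda>s. - (deriv L s / L s))"
        using L(3) by (intro continuous_intros cont holomorphic_deriv L open_halfspace_Re_gt) auto
      fix s assume s: "Re s > 1"
      have "eventually (\<lambda>s. s \<in> {s. Re s > 1}) (nhds s)"
        using s by (intro eventually_nhds_in_open open_halfspace_Re_gt) auto
      hence "eventually (\<lambda>s. L s = dseries \<psi> s) (nhds s)" by eventually_elim (use L in auto)
      from DERIV_transfer_nhds[OF dseries_dchar_deriv[OF \<psi> m s] this]
      have "deriv L s = - (dseries \<psi> s * dseries (\<lambda>n. mangoldt n * \<psi> n) s)" by (rule DERIV_imp_deriv)
      moreover have "L s = dseries \<psi> s" by (rule L(2)[OF s])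
      moreover have "L s \<noteq> 0" by (rule L(3)) (use s in simp)
      ultimately show "- (deriv L s / L s) = dseries (\<lambda>n. mangoldt n * \<psi> n) s
        - (\<Sum>r=1..m. \<psi> r) / of_nat (totient m) * zeta_series s"
        using sum_dchar_nonprincipal[OF \<psi> m False] by simp
    qed
  next
    case True
    define L where "L = Lam m (pchar m)"
    have holo: "L holomorphic_on {s. Re s > 0}" unfolding L_def using m by (intro Lam_holomorphic) auto
    have nz: "L s \<noteq> 0" if "Re s \<ge> 1" for s unfolding L_def using Lam_pchar_nonzero[OF m that] .
    obtain Z where Z: "Z holomorphic_on {s. Re s > 0}" "\<And>s. Re s > 1 \<Longrightarrow> zeta_series s = 1 / (s - 1) + Z s"
      using zeta_series_pole by blast
    show ?thesis
    proof (intro exI[of _ "\<lambda>s. - (deriv L s / L s) - Z s"] conjI allI impI)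
      show "continuous_on {s. Re s \<ge> 1} (\<lambda>s. - (deriv L s / L s) - Z s)"
        using nz by (intro continuous_intros cont holomorphic_deriv holo Z open_halfspace_Re_gt) auto
      fix s assume s: "Re s > 1"
      define D where "D = dseries (pchar m) s"
      define Q where "Q = dseries (\<lambda>n. mangoldt n * pchar m n) s"
      have p: "dchar m (pchar m)" using m by (rule dchar_pchar)
      have "((\<lambda>s. (s - 1) * dseries (pchar m) s) has_field_derivative (1 * D + - (D * Q) * (s - 1))) (at s)"
        unfolding Q_def D_def by (intro DERIV_mult dseries_dchar_deriv[OF p m s]) (auto intro!: derivative_eq_intros)
      moreover have "eventually (\<lambda>s. s \<in> {s. Re s > 1}) (nhds s)"
        using s by (intro eventually_nhds_in_open open_halfspace_Re_gt) auto
      hence "eventually (\<lambda>s. L s = (s - 1) * dseries (pchar m) s) (nhds s)"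
        by eventually_elim (use Lam_eq_dseries[OF p] m in \<open>auto simp: L_def\<close>)
      ultimately have "(L has_field_derivative (1 * D + - (D * Q) * (s - 1))) (at s)"
        by (rule DERIV_transfer_nhds)
      hence 1: "deriv L s = D - D * Q * (s - 1)" by (simp add: DERIV_imp_deriv)
      have 2: "L s = (s - 1) * D" unfolding L_def D_def using Lam_eq_dseries[OF p _ s] m by auto
      have "D \<noteq> 0" "s - 1 \<noteq> 0" using nz[of s] 2 s by auto
      hence "deriv L s / L s = 1 / (s - 1) - Q" unfolding 1 2 by (simp add: field_simps)
      thus "- (deriv L s / L s) - Z s = dseries (\<lambda>n. mangoldt n * \<psi> n) s
        - (\<Sum>r=1..m. \<psi> r) / of_nat (totient m) * zeta_series s"
        using True Z(2)[OF s] sum_pchar[OF m] m by (simp add: Q_def)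
    qed
  qed
  thus ?thesis unfolding boundary_regular_def using norm_dchar_le_1[OF \<psi> m] by blast
qed

lemma boundary_regular_unit_function:
  assumes m: "m \<ge> 1" and f: "unit_function m f"
  shows "boundary_regular m f"
  using assms
proof (induction rule: unit_function_induct)
  case (add f g)
  obtain M M' where M: "\<And>n. norm (f n) \<le> M" "\<And>n. norm (g n) \<le> M'"
    using add unfolding boundary_regular_def by blast
  obtain E E' where E: "continuous_on {s. Re s \<ge> 1} E" "continuous_on {s. Re s \<ge> 1} E'"
    "\<And>s. Re s > 1 \<Longrightarrow> E s = dseries (\<lambda>n. mangoldt n * f n) s - (\<Sum>r=1..m. f r) / of_nat (totient m) * zeta_series s"
    "\<And>s. Re s > 1 \<Longrightarrow> E' s = dseries (\<lambda>n. mangoldt n * g n) s - (\<Sum>r=1..m. g r) / of_nat (totient m) * zeta_series s"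
    using add unfolding boundary_regular_def by blast
  have sub: "subpoly (\<lambda>n. mangoldt n * f n)" "subpoly (\<lambda>n. mangoldt n * g n)"
    using M by (auto intro!: subpoly_mult[OF subpoly_mangoldt] intro: subpoly_bounded)
  have "norm (f n + g n) \<le> M + M'" for n by (rule norm_triangle_mono[OF M])
  moreover have "E s + E' s = dseries (\<lambda>n. mangoldt n * (f n + g n)) s - (\<Sum>r=1..m. f r + g r) / of_nat (totient m) * zeta_series s"
    if s: "Re s > 1" for s
  proof -
    have "dseries (\<lambda>n. mangoldt n * (f n + g n)) s = dseries (\<lambda>n. mangoldt n * f n) s + dseries (\<lambda>n. mangoldt n * g n) s"
      using dseries_add[OF sub s] by (simp add: ring_distribs)
    thus ?thesis unfolding E(3)[OF s] E(4)[OF s] by (simp add: sum.distrib add_divide_distrib ring_distribs)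
  qed
  moreover have "continuous_on {s. Re s \<ge> 1} (\<lambda>s. E s + E' s)" by (intro continuous_intros E)
  ultimately show ?case unfolding boundary_regular_def by blast
next
  case (scale c f)
  obtain M where M: "\<And>n. norm (f n) \<le> M" using scale unfolding boundary_regular_def by blast
  obtain E where E: "continuous_on {s. Re s \<ge> 1} E"
    "\<And>s. Re s > 1 \<Longrightarrow> E s = dseries (\<lambda>n. mangoldt n * f n) s - (\<Sum>r=1..m. f r) / of_nat (totient m) * zeta_series s"
    using scale unfolding boundary_regular_def by blast
  have sub: "subpoly (\<lambda>n. mangoldt n * f n)"
    using M by (auto intro!: subpoly_mult[OF subpoly_mangoldt] intro: subpoly_bounded)
  have "norm (c * f n) \<le> norm c * M" for n using M by (simp add: norm_mult mult_left_mono)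
  moreover have "c * E s = dseries (\<lambda>n. mangoldt n * (c * f n)) s - (\<Sum>r=1..m. c * f r) / of_nat (totient m) * zeta_series s"
    if s: "Re s > 1" for s
  proof -
    have "dseries (\<lambda>n. mangoldt n * (c * f n)) s = c * dseries (\<lambda>n. mangoldt n * f n) s"
      using dseries_cmult[OF sub s, of c] by (simp add: mult_ac)
    thus ?thesis unfolding E(2)[OF s] by (simp add: sum_distrib_left[symmetric] ring_distribs)
  qed
  moreover have "continuous_on {s. Re s \<ge> 1} (\<lambda>s. c * E s)" by (intro continuous_intros E)
  ultimately show ?case unfolding boundary_regular_def by blast
next
  case (char \<psi>)
  thus ?case using boundary_regular_dchar m by blast
qed

section \<open>A Tauberian theorem with the Fejer kernel\<close>

text \<open>The Fourier transform of the triangle 1 - |t| / l on [-l, l]: nonnegative, of quadratic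
  decay, and the transform of a compactly supported function. At 0 the limit value is
  inserted.\<close>

definition fejer :: "real \<Rightarrow> real \<Rightarrow> real" where
  "fejer l u = (if u = 0 then l else 2 * (1 - cos (l * u)) / (l * u\<^sup>2))"

lemma fejer_has_integral:
  assumes l: "l > 0"
  shows "((\<lambda>t. of_real (1 - \<bar>t\<bar> / l) * cis (t * u)) has_integral of_real (fejer l u)) {-l..l}"
proof (cases "u = 0")
  case False
  define c where "c = \<i> * complex_of_real u"
  have c: "c \<noteq> 0" and c2: "c\<^sup>2 = - of_real (u\<^sup>2)" using False by (auto simp: c_def power_mult_distrib)
  \<comment> \<open>Antiderivatives on the two halves of the interval, found by integration by
    parts.\<close>
  define F where "F t = of_real (1 - t / l) * exp (c * of_real t) / c + exp (c * of_real t) / (of_real l * c\<^sup>2)" for t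
  define G where "G t = of_real (1 + t / l) * exp (c * of_real t) / c - exp (c * of_real t) / (of_real l * c\<^sup>2)" for t
  have cis: "cis (t * u) = exp (c * of_real t)" for t
    by (simp add: cis_conv_exp c_def mult_ac)
  have dF: "(F has_vector_derivative of_real (1 - t / l) * exp (c * of_real t)) (at t within A)" for t A
    unfolding F_def using c l
    by (auto intro!: derivative_eq_intros has_vector_derivative_real_field simp: field_simps power2_eq_square)
  have dG: "(G has_vector_derivative of_real (1 + t / l) * exp (c * of_real t)) (at t within A)" for t A
    unfolding G_def using c l
    by (auto intro!: derivative_eq_intros has_vector_derivative_real_field simp: field_simps power2_eq_square)
  have "((\<lambda>t. of_real (1 - t / l) * exp (c * of_real t)) has_integral (F l - F 0)) {0..l}"
    using l by (intro fundamental_theorem_of_calculus dF) auto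
  hence 1: "((\<lambda>t. of_real (1 - \<bar>t\<bar> / l) * cis (t * u)) has_integral (F l - F 0)) {0..l}"
    by (rule has_integral_eq[rotated]) (auto simp: cis)
  have "((\<lambda>t. of_real (1 + t / l) * exp (c * of_real t)) has_integral (G 0 - G (-l))) {-l..0}"
    using l by (intro fundamental_theorem_of_calculus dG) auto
  hence 2: "((\<lambda>t. of_real (1 - \<bar>t\<bar> / l) * cis (t * u)) has_integral (G 0 - G (-l))) {-l..0}"
    by (rule has_integral_eq[rotated]) (auto simp: cis)
  have "((\<lambda>t. of_real (1 - \<bar>t\<bar> / l) * cis (t * u)) has_integral (G 0 - G (-l)) + (F l - F 0)) {-l..l}"
    using l by (intro has_integral_combine[OF _ _ 2 1]) auto
  also have "(G 0 - G (-l)) + (F l - F 0) = (exp (c * of_real l) + exp (- (c * of_real l)) - 2) / (of_real l * c\<^sup>2)"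
    using l c by (simp add: F_def G_def field_simps)
  also have "exp (c * of_real l) + exp (- (c * of_real l)) = of_real (2 * cos (l * u))"
    using cis[of l] cis[of "-l"] by (simp add: cis.ctr complex_eq_iff)
  also have "(of_real (2 * cos (l * u)) - 2) / (of_real l * c\<^sup>2) = of_real (fejer l u)"
    using l False by (simp add: c2 fejer_def field_simps)
  finally show ?thesis .
next
  case True
  define F where "F t = complex_of_real (t - t\<^sup>2 / (2 * l))" for t
  define G where "G t = complex_of_real (t + t\<^sup>2 / (2 * l))" for t
  have dF: "(F has_vector_derivative of_real (1 - t / l)) (at t within A)" for t A
    unfolding F_def using l
    by (intro has_vector_derivative_of_real) (auto intro!: derivative_eq_intros simp: field_simps)
  have dG: "(G has_vector_derivative of_real (1 + t / l)) (at t within A)" for t A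
    unfolding G_def using l
    by (intro has_vector_derivative_of_real) (auto intro!: derivative_eq_intros simp: field_simps)
  have "((\<lambda>t. of_real (1 - t / l)) has_integral (F l - F 0)) {0..l}"
    using l by (intro fundamental_theorem_of_calculus dF) auto
  hence 1: "((\<lambda>t. of_real (1 - \<bar>t\<bar> / l) * cis (t * u)) has_integral (F l - F 0)) {0..l}"
    by (rule has_integral_eq[rotated]) (auto simp: True)
  have "((\<lambda>t. of_real (1 + t / l)) has_integral (G 0 - G (-l))) {-l..0}"
    using l by (intro fundamental_theorem_of_calculus dG) auto
  hence 2: "((\<lambda>t. of_real (1 - \<bar>t\<bar> / l) * cis (t * u)) has_integral (G 0 - G (-l))) {-l..0}"
    by (rule has_integral_eq[rotated]) (auto simp: True)
  have "((\<lambda>t. of_real (1 - \<bar>t\<bar> / l) * cis (t * u)) has_integral (G 0 - G (-l)) + (F l - F 0)) {-l..l}"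
    using l by (intro has_integral_combine[OF _ _ 2 1]) auto
  also have "(G 0 - G (-l)) + (F l - F 0) = of_real (fejer l u)"
    using l True by (simp add: F_def G_def fejer_def field_simps power2_eq_square)
  finally show ?thesis .
qed

lemma fejer_nonneg: "l > 0 \<Longrightarrow> fejer l u \<ge> 0"
  by (auto simp: fejer_def)

lemma fejer_le: "l > 0 \<Longrightarrow> u \<noteq> 0 \<Longrightarrow> fejer l u \<le> 4 / (l * u\<^sup>2)"
proof -
  assume "l > 0" "u \<noteq> 0"
  moreover have "2 * (1 - cos (l * u)) \<le> 4" by (smt (verit) cos_ge_minus_one)
  hence "2 * (1 - cos (l * u)) / (l * u\<^sup>2) \<le> 4 / (l * u\<^sup>2)"
    using \<open>l > 0\<close> by (intro divide_right_mono) auto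
  ultimately show ?thesis by (simp add: fejer_def)
qed

text \<open>Two integrations: cos v is at least 1/2 for v up to 1 < pi / 3, hence sin t is at least
  t / 2, hence the claim.\<close>

lemma one_minus_cos_ge:
  assumes "\<bar>x\<bar> \<le> (1::real)"
  shows "1 - cos x \<ge> x\<^sup>2 / 4"
proof -
  have *: "1 - cos x \<ge> x\<^sup>2 / 4" if x: "0 \<le> x" "x \<le> 1" for x :: real
  proof -
    have 1: "sin t \<ge> t / 2" if t: "0 \<le> t" "t \<le> 1" for t :: real
    proof -
      have "sin 0 - 0 / 2 \<le> sin t - t / 2"
      proof (rule DERIV_nonneg_imp_nondecreasing[OF t(1)])
        fix v :: real assume v: "0 \<le> v" "v \<le> t"
        have "cos (pi / 3) \<le> cos v" using v t pi_gt3 by (intro cos_monotone_0_pi_le) auto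
        hence "cos v - 1 / 2 \<ge> 0" by (simp add: cos_60)
        moreover have "((\<lambda>t. sin t - t / 2) has_real_derivative (cos v - 1 / 2)) (at v)"
          by (auto intro!: derivative_eq_intros)
        ultimately show "\<exists>y. ((\<lambda>t. sin t - t / 2) has_real_derivative y) (at v) \<and> 0 \<le> y" by blast
      qed
      thus ?thesis by simp
    qed
    have "1 - cos 0 - 0\<^sup>2 / 4 \<le> 1 - cos x - x\<^sup>2 / 4"
    proof (rule DERIV_nonneg_imp_nondecreasing[OF x(1)])
      fix v :: real assume v: "0 \<le> v" "v \<le> x"
      have "sin v - v / 2 \<ge> 0" using 1[of v] v x by simp
      moreover have "((\<lambda>x. 1 - cos x - x\<^sup>2 / 4) has_real_derivative (sin v - v / 2)) (at v)"
        by (auto intro!: derivative_eq_intros)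
      ultimately show "\<exists>y. ((\<lambda>x. 1 - cos x - x\<^sup>2 / 4) has_real_derivative y) (at v) \<and> 0 \<le> y" by blast
    qed
    thus ?thesis by simp
  qed
  show ?thesis using *[of x] *[of "-x"] assms by (cases "x \<ge> 0") auto
qed

text \<open>On the scale 1 / l the kernel keeps at least half of its height l; this gives the lower
  bound for the mass near the centre.\<close>

lemma fejer_ge:
  assumes l: "l > 0" and u: "\<bar>l * u\<bar> \<le> 1"
  shows "fejer l u \<ge> l / 2"
proof (cases "u = 0")
  case False
  have "l / 2 = 2 * ((l * u)\<^sup>2 / 4) / (l * u\<^sup>2)" using l False by (simp add: field_simps power2_eq_square)
  also have "\<dots> \<le> 2 * (1 - cos (l * u)) / (l * u\<^sup>2)"
    using one_minus_cos_ge[OF u] l by (intro divide_right_mono mult_left_mono) auto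
  finally show ?thesis using False by (simp add: fejer_def)
qed (use l in \<open>auto simp: fejer_def\<close>)

text \<open>The shift by pi / y flips the sign of the oscillating factor.\<close>

lemma riemann_lebesgue:
  fixes h :: "real \<Rightarrow> complex"
  assumes h: "continuous_on {-l..l} h" and l: "l > 0" and zero: "h l = 0" "h (-l) = 0"
  shows "((\<lambda>y. integral {-l..l} (\<lambda>t. h t * cis (-(t * y)))) \<longlongrightarrow> 0) at_top"
proof -
  \<comment> \<open>Since h vanishes at both ends, the extension by 0 is continuous, hence uniformly
    continuous on the larger interval that the shift requires.\<close>
  define H where "H t = (if t \<in> {-l..l} then h t else 0)" for t
  have "continuous_on ({-l..l} \<union> ({..-l} \<union> {l..})) H"
    unfolding H_def
  proof (rule continuous_on_If[where s = "{-l..l}" and t = "{..-l} \<union> {l..}" and P = "\<lambda>t. t \<in> {-l..l}"])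
  qed (use h zero l in \<open>auto intro!: closed_Un\<close>)
  moreover have "{-l..l} \<union> ({..-l} \<union> {l..}) = UNIV" using l by auto
  ultimately have contH: "continuous_on UNIV H" by simp
  \<comment> \<open>The margin exceeds the shift pi / y, which is at most 1, so [-R, R] and its
    shift both contain the support of \<open>H\<close>.\<close>
  define R where "R = l + 2"
  have H0: "H t = 0" if "\<bar>t\<bar> > l" for t using that by (auto simp: H_def)
  define J where "J y = integral {-l..l} (\<lambda>t. h t * cis (-(t * y)))" for y
  have J: "((\<lambda>t. H t * cis (-(t * y))) has_integral J y) {a..b}" if "a \<le> -l" "b \<ge> l" for y a b
  proof -
    have "(\<lambda>t. h t * cis (-(t * y))) integrable_on {-l..l}"
      by (intro integrable_continuous_interval continuous_intros h)
    hence "((\<lambda>t. h t * cis (-(t * y))) has_integral J y) {-l..l}" unfolding J_def by (rule integrable_integral)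
    hence "((\<lambda>t. H t * cis (-(t * y))) has_integral J y) {-l..l}"
      by (rule has_integral_eq[rotated]) (simp add: H_def)
    thus ?thesis by (rule has_integral_on_superset) (use that in \<open>auto intro!: H0\<close>)
  qed
  have diff: "((\<lambda>t. (H t - H (t + pi / y)) * cis (-(t * y))) has_integral 2 * J y) {-R..R}" if y: "y \<ge> pi" for y
  proof -
    have y0: "y > 0" using y pi_gt_zero by linarith
    have s: "0 < pi / y" "pi / y \<le> 1" using y y0 by auto
    have "((\<lambda>t. H t * cis (-(t * y))) has_integral J y) {-R + pi / y..R + pi / y}"
      by (rule J) (use s l in \<open>auto simp: R_def\<close>)
    hence "((\<lambda>t. H t * cis (-(t * y))) \<circ> (+) (pi / y) has_integral J y) {-R..R}"
      by (subst has_integral_shift_Icc_real)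
    moreover have "((\<lambda>t. H t * cis (-(t * y))) \<circ> (+) (pi / y)) = (\<lambda>t. - (H (t + pi / y) * cis (-(t * y))))"
    proof
      fix t
      have "(pi / y + t) * y = pi + t * y" using y0 by (simp add: field_simps)
      hence "cis (-((pi / y + t) * y)) = cis (-pi) * cis (-(t * y))"
        by (simp add: cis_mult)
      also have "cis (-pi) = -1" by (simp add: complex_eq_iff)
      finally have "cis (-((pi / y + t) * y)) = - cis (-(t * y))" by simp
      thus "((\<lambda>t. H t * cis (-(t * y))) \<circ> (+) (pi / y)) t = - (H (t + pi / y) * cis (-(t * y)))"
        by (simp add: add.commute)
    qed
    ultimately have "((\<lambda>t. - (H (t + pi / y) * cis (-(t * y)))) has_integral J y) {-R..R}" by simp
    moreover have "((\<lambda>t. H t * cis (-(t * y))) has_integral J y) {-R..R}"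
      by (rule J) (use l in \<open>auto simp: R_def\<close>)
    ultimately have "((\<lambda>t. H t * cis (-(t * y)) + - (H (t + pi / y) * cis (-(t * y)))) has_integral J y + J y) {-R..R}"
      by (intro has_integral_add)
    thus ?thesis by (simp add: algebra_simps)
  qed
  have "uniformly_continuous_on {-R-1..R+1} H"
    by (intro compact_uniformly_continuous continuous_on_subset[OF contH]) auto
  show ?thesis
    unfolding J_def[symmetric]
  proof (rule tendstoI)
    fix e :: real assume e: "e > 0"
    define e' where "e' = e / (2 * R)"
    have e': "e' > 0" using e l by (simp add: e'_def R_def)
    obtain d where d: "d > 0" "\<And>t t'. t \<in> {-R-1..R+1} \<Longrightarrow> t' \<in> {-R-1..R+1} \<Longrightarrow> dist t' t < d \<Longrightarrow> dist (H t') (H t) < e'"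
      using \<open>uniformly_continuous_on {-R-1..R+1} H\<close> e' unfolding uniformly_continuous_on_def by metis
    have "eventually (\<lambda>y. y \<ge> pi \<and> pi / y < d) at_top"
    proof (intro eventually_conj eventually_ge_at_top)
      have "((\<lambda>y. pi / y) \<longlongrightarrow> 0) at_top" by real_asymp
      thus "eventually (\<lambda>y. pi / y < d) at_top" using d(1) by (rule order_tendstoD)
    qed
    thus "eventually (\<lambda>y. dist (J y) 0 < e) at_top"
    proof eventually_elim
      case (elim y)
      have y0: "y > 0" using elim pi_gt_zero by linarith
      have s: "0 < pi / y" "pi / y \<le> 1" using elim y0 by auto
      have "norm (2 * J y) \<le> e' * measure lborel (cbox (-R) R)"
      proof (rule has_integral_bound[OF _ diff[of y, unfolded cbox_interval[symmetric]]])
        fix t assume t: "t \<in> cbox (-R) R"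
        have "dist (H (t + pi / y)) (H t) < e'"
          by (rule d(2)) (use t s elim in \<open>auto simp: dist_real_def\<close>)
        thus "norm ((H t - H (t + pi / y)) * cis (-(t * y))) \<le> e'"
          by (simp add: norm_mult dist_norm norm_minus_commute)
      qed (use e' elim in auto)
      also have "\<dots> = e" using l by (simp add: e'_def R_def)
      finally show ?case using e by (simp add: norm_mult)
    qed
  qed
qed

text \<open>For e > 0 the series converges uniformly on the segment at Re s = 1 + e and may be
  integrated termwise against the triangle. The phase cis (-(t * y)) centres the kernel at ln n =
  y.\<close>

lemma fejer_sums:
  assumes c: "subpoly c" and l: "l > 0" and e: "e > 0"
  shows "(\<lambda>n. c n * of_real (real n powr (-1 - e) * fejer l (ln (real n) - y))) sums
     integral {-l..l} (\<lambda>t. of_real (1 - \<bar>t\<bar> / l) * cis (-(t * y)) * dseries c (of_real (1 + e) - \<i> * of_real t))"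
proof -
  define s where "s t = of_real (1 + e) - \<i> * complex_of_real t" for t
  define k where "k t = of_real (1 - \<bar>t\<bar> / l) * cis (-(t * y))" for t
  have Re_s: "Re (s t) = 1 + e" for t by (simp add: s_def)
  define M where "M n = norm (c n * of_nat n powr (-of_real (1 + e)))" for n
  define f where "f n t = k t * (c n * of_nat n powr (- s t))" for n t
  have M: "summable M" unfolding M_def using e by (intro dseries_summable_norm c) auto
  have le: "norm (f n t) \<le> M n" if "t \<in> {-l..l}" for n t
  proof -
    have "\<bar>1 - \<bar>t\<bar> / l\<bar> \<le> 1" using that l by (auto simp: abs_le_iff field_simps)
    hence "norm (k t) \<le> 1" by (simp only: k_def norm_mult norm_of_real norm_cis mult_1_right)
    hence "norm (k t) * norm (c n * of_nat n powr (- s t)) \<le> 1 * norm (c n * of_nat n powr (- s t))"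
      by (rule mult_right_mono) auto
    thus ?thesis by (simp add: f_def M_def norm_mult norm_of_nat_powr Re_s)
  qed
  have "uniform_limit {-l..l} (\<lambda>N t. \<Sum>n<N. f n t) (\<lambda>t. \<Sum>n. f n t) sequentially"
    by (rule Weierstrass_m_test[OF le M])
  moreover have "(\<Sum>n. f n t) = k t * dseries c (s t)" for t
    unfolding f_def dseries_def using e Re_s by (intro suminf_mult dseries_summable c) auto
  ultimately have lim: "uniform_limit {-l..l} (\<lambda>N t. \<Sum>n<N. f n t) (\<lambda>t. k t * dseries c (s t)) sequentially"
    by simp
  have f_eq: "f n t = (c n * of_real (real n powr (-1 - e))) * (of_real (1 - \<bar>t\<bar> / l) * cis (t * (ln (real n) - y)))" for n t
  proof (cases "n = 0")
    case False
    have "of_nat n powr (- s t) = exp (of_real ((-1 - e) * ln (real n))) * exp (\<i> * of_real (t * ln (real n)))"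
      using False by (simp add: powr_def s_def exp_add[symmetric] algebra_simps)
    also have "exp (of_real ((-1 - e) * ln (real n))) = complex_of_real (real n powr (-1 - e))"
      unfolding exp_of_real using False by (simp add: powr_def)
    also have "exp (\<i> * of_real (t * ln (real n))) = cis (t * ln (real n))" by (simp add: cis_conv_exp)
    finally have "f n t = k t * (c n * (of_real (real n powr (-1 - e)) * cis (t * ln (real n))))"
      by (simp add: f_def)
    moreover have cis_eq: "cis (t * (ln (real n) - y)) = cis (-(t * y)) * cis (t * ln (real n))"
      by (simp add: cis_mult algebra_simps)
    ultimately show ?thesis unfolding cis_eq k_def by (simp only: mult_ac)
  qed (simp add: f_def)
  have int: "(f n has_integral (c n * of_real (real n powr (-1 - e))) * of_real (fejer l (ln (real n) - y))) {-l..l}" for n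
    unfolding f_eq[abs_def] by (intro has_integral_mult_right fejer_has_integral l)
  have cont: "continuous_on {-l..l} (\<lambda>t. \<Sum>n<N. f n t)" for N
    unfolding f_eq using l by (intro continuous_intros) auto
  obtain I J where IJ: "\<And>N. ((\<lambda>t. \<Sum>n<N. f n t) has_integral I N) {-l..l}"
    "((\<lambda>t. k t * dseries c (s t)) has_integral J) {-l..l}" "I \<longlonglongrightarrow> J"
    using uniform_limit_integral[OF lim cont sequentially_bot] by blast
  have I_eq: "I = (\<lambda>N. \<Sum>n<N. (c n * of_real (real n powr (-1 - e))) * of_real (fejer l (ln (real n) - y)))"
  proof
    show "I N = (\<Sum>n<N. (c n * of_real (real n powr (-1 - e))) * of_real (fejer l (ln (real n) - y)))" for N
      by (rule has_integral_unique[OF IJ(1)]) (intro has_integral_sum int finite_lessThan)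
  qed
  have "(\<lambda>n. (c n * of_real (real n powr (-1 - e))) * of_real (fejer l (ln (real n) - y))) sums J"
    using IJ(3) unfolding sums_def I_eq .
  moreover have "J = integral {-l..l} (\<lambda>t. k t * dseries c (s t))"
    using IJ(2) by (simp add: integral_unique)
  ultimately show ?thesis by (simp add: k_def s_def mult.assoc)
qed

section \<open>Fejer weights on the integers\<close>

definition fweight :: "real \<Rightarrow> real \<Rightarrow> nat \<Rightarrow> real" where
  "fweight l y n = fejer l (ln (real n) - y) / real n"

lemma fweight_nonneg: "l > 0 \<Longrightarrow> fweight l y n \<ge> 0"
  by (simp add: fweight_def fejer_nonneg)

lemma fweight_le:
  assumes "l > 0" "ln (real n) \<noteq> y"
  shows "fweight l y n \<le> 4 / l * (1 / (real n * (ln (real n) - y)\<^sup>2))"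
proof -
  have "fejer l (ln (real n) - y) / real n \<le> 4 / (l * (ln (real n) - y)\<^sup>2) / real n"
    using assms by (intro divide_right_mono fejer_le) auto
  thus ?thesis by (simp add: fweight_def mult_ac)
qed

lemma ln_Suc_ge: "n \<ge> 1 \<Longrightarrow> ln (real (Suc n)) - ln (real n) \<ge> 1 / real (Suc n)"
proof -
  assume n: "n \<ge> 1"
  have "ln (real n / real (Suc n)) \<le> real n / real (Suc n) - 1" using n by (intro ln_le_minus_one) auto
  thus ?thesis using n by (simp add: ln_div field_simps)
qed

lemma ln_Suc_le: "n \<ge> 1 \<Longrightarrow> ln (real (Suc n)) - ln (real n) \<le> 1 / real n"
proof -
  assume n: "n \<ge> 1"
  have "ln (real (Suc n) / real n) \<le> real (Suc n) / real n - 1" using n by (intro ln_le_minus_one) auto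
  thus ?thesis using n by (simp add: ln_div field_simps)
qed

text \<open>Both bounds come from comparing 1 / (n g n^2), where g n = ln n - y, with increments of 1 / g.\<close>

lemma sum_right_le:
  assumes N: "N \<ge> 1" and d: "d > 0" "ln (real N) - y \<ge> d"
  shows "(\<Sum>n\<in>{N<..M}. 1 / (real n * (ln (real n) - y)\<^sup>2)) \<le> 1 / d"
proof -
  define g where "g n = ln (real n) - y" for n
  have gd: "g n \<ge> d" if "n \<ge> N" for n
  proof -
    have "ln (real n) \<ge> ln (real N)" using that N by simp
    thus ?thesis using d by (simp add: g_def)
  qed
  have "(\<Sum>n\<in>{N<..M}. 1 / (real n * (g n)\<^sup>2)) \<le> 1 / d - 1 / g M" if "M \<ge> N"
    using that
  proof (induction M rule: dec_induct)
    case base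
    show ?case using gd[of N] d by (simp add: frac_le)
  next
    case (step M)
    have g: "g M \<ge> d" "g (Suc M) \<ge> d" using gd step by auto
    have pos: "g M > 0" "g (Suc M) > 0" using g d by auto
    have inc: "g (Suc M) - g M \<ge> 1 / real (Suc M)" using ln_Suc_ge[of M] N step by (simp add: g_def)
    have "0 \<le> 1 / real (Suc M)" by simp
    hence mono: "g M \<le> g (Suc M)" using inc by linarith
    have "1 / (real (Suc M) * (g (Suc M))\<^sup>2) = 1 / real (Suc M) / (g (Suc M))\<^sup>2" by simp
    also have "\<dots> \<le> (g (Suc M) - g M) / (g M * g (Suc M))"
      using inc mono pos by (intro frac_le) (auto simp: power2_eq_square)
    also have "\<dots> = 1 / g M - 1 / g (Suc M)" using pos by (simp add: field_simps)
    finally have "1 / (real (Suc M) * (g (Suc M))\<^sup>2) \<le> 1 / g M - 1 / g (Suc M)" .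
    moreover have "{N<..Suc M} = insert (Suc M) {N<..M}" using step by auto
    ultimately show ?case using step.IH by simp
  qed
  moreover have "1 / g M \<ge> 0" if "M \<ge> N" using gd[OF that] d by simp
  ultimately have "(\<Sum>n\<in>{N<..M}. 1 / (real n * (g n)\<^sup>2)) \<le> 1 / d"
    using d by (cases "M \<ge> N") (smt (verit), simp)
  thus ?thesis by (simp add: g_def)
qed

lemma sum_left_le:
  assumes d: "d > 0" "y - ln (real (Suc N)) \<ge> d"
  shows "(\<Sum>n\<in>{1..N}. 1 / (real n * (ln (real n) - y)\<^sup>2)) \<le> 2 / d"
proof -
  define h where "h n = y - ln (real n)" for n
  have hd: "h n \<ge> d" if "n \<le> Suc N" "n \<ge> 1" for n
  proof -
    have "ln (real n) \<le> ln (real (Suc N))" using that by simp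
    thus ?thesis using d by (simp add: h_def)
  qed
  have "(\<Sum>n\<in>{1..M}. 1 / (real n * (h n)\<^sup>2)) \<le> 2 / h (Suc M)" if "M \<le> N" for M
    using that
  proof (induction M)
    case 0
    show ?case using hd[of 1] d by simp
  next
    case (Suc M)
    have g: "h (Suc M) \<ge> d" "h (Suc (Suc M)) \<ge> d" using hd Suc by auto
    have pos: "h (Suc M) > 0" "h (Suc (Suc M)) > 0" using g d by auto
    have "h (Suc M) - h (Suc (Suc M)) \<ge> 1 / real (Suc (Suc M))" using ln_Suc_ge[of "Suc M"] by (simp add: h_def)
    hence "2 * (1 / real (Suc (Suc M))) \<le> 2 * (h (Suc M) - h (Suc (Suc M)))" by (intro mult_left_mono) auto
    \<comment> \<open>The increment of \<open>h\<close> bounds 1 / (M + 2), whereas 1 / (M + 1) is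
      needed; the factor 2 in the lemma pays for this.\<close>
    moreover have "1 / real (Suc M) \<le> 2 * (1 / real (Suc (Suc M)))" by (simp add: field_simps)
    ultimately have inc: "1 / real (Suc M) \<le> 2 * (h (Suc M) - h (Suc (Suc M)))" by (rule order_trans[rotated])
    have "0 \<le> 2 * (h (Suc M) - h (Suc (Suc M)))" by (rule order_trans[OF _ inc]) simp
    hence mono: "h (Suc (Suc M)) \<le> h (Suc M)" by simp
    have "1 / (real (Suc M) * (h (Suc M))\<^sup>2) = 1 / real (Suc M) / (h (Suc M))\<^sup>2" by simp
    also have "\<dots> \<le> (2 * (h (Suc M) - h (Suc (Suc M)))) / (h (Suc M) * h (Suc (Suc M)))"
      using inc mono pos by (intro frac_le) (auto simp: power2_eq_square)
    also have "\<dots> = 2 / h (Suc (Suc M)) - 2 / h (Suc M)" using pos by (simp add: field_simps)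
    finally have "1 / (real (Suc M) * (h (Suc M))\<^sup>2) \<le> 2 / h (Suc (Suc M)) - 2 / h (Suc M)" .
    moreover have "(\<Sum>n\<in>{1..Suc M}. 1 / (real n * (h n)\<^sup>2)) = (\<Sum>n\<in>{1..M}. 1 / (real n * (h n)\<^sup>2)) + 1 / (real (Suc M) * (h (Suc M))\<^sup>2)"
      by simp
    ultimately show ?case using Suc by simp
  qed
  from this[of N] have "(\<Sum>n\<in>{1..N}. 1 / (real n * (h n)\<^sup>2)) \<le> 2 / h (Suc N)" by simp
  also have "\<dots> \<le> 2 / d" using hd[of "Suc N"] d by (intro divide_left_mono) auto
  finally show ?thesis by (simp add: h_def power2_commute)
qed

lemma fweight_summable:
  assumes l: "l > 0"
  shows "summable (fweight l y)"
proof -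
  define N where "N = nat \<lceil>exp (y + 1)\<rceil> + 1"
  have "exp (y + 1) \<le> real N" unfolding N_def by linarith
  moreover from this have "real N > 0" using exp_gt_zero[of "y + 1"] by linarith
  ultimately have "ln (exp (y + 1)) \<le> ln (real N)" by (subst ln_le_cancel_iff) auto
  hence N: "N \<ge> 1" "ln (real N) - y \<ge> 1" by (auto simp: N_def)
  have "summable (\<lambda>n. fweight l y (n + Suc N))"
  proof (rule summableI_nonneg_bounded)
    show "0 \<le> fweight l y (n + Suc N)" for n using l by (rule fweight_nonneg)
    fix M
    have "(\<Sum>n<M. fweight l y (n + Suc N)) = (\<Sum>n\<in>{N<..N + M}. fweight l y n)"
      by (rule sum.reindex_bij_witness[of _ "\<lambda>n. n - Suc N" "\<lambda>n. n + Suc N"]) auto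
    also have "\<dots> \<le> (\<Sum>n\<in>{N<..N + M}. 4 / l * (1 / (real n * (ln (real n) - y)\<^sup>2)))"
    proof (intro sum_mono fweight_le l)
      fix n assume "n \<in> {N<..N + M}"
      hence "ln (real n) \<ge> ln (real N)" using N by simp
      thus "ln (real n) \<noteq> y" using N by auto
    qed
    also have "\<dots> = 4 / l * (\<Sum>n\<in>{N<..N + M}. 1 / (real n * (ln (real n) - y)\<^sup>2))"
      by (rule sum_distrib_left[symmetric])
    also have "\<dots> \<le> 4 / l * (1 / 1)"
      using N l by (intro mult_left_mono sum_right_le) auto
    finally show "(\<Sum>n<M. fweight l y (n + Suc N)) \<le> 4 / l * (1 / 1)" .
  qed
  thus ?thesis by (subst (asm) summable_iff_shift)
qed

text \<open>The two tails cost 4 / l * (2 / d + 4 / d). They are cut at distance d / 2 instead of d,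
  which leaves room to round exp (y + d / 2) and exp (y - d / 2) to integers once y is
  large.\<close>

lemma fweight_far:
  assumes l: "l > 0" and d: "d > 0"
  shows "\<forall>\<^sub>F y in at_top. \<forall>M. (\<Sum>n\<in>{n\<in>{1..M}. \<bar>ln (real n) - y\<bar> > d}. fweight l y n) \<le> 24 / (l * d)"
proof -
  have "\<forall>\<^sub>F y in at_top. exp (y + d) - exp (y + d / 2) \<ge> 1"
    using d by real_asymp
  moreover have "\<forall>\<^sub>F y in at_top. exp (y - d / 2) - exp (y - d) \<ge> 2" using d by real_asymp
  ultimately show ?thesis
  proof eventually_elim
    case (elim y)
    show ?case
    proof
      fix M
      define N where "N = nat \<lceil>exp (y + d / 2)\<rceil>"
      define N' where "N' = nat \<lfloor>exp (y - d / 2)\<rfloor> - 1"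
      have N1: "real N \<ge> exp (y + d / 2)" "real N < exp (y + d / 2) + 1"
        unfolding N_def using exp_gt_zero[of "y + d / 2"] by linarith+
      have e2: "exp (y - d / 2) \<ge> 2" using elim(2) exp_gt_zero[of "y - d"] by linarith
      have fl: "\<lfloor>exp (y - d / 2)\<rfloor> \<ge> 2" using e2 by linarith
      have N'1: "real (Suc N') \<le> exp (y - d / 2)" "real N' > exp (y - d / 2) - 2"
        unfolding N'_def using fl by linarith+
      have "N > 0" using N1(1) exp_gt_zero[of "y + d / 2"] by (intro Nat.gr0I) auto
      hence lnN: "ln (real N) - y \<ge> d / 2"
        using N1(1) ln_le_cancel_iff[of "exp (y + d / 2)" "real N"] by simp
      have lnN': "y - ln (real (Suc N')) \<ge> d / 2"
        using N'1(1) ln_le_cancel_iff[of "real (Suc N')" "exp (y - d / 2)"] by (simp del: of_nat_Suc)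
      define t where "t n = 1 / (real n * (ln (real n) - y)\<^sup>2)" for n
      have t0: "t n \<ge> 0" for n by (simp add: t_def)
      have "(\<Sum>n\<in>{n\<in>{1..M}. \<bar>ln (real n) - y\<bar> > d}. fweight l y n) \<le> (\<Sum>n\<in>{n\<in>{1..M}. \<bar>ln (real n) - y\<bar> > d}. 4 / l * t n)"
        unfolding t_def using d by (intro sum_mono fweight_le l) auto
      also have "\<dots> \<le> (\<Sum>n\<in>{N<..M} \<union> {1..N'}. 4 / l * t n)"
      proof (intro sum_mono2)
        show "{n\<in>{1..M}. \<bar>ln (real n) - y\<bar> > d} \<subseteq> {N<..M} \<union> {1..N'}"
        proof safe
          fix n assume n: "n \<in> {1..M}" "\<bar>ln (real n) - y\<bar> > d" "n \<notin> {1..N'}"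
          have "n > N"
          proof (cases "ln (real n) - y > d")
            case True
            hence "exp (y + d) < exp (ln (real n))" by (subst exp_less_cancel_iff) simp
            also have "exp (ln (real n)) = real n" using n(1) by simp
            finally have "exp (y + d) < real n" .
            thus ?thesis using elim(1) N1 by linarith
          next
            case False
            hence "exp (ln (real n)) < exp (y - d)" using n by (subst exp_less_cancel_iff) auto
            moreover have "exp (ln (real n)) = real n" using n(1) by simp
            ultimately have "real n < exp (y - d)" by (simp only:)
            hence "n \<le> N'" using elim(2) N'1 by linarith
            thus ?thesis using n by auto
          qed
          thus "n \<in> {N<..M}" using n by auto
        qed
      qed (use t0 l in auto)
      also have "\<dots> \<le> (\<Sum>n\<in>{N<..M}. 4 / l * t n) + (\<Sum>n\<in>{1..N'}. 4 / l * t n)"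
        using t0 l by (subst sum_Un) (auto intro!: sum_nonneg)
      also have "\<dots> = 4 / l * ((\<Sum>n\<in>{N<..M}. t n) + (\<Sum>n\<in>{1..N'}. t n))"
        by (simp only: sum_distrib_left ring_distribs)
      also have "\<dots> \<le> 4 / l * (1 / (d / 2) + 2 / (d / 2))"
        unfolding t_def using l d \<open>N > 0\<close> lnN lnN'
        by (intro mult_left_mono add_mono sum_right_le sum_left_le) auto
      also have "\<dots> = 24 / (l * d)" using l d by (simp add: field_simps)
      finally show "(\<Sum>n\<in>{n\<in>{1..M}. \<bar>ln (real n) - y\<bar> > d}. fweight l y n) \<le> 24 / (l * d)" .
    qed
  qed
qed

text \<open>On the window of radius 1 / l the kernel is at least l / 2, and the numbers 1 / n there
  sum to at least 1 / l, half of the logarithmic length of the window; the other half absorbs the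
  rounding.\<close>

lemma fweight_near:
  assumes l: "l > 0"
  shows "\<forall>\<^sub>F y in at_top. 1 / 2 \<le> (\<Sum>n. fweight l y n)"
proof -
  define d where "d = 1 / l"
  have d: "d > 0" using l by (simp add: d_def)
  have "\<forall>\<^sub>F y in at_top. ln (exp (y + d)) - ln (exp (y - d) + 1) \<ge> d"
    using d by real_asymp
  moreover have "\<forall>\<^sub>F y in at_top. exp (y - d) \<ge> (1::real)" using d by real_asymp
  ultimately show ?thesis
  proof eventually_elim
    case (elim y)
    define N where "N = nat \<lceil>exp (y - d)\<rceil>"
    define M where "M = nat \<lfloor>exp (y + d)\<rfloor>"
    have N: "real N \<ge> exp (y - d)" "real N < exp (y - d) + 1"
      unfolding N_def using exp_gt_zero[of "y - d"] by linarith+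
    have M: "real M \<le> exp (y + d)" "real (Suc M) > exp (y + d)"
      unfolding M_def using exp_gt_zero[of "y + d"] by linarith+
    have N1: "N \<ge> 1" using N elim by linarith
    have "d \<le> ln (exp (y + d)) - ln (exp (y - d) + 1)" by (rule elim)
    also have "\<dots> \<le> ln (real (Suc M)) - ln (real N)"
    proof (rule diff_mono)
      show "ln (exp (y + d)) \<le> ln (real (Suc M))" using M(2) by (subst ln_le_cancel_iff) auto
      show "ln (real N) \<le> ln (exp (y - d) + 1)" using N(2) N1 by (subst ln_le_cancel_iff) (auto intro: add_pos_pos)
    qed
    finally have dle: "d \<le> ln (real (Suc M)) - ln (real N)" .
    have "ln (real N) < ln (real (Suc M))" using dle d by linarith
    hence "N \<le> M" using N1 by simp
    have "d \<le> (\<Sum>n=N..M. ln (real (Suc n)) - ln (real n))"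
      using sum_Suc_diff[of N M "\<lambda>n. ln (real n)"] \<open>N \<le> M\<close> dle by simp
    also have "\<dots> \<le> (\<Sum>n=N..M. 1 / real n)" using N1 by (intro sum_mono ln_Suc_le) auto
    finally have "l / 2 * d \<le> l / 2 * (\<Sum>n=N..M. 1 / real n)" using l by (intro mult_left_mono) auto
    also have "\<dots> \<le> (\<Sum>n=N..M. fweight l y n)"
      unfolding sum_distrib_left
    proof (intro sum_mono)
      fix n assume n: "n \<in> {N..M}"
      have "ln (exp (y - d)) \<le> ln (real n)" using n N N1 by (subst ln_le_cancel_iff) auto
      moreover have "ln (real n) \<le> ln (exp (y + d))" using n M N1 by (subst ln_le_cancel_iff) auto
      ultimately have "\<bar>ln (real n) - y\<bar> \<le> d" by auto
      hence "l * \<bar>ln (real n) - y\<bar> \<le> l * d" using l by (intro mult_left_mono) auto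
      moreover have "\<bar>l * (ln (real n) - y)\<bar> = l * \<bar>ln (real n) - y\<bar>"
        using l by (metis abs_mult abs_of_pos)
      moreover have "l * d = 1" using l by (simp add: d_def)
      ultimately have "\<bar>l * (ln (real n) - y)\<bar> \<le> 1" by (simp only:)
      from divide_right_mono[OF fejer_ge[OF l this], of "real n"]
      show "l / 2 * (1 / real n) \<le> fweight l y n" by (simp add: fweight_def)
    qed
    also have "\<dots> \<le> (\<Sum>n. fweight l y n)"
      using l by (intro sum_le_suminf fweight_summable) (auto simp: fweight_nonneg)
    finally show ?case using l by (simp add: d_def)
  qed
qed

text \<open>On Re s = 1 convergence is not known, so the identity is used at 1 + e and e tends to 0.
  Continuity of \<open>D\<close> controls the integral; nonnegativity of b turns this into a bound
  for partial sums, which gives summability and then the majorant for exchanging limit and sum. The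
  limiting integral tends to 0 by \<open>riemann_lebesgue\<close>, because the triangle vanishes at
  its ends.\<close>

lemma fejer_average:
  fixes b :: "nat \<Rightarrow> real"
  assumes b0: "\<And>n. b n \<ge> 0" and sub: "subpoly (\<lambda>n. of_real (b n))"
    and D: "continuous_on {s. Re s \<ge> 1} D"
    and D_eq: "\<And>s. Re s > 1 \<Longrightarrow> D s = dseries (\<lambda>n. of_real (b n - 1)) s"
    and l: "l > 0"
  shows "summable (\<lambda>n. b n * fweight l y n)"
    and "((\<lambda>y. \<Sum>n. (b n - 1) * fweight l y n) \<longlongrightarrow> 0) at_top"
proof -
  define c where "c n = complex_of_real (b n - 1)" for n
  have "subpoly (\<lambda>n. of_real (b n) + (-1))"
    by (rule subpoly_add[OF sub subpoly_bounded[of _ 1]]) simp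
  hence subc: "subpoly c" by (simp add: c_def[abs_def])
  define I where "I e y = integral (cbox (-l) l) (\<lambda>t. of_real (1 - \<bar>t\<bar> / l) * cis (-(t * y)) * D (of_real (1 + e) - \<i> * of_real t))" for e y
  define w where "w e y n = real n powr (-1 - e) * fejer l (ln (real n) - y)" for e y n
  have w_nonneg: "w e y n \<ge> 0" for e y n using l by (simp add: w_def fejer_nonneg)
  have w0: "w 0 y n = fweight l y n" for y n
    by (cases "n = 0") (simp_all add: w_def fweight_def powr_minus_divide)
  have w_le: "w e y n \<le> fweight l y n" if "e \<ge> 0" for e y n
  proof (cases "n = 0")
    case False
    hence "real n powr (-1 - e) \<le> real n powr (-1 - 0)" using that by (intro powr_mono) auto
    hence "w e y n \<le> w 0 y n" unfolding w_def using l by (intro mult_right_mono) (auto simp: fejer_nonneg)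
    thus ?thesis by (simp add: w0)
  qed (simp add: w_def fweight_def)
  have sums: "(\<lambda>n. (b n - 1) * w e y n) sums Re (I e y)" if "e > 0" for e y
  proof -
    have "(\<lambda>n. c n * of_real (w e y n)) sums
       integral {-l..l} (\<lambda>t. of_real (1 - \<bar>t\<bar> / l) * cis (-(t * y)) * dseries c (of_real (1 + e) - \<i> * of_real t))"
      unfolding w_def by (rule fejer_sums[OF subc l that])
    also have "integral {-l..l} (\<lambda>t. of_real (1 - \<bar>t\<bar> / l) * cis (-(t * y)) * dseries c (of_real (1 + e) - \<i> * of_real t)) = I e y"
      unfolding I_def cbox_interval using that by (intro integral_cong) (simp add: D_eq c_def[abs_def])
    finally have "(\<lambda>n. Re (c n * of_real (w e y n))) sums Re (I e y)" by (rule sums_Re)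
    thus ?thesis by (simp add: c_def)
  qed
  have cont: "continuous_on {0..} (\<lambda>e. I e y)" for y
    unfolding I_def
  proof (rule integral_continuous_on_param)
    have "continuous_on ({0..} \<times> cbox (-l) l) (\<lambda>x. D (of_real (1 + fst x) - \<i> * of_real (snd x)))"
      by (rule continuous_on_compose2[OF D]) (auto intro!: continuous_intros)
    thus "continuous_on ({0..} \<times> cbox (-l) l) (\<lambda>(e, t). of_real (1 - \<bar>t\<bar> / l) * cis (-(t * y)) * D (of_real (1 + e) - \<i> * of_real t))"
      unfolding case_prod_unfold using l by (intro continuous_intros) auto
  qed
  define \<epsilon> where "\<epsilon> j = 1 / real (Suc j)" for j
  have \<epsilon>: "\<epsilon> \<longlonglongrightarrow> 0" "\<And>j. \<epsilon> j > 0"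
    unfolding \<epsilon>_def by (real_asymp, simp)
  have I_lim: "(\<lambda>j. I (\<epsilon> j) y) \<longlonglongrightarrow> I 0 y" for y
    by (rule continuous_on_tendsto_compose[OF cont \<epsilon>(1)]) (use \<epsilon>(2) in \<open>auto intro!: always_eventually less_imp_le\<close>)
  have w_lim: "(\<lambda>j. w (\<epsilon> j) y n) \<longlonglongrightarrow> fweight l y n" for y n
  proof (cases "n = 0")
    case False
    have "(\<lambda>j. w (\<epsilon> j) y n) \<longlonglongrightarrow> w 0 y n"
      unfolding w_def using False by (intro tendsto_intros \<epsilon>(1)) auto
    thus ?thesis by (simp add: w0)
  qed (simp add: w_def fweight_def)
  have w_summable: "summable (w e y)" if "e \<ge> 0" for e y
    by (rule summable_comparison_test'[OF fweight_summable[OF l, of y], of 0]) (use w_nonneg w_le that in auto)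
  have bw_summable: "summable (\<lambda>n. b n * w e y n)" if "e > 0" for e y
    using summable_add[OF sums_summable[OF sums[OF that, of y]] w_summable[of e y]] that by (simp add: left_diff_distrib)
  show bf: "summable (\<lambda>n. b n * fweight l y n)" for y
  proof -
    have "convergent (\<lambda>j. I (\<epsilon> j) y)" using I_lim by (auto simp: convergent_def)
    hence "Bseq (\<lambda>j. I (\<epsilon> j) y)" by (rule convergent_imp_Bseq)
    then obtain C where C: "\<And>j. norm (I (\<epsilon> j) y) \<le> C" by (auto simp: Bseq_def)
    show ?thesis
    proof (rule summableI_nonneg_bounded)
      show "0 \<le> b n * fweight l y n" for n using b0 l by (simp add: fweight_nonneg)
      fix N
      have "(\<Sum>n<N. b n * w (\<epsilon> j) y n) \<le> C + (\<Sum>n. fweight l y n)" for j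
      proof -
        have "(\<Sum>n<N. b n * w (\<epsilon> j) y n) \<le> (\<Sum>n. b n * w (\<epsilon> j) y n)"
          using \<epsilon>(2) b0 w_nonneg by (intro sum_le_suminf bw_summable) auto
        also have "\<dots> = (\<Sum>n. (b n - 1) * w (\<epsilon> j) y n) + (\<Sum>n. w (\<epsilon> j) y n)"
          using suminf_add[OF sums_summable[OF sums[OF \<epsilon>(2)]] w_summable[OF less_imp_le[OF \<epsilon>(2)]], of j y]
          by (simp add: algebra_simps)
        also have "(\<Sum>n. (b n - 1) * w (\<epsilon> j) y n) = Re (I (\<epsilon> j) y)"
          using sums[OF \<epsilon>(2)] by (simp add: sums_iff)
        also have "\<dots> \<le> C" using C[of j] complex_Re_le_cmod[of "I (\<epsilon> j) y"] by linarith
        also have "(\<Sum>n. w (\<epsilon> j) y n) \<le> (\<Sum>n. fweight l y n)"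
          using \<epsilon>(2) l by (intro suminf_le w_le w_summable fweight_summable less_imp_le) auto
        finally show ?thesis by simp
      qed
      moreover have "(\<lambda>j. \<Sum>n<N. b n * w (\<epsilon> j) y n) \<longlonglongrightarrow> (\<Sum>n<N. b n * fweight l y n)"
        by (intro tendsto_intros w_lim)
      ultimately show "(\<Sum>n<N. b n * fweight l y n) \<le> C + (\<Sum>n. fweight l y n)"
        by (intro LIMSEQ_le_const2) auto
    qed
  qed
  have eq: "(\<Sum>n. (b n - 1) * fweight l y n) = Re (I 0 y)" for y
  proof -
    have "(\<lambda>j. \<Sum>n. (b n - 1) * w (\<epsilon> j) y n) \<longlonglongrightarrow> (\<Sum>n. (b n - 1) * fweight l y n)"
    proof (rule tannerys_theorem[THEN conjunct2, THEN conjunct2])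
      show "(\<lambda>j. (b n - 1) * w (\<epsilon> j) y n) \<longlonglongrightarrow> (b n - 1) * fweight l y n" for n
        by (intro tendsto_intros w_lim)
      show "summable (\<lambda>n. b n * fweight l y n + fweight l y n)"
        by (intro summable_add bf fweight_summable l)
      have "norm ((b n - 1) * w (\<epsilon> j) y n) \<le> b n * fweight l y n + fweight l y n" for n j
      proof -
        have "norm ((b n - 1) * w (\<epsilon> j) y n) \<le> (b n + 1) * fweight l y n"
          unfolding norm_mult using b0[of n] w_nonneg w_le[OF less_imp_le[OF \<epsilon>(2)]]
          by (intro mult_mono) auto
        thus ?thesis by (simp add: algebra_simps)
      qed
      thus "\<forall>\<^sub>F (n, j) in sequentially \<times>\<^sub>F sequentially. norm ((b n - 1) * w (\<epsilon> j) y n) \<le> b n * fweight l y n + fweight l y n"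
        by (intro always_eventually) auto
    qed auto
    moreover have "(\<lambda>j. \<Sum>n. (b n - 1) * w (\<epsilon> j) y n) \<longlonglongrightarrow> Re (I 0 y)"
      using tendsto_Re[OF I_lim[of y]] sums[OF \<epsilon>(2)] by (simp add: sums_iff)
    ultimately show ?thesis by (rule LIMSEQ_unique)
  qed
  have "((\<lambda>y. integral {-l..l} (\<lambda>t. (of_real (1 - \<bar>t\<bar> / l) * D (1 - \<i> * of_real t)) * cis (-(t * y)))) \<longlongrightarrow> 0) at_top"
  proof (rule riemann_lebesgue[OF _ l])
    have "continuous_on {-l..l} (\<lambda>t. D (1 - \<i> * of_real t))"
      by (rule continuous_on_compose2[OF D]) (auto intro!: continuous_intros)
    thus "continuous_on {-l..l} (\<lambda>t. of_real (1 - \<bar>t\<bar> / l) * D (1 - \<i> * of_real t))"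
      using l by (intro continuous_intros) auto
  qed (use l in auto)
  hence "((\<lambda>y. I 0 y) \<longlongrightarrow> 0) at_top" by (simp add: I_def mult_ac)
  from tendsto_Re[OF this] show "((\<lambda>y. \<Sum>n. (b n - 1) * fweight l y n) \<longlongrightarrow> 0) at_top"
    by (simp add: eq)
qed

text \<open>b n dominates b N up to a factor exp (2 h) on the window [N, N exp (2 h)], and is dominated by it on
  [N exp (-2 h), N]; the Fejer averages over these windows are asymptotically those of the constant 1.\<close>

lemma tauberian_window:
  fixes b :: "nat \<Rightarrow> real"
  assumes b0: "\<And>n. b n \<ge> 0"
    and mono: "\<And>m n. 1 \<le> m \<Longrightarrow> m \<le> n \<Longrightarrow> real m * b m \<le> real n * b n"
    and avg: "\<And>l y. l > 0 \<Longrightarrow> summable (\<lambda>n. b n * fweight l y n)"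
      "\<And>l. l > 0 \<Longrightarrow> ((\<lambda>y. \<Sum>n. (b n - 1) * fweight l y n) \<longlongrightarrow> 0) at_top"
    and h: "h > 0" and k: "k > 0" "k < 1 / 2"
  shows "(\<forall>\<^sub>F N in sequentially. b N \<le> exp (2 * h) * (1 + k) / (1 - 2 * k)) \<and>
    (\<forall>B. (\<forall>n\<ge>1. b n \<le> B) \<longrightarrow> (\<forall>\<^sub>F N in sequentially. exp (-2 * h) * (1 - k - 2 * B * k) \<le> b N))"
proof -
  \<comment> \<open>Chosen so that the bound 24 / (l * h) for the mass outside the window of radius
    h is k.\<close>
  define l where "l = 24 / (h * k)"
  have l: "l > 0" using h k by (simp add: l_def)
  have lk: "24 / (l * h) = k" using h k by (simp add: l_def)
  define f where "f y = fweight l y" for y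
  have f0: "f y n \<ge> 0" for y n using l by (simp add: f_def fweight_nonneg)
  have fs: "summable (f y)" for y unfolding f_def by (rule fweight_summable[OF l])
  have bfs: "summable (\<lambda>n. b n * f y n)" for y unfolding f_def by (rule avg(1)[OF l])
  define A where "A y = {n. n \<ge> 1 \<and> \<bar>ln (real n) - y\<bar> \<le> h}" for y
  define S where "S y = (\<Sum>n. f y n)" for y
  define T where "T y = (\<Sum>n. (b n - 1) * f y n)" for y
  have finA: "finite (A y)" for y
  proof (rule finite_subset)
    show "A y \<subseteq> {..nat \<lceil>exp (y + h)\<rceil>}"
    proof
      fix n assume "n \<in> A y"
      hence "n \<ge> 1" "ln (real n) \<le> y + h" by (auto simp: A_def)
      hence "exp (ln (real n)) \<le> exp (y + h)" by (subst exp_le_cancel_iff)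
      hence "real n \<le> exp (y + h)" using \<open>n \<ge> 1\<close> by simp
      thus "n \<in> {..nat \<lceil>exp (y + h)\<rceil>}" by simp linarith
    qed
  qed auto
  have bf_eq: "(\<Sum>n. b n * f y n) = S y + T y" for y
  proof -
    have "summable (\<lambda>n. (b n - 1) * f y n)"
      using summable_diff[OF bfs fs, of y y] by (simp add: algebra_simps)
    from suminf_add[OF fs this] show ?thesis by (simp add: S_def T_def algebra_simps)
  qed
  \<comment> \<open>This is applied with g the constant 1 and with g = b. Outside the window only
    the bound C is used, and index 0 has weight 0 because division by 0 is 0.\<close>
  have split: "(\<Sum>n. g n * f y n) \<le> (\<Sum>n\<in>A y. g n * f y n) + C * k"
    if far: "\<forall>M. (\<Sum>n\<in>{n\<in>{1..M}. \<bar>ln (real n) - y\<bar> > h}. fweight l y n) \<le> k"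
      and g: "\<And>n. n \<ge> 1 \<Longrightarrow> g n \<le> C" "\<And>n. g n \<ge> 0" and gs: "summable (\<lambda>n. g n * f y n)" for g y C
  proof (rule suminf_le_const[OF gs])
    fix M
    define R where "R = {n\<in>{1..M}. \<bar>ln (real n) - y\<bar> > h}"
    have C: "C \<ge> 0" using g(1)[of 1] g(2)[of 1] by simp
    have "(\<Sum>n<M. g n * f y n) \<le> (\<Sum>n\<in>insert 0 (A y \<union> R). g n * f y n)"
    proof (intro sum_mono2)
      show "{..<M} \<subseteq> insert 0 (A y \<union> R)" by (auto simp: A_def R_def Suc_le_eq)
    qed (use finA g f0 in \<open>auto simp: R_def\<close>)
    also have "\<dots> = (\<Sum>n\<in>A y \<union> R. g n * f y n)"
      using finA by (subst sum.insert) (auto simp: R_def A_def f_def fweight_def)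
    also have "\<dots> = (\<Sum>n\<in>A y. g n * f y n) + (\<Sum>n\<in>R. g n * f y n)"
      using finA by (intro sum.union_disjoint) (auto simp: R_def A_def)
    also have "(\<Sum>n\<in>R. g n * f y n) \<le> (\<Sum>n\<in>R. C * f y n)"
      using g f0 by (intro sum_mono mult_right_mono) (auto simp: R_def)
    also have "\<dots> = C * (\<Sum>n\<in>R. f y n)" by (rule sum_distrib_left[symmetric])
    also have "\<dots> \<le> C * k" using far C by (intro mult_left_mono) (auto simp: R_def f_def)
    finally show "(\<Sum>n<M. g n * f y n) \<le> (\<Sum>n\<in>A y. g n * f y n) + C * k" by simp
  qed
  \<comment> \<open>Since the total mass is at least 1/2, an absolute error below k / 2 is a
    relative error below k.\<close>
  define good where "good y \<longleftrightarrow> (\<forall>M. (\<Sum>n\<in>{n\<in>{1..M}. \<bar>ln (real n) - y\<bar> > h}. fweight l y n) \<le> k) \<and>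
    1 / 2 \<le> S y \<and> \<bar>T y\<bar> < k / 2" for y
  have good: "\<forall>\<^sub>F y in at_top. good y"
  proof -
    have "\<forall>\<^sub>F y in at_top. \<bar>T y\<bar> < k / 2"
      using tendstoD[OF avg(2)[OF l], of "k / 2"] k by (simp add: T_def f_def)
    with fweight_far[OF l h, unfolded lk] fweight_near[OF l] show ?thesis
      by eventually_elim (simp add: good_def S_def f_def)
  qed
  have "filterlim (\<lambda>N. ln (real N) + h) at_top sequentially" by real_asymp
  from eventually_compose_filterlim[OF good this] eventually_ge_at_top[of 1]
  have upper: "\<forall>\<^sub>F N in sequentially. b N \<le> exp (2 * h) * (1 + k) / (1 - 2 * k)"
  proof eventually_elim
    case (elim N)
    define y where "y = ln (real N) + h"
    have g: "good y" using elim by (simp add: y_def)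
    have bn: "b N * exp (-2 * h) \<le> b n" if "n \<in> A y" for n
    proof -
      have n: "n \<ge> 1" "ln (real N) \<le> ln (real n)" "ln (real n) \<le> ln (real N) + 2 * h"
        using that by (auto simp: A_def y_def)
      have Nn: "N \<le> n" using n elim by simp
      have "exp (ln (real n)) \<le> exp (ln (real N) + 2 * h)" using n(3) by (subst exp_le_cancel_iff)
      hence nN: "real n \<le> real N * exp (2 * h)" using n(1) elim by (simp add: exp_add)
      have "b N * exp (-2 * h) * real n \<le> b N * exp (-2 * h) * (real N * exp (2 * h))"
        using b0 nN by (intro mult_left_mono) auto
      also have "\<dots> = real N * b N" by (simp add: exp_minus field_simps)
      also have "\<dots> \<le> real n * b n" by (rule mono) (use elim Nn in auto)
      finally show ?thesis using n(1) by (simp add: mult.commute)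
    qed
    define a where "a = (\<Sum>n\<in>A y. f y n)"
    have S_le: "S y \<le> a + k"
      using split[of y "\<lambda>_. 1" 1] g fs by (simp add: good_def S_def a_def)
    have "b N * exp (-2 * h) * a = (\<Sum>n\<in>A y. b N * exp (-2 * h) * f y n)"
      unfolding a_def by (rule sum_distrib_left)
    also have "\<dots> \<le> (\<Sum>n\<in>A y. b n * f y n)" using f0 bn by (intro sum_mono mult_right_mono) auto
    also have "\<dots> \<le> (\<Sum>n. b n * f y n)" using finA b0 f0 by (intro sum_le_suminf bfs) auto
    also have "\<dots> = S y + T y" by (rule bf_eq)
    also have "\<dots> \<le> S y + k * S y"
    proof -
      have "T y \<le> k * (1 / 2)" using g by (auto simp: good_def)
      also have "\<dots> \<le> k * S y" using g k by (intro mult_left_mono) (auto simp: good_def)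
      finally show ?thesis by simp
    qed
    finally have 1: "b N * exp (-2 * h) * a \<le> S y * (1 + k)" by (simp add: algebra_simps)
    have "k * 1 \<le> k * (2 * S y)" using g k by (intro mult_left_mono) (auto simp: good_def)
    hence "S y * (1 - 2 * k) \<le> a" using S_le by (simp add: algebra_simps)
    hence "b N * exp (-2 * h) * (S y * (1 - 2 * k)) \<le> b N * exp (-2 * h) * a"
      using b0 by (intro mult_left_mono) auto
    hence "S y * (b N * exp (-2 * h) * (1 - 2 * k)) \<le> S y * (1 + k)" using 1 by (simp add: mult_ac)
    moreover have "S y > 0" using g by (auto simp: good_def)
    ultimately have "b N * exp (-2 * h) * (1 - 2 * k) \<le> 1 + k" by (subst (asm) mult_le_cancel_left_pos)
    hence "b N * (1 - 2 * k) \<le> exp (2 * h) * (1 + k)" by (simp add: exp_minus field_simps)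
    thus ?case using k by (simp add: pos_le_divide_eq)
  qed
  have "filterlim (\<lambda>N. ln (real N) - h) at_top sequentially" by real_asymp
  note ev = eventually_compose_filterlim[OF good this]
  \<comment> \<open>Here b itself has to be bounded to control its mass far from the window. The
    upper estimate used only nonnegativity of b, so it can supply \<open>B\<close>
    beforehand.\<close>
  have lower: "\<forall>\<^sub>F N in sequentially. exp (-2 * h) * (1 - k - 2 * B * k) \<le> b N" if B: "\<forall>n\<ge>1. b n \<le> B" for B
    using ev eventually_ge_at_top[of 1]
  proof eventually_elim
    case (elim N)
    define y where "y = ln (real N) - h"
    have g: "good y" using elim by (simp add: y_def)
    have B0: "B \<ge> 0" using b0[of 1] B by (meson le_refl order_trans)
    have bn: "b n \<le> b N * exp (2 * h)" if "n \<in> A y" for n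
    proof -
      have n: "n \<ge> 1" "ln (real n) \<le> ln (real N)" "ln (real N) \<le> ln (real n) + 2 * h"
        using that by (auto simp: A_def y_def)
      have nN: "n \<le> N" using n elim by simp
      have "exp (ln (real N)) \<le> exp (ln (real n) + 2 * h)" using n(3) by (subst exp_le_cancel_iff)
      hence Nn: "real N \<le> real n * exp (2 * h)" using n(1) elim by (simp add: exp_add)
      have "real n * b n \<le> real N * b N" by (rule mono) (use n nN in auto)
      also have "\<dots> \<le> real n * exp (2 * h) * b N" using b0 Nn by (intro mult_right_mono) auto
      finally show ?thesis using n(1) by (simp add: mult_ac)
    qed
    have "S y - k * S y \<le> S y + T y"
    proof -
      have "- T y \<le> k * (1 / 2)" using g by (auto simp: good_def)
      also have "\<dots> \<le> k * S y" using g k by (intro mult_left_mono) (auto simp: good_def)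
      finally show ?thesis by simp
    qed
    also have "\<dots> = (\<Sum>n. b n * f y n)" by (rule bf_eq[symmetric])
    also have "\<dots> \<le> (\<Sum>n\<in>A y. b n * f y n) + B * k"
      by (rule split) (use g B b0 bfs in \<open>auto simp: good_def\<close>)
    also have "(\<Sum>n\<in>A y. b n * f y n) \<le> (\<Sum>n\<in>A y. b N * exp (2 * h) * f y n)"
      using f0 bn by (intro sum_mono mult_right_mono) auto
    also have "\<dots> = b N * exp (2 * h) * (\<Sum>n\<in>A y. f y n)" by (rule sum_distrib_left[symmetric])
    also have "\<dots> \<le> b N * exp (2 * h) * S y"
      unfolding S_def using b0 finA f0 by (intro mult_left_mono sum_le_suminf fs) auto
    also have "B * k \<le> S y * (2 * B * k)"
    proof -
      have "B * k * 1 \<le> B * k * (2 * S y)" using g k B0 by (intro mult_left_mono) (auto simp: good_def)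
      thus ?thesis by (simp add: mult_ac)
    qed
    finally have "S y * (1 - k - 2 * B * k) \<le> S y * (b N * exp (2 * h))"
      by (simp add: algebra_simps)
    moreover have "S y > 0" using g by (auto simp: good_def)
    ultimately have "1 - k - 2 * B * k \<le> b N * exp (2 * h)" by (subst (asm) mult_le_cancel_left_pos)
    hence "exp (-2 * h) * (1 - k - 2 * B * k) \<le> exp (-2 * h) * (b N * exp (2 * h))"
      by (intro mult_left_mono) auto
    also have "\<dots> = b N" by (simp add: exp_minus)
    finally show ?case .
  qed
  from upper lower show ?thesis by blast
qed

text \<open>The window estimate is used twice: with h = 1 and k = 1/4 it shows that b is bounded,
  and with that bound both of its inequalities, for h = k tending to 0, close in on 1.\<close>

lemma tauberian:
  fixes b :: "nat \<Rightarrow> real"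
  assumes b0: "\<And>n. b n \<ge> 0"
    and mono: "\<And>m n. 1 \<le> m \<Longrightarrow> m \<le> n \<Longrightarrow> real m * b m \<le> real n * b n"
    and sub: "subpoly (\<lambda>n. of_real (b n))"
    and D: "continuous_on {s. Re s \<ge> 1} D"
    and D_eq: "\<And>s. Re s > 1 \<Longrightarrow> D s = dseries (\<lambda>n. of_real (b n - 1)) s"
  shows "b \<longlonglongrightarrow> 1"
proof -
  note window = tauberian_window[OF b0 mono fejer_average[OF b0 sub D D_eq]]
  have "\<forall>\<^sub>F N in sequentially. b N \<le> exp (2 * 1) * (1 + 1 / 4) / (1 - 2 * (1 / 4))"
    using window[of 1 "1 / 4"] by simp
  then obtain N0 where N0: "\<And>N. N \<ge> N0 \<Longrightarrow> b N \<le> exp (2 * 1) * (1 + 1 / 4) / (1 - 2 * (1 / 4))"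
    by (auto simp: eventually_sequentially)
  define B where "B = Max (insert (exp (2 * 1) * (1 + 1 / 4) / (1 - 2 * (1 / 4))) (b ` {..N0}))"
  have B: "b n \<le> B" for n
  proof (cases "n \<ge> N0")
    case True
    have "exp (2 * 1) * (1 + 1 / 4) / (1 - 2 * (1 / 4)) \<le> B" unfolding B_def by (intro Max_ge) auto
    with N0[OF True] show ?thesis by linarith
  next
    case False
    thus ?thesis unfolding B_def by (intro Max_ge) auto
  qed
  show ?thesis
  proof (rule order_tendstoI)
    fix a :: real assume a: "a > 1"
    have "((\<lambda>k. exp (2 * k) * (1 + k) / (1 - 2 * k)) \<longlongrightarrow> 1) (at_right (0::real))" by real_asymp
    hence "\<forall>\<^sub>F k in at_right 0. exp (2 * k) * (1 + k) / (1 - 2 * k) < a" using a by (rule order_tendstoD)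
    moreover have "\<forall>\<^sub>F k in at_right (0::real). k < 1 / 2" by real_asymp
    moreover have "\<forall>\<^sub>F k in at_right (0::real). k > 0" by real_asymp
    ultimately have "\<forall>\<^sub>F k in at_right (0::real). exp (2 * k) * (1 + k) / (1 - 2 * k) < a \<and> k < 1 / 2 \<and> k > 0"
      by eventually_elim simp
    then obtain k :: real where k: "exp (2 * k) * (1 + k) / (1 - 2 * k) < a" "k < 1 / 2" "k > 0"
      using eventually_happens'[OF trivial_limit_at_right_real] by blast
    have "\<forall>\<^sub>F N in sequentially. b N \<le> exp (2 * k) * (1 + k) / (1 - 2 * k)"
      using window[of k k] k by blast
    thus "\<forall>\<^sub>F N in sequentially. b N < a" by eventually_elim (use k in linarith)
  next
    fix a :: real assume a: "a < 1"
    have "((\<lambda>k. exp (-2 * k) * (1 - k - 2 * B * k)) \<longlongrightarrow> 1) (at_right (0::real))" by real_asymp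
    hence "\<forall>\<^sub>F k in at_right 0. a < exp (-2 * k) * (1 - k - 2 * B * k)" using a by (rule order_tendstoD)
    moreover have "\<forall>\<^sub>F k in at_right (0::real). k < 1 / 2" by real_asymp
    moreover have "\<forall>\<^sub>F k in at_right (0::real). k > 0" by real_asymp
    ultimately have "\<forall>\<^sub>F k in at_right (0::real). a < exp (-2 * k) * (1 - k - 2 * B * k) \<and> k < 1 / 2 \<and> k > 0"
      by eventually_elim simp
    then obtain k :: real where k: "a < exp (-2 * k) * (1 - k - 2 * B * k)" "k < 1 / 2" "k > 0"
      using eventually_happens'[OF trivial_limit_at_right_real] by blast
    have "\<forall>\<^sub>F N in sequentially. exp (-2 * k) * (1 - k - 2 * B * k) \<le> b N"
      using window[of k k] k B by blast
    thus "\<forall>\<^sub>F N in sequentially. a < b N" by eventually_elim (use k in linarith)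
  qed
qed

text \<open>Partial summation turns the Dirichlet series of a into that of the averages A n / n, up to a holomorphic error.\<close>

lemma tauberian_nonneg_series:
  fixes a :: "nat \<Rightarrow> real"
  assumes a0: "\<And>n. a n \<ge> 0" and az: "a 0 = 0" and al: "\<And>n. n \<ge> 1 \<Longrightarrow> a n \<le> C * ln (real n)"
    and E: "continuous_on {s. Re s \<ge> 1} E"
    and E_eq: "\<And>s. Re s > 1 \<Longrightarrow> E s = dseries (\<lambda>n. of_real (a n)) s - zeta_series s"
  shows "(\<lambda>n. (\<Sum>k\<le>n. a k) / real n) \<longlonglongrightarrow> 1"
proof -
  define A where "A n = (\<Sum>k\<le>n. a k)" for n
  define b where "b n = A n / real n" for n
  have A_nonneg: "A n \<ge> 0" for n unfolding A_def by (intro sum_nonneg a0)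
  have A0: "A 0 = 0" by (simp add: A_def az)
  have C0: "C \<ge> 0"
  proof -
    have "0 \<le> C * ln 2" using order_trans[OF a0[of 2] al[of 2]] by simp
    thus ?thesis using ln_gt_zero[of 2] by (simp add: zero_le_mult_iff)
  qed
  have A_le: "A n \<le> C * real n * ln (real n)" for n
  proof (cases "n = 0")
    case False
    have "A n = (\<Sum>k=1..n. a k)"
      unfolding A_def using az by (intro sum.mono_neutral_right) (auto simp: Suc_le_eq)
    also have "\<dots> \<le> (\<Sum>k=1..n. C * ln (real n))"
      using C0 by (intro sum_mono order_trans[OF al] mult_left_mono) auto
    finally show ?thesis by (simp add: mult_ac)
  qed (simp add: A0)
  have b0: "b n \<ge> 0" for n using A_nonneg by (simp add: b_def)
  have mono: "real m * b m \<le> real n * b n" if "1 \<le> m" "m \<le> n" for m n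
    using that a0 by (auto simp: b_def A_def intro!: sum_mono2)
  have subb: "subpoly (\<lambda>n. of_real (b n))"
  proof (rule subpoly_le[OF subpoly_mult[OF subpoly_bounded[of "\<lambda>_. of_real C" "C"] subpoly_ln]])
    fix n :: nat
    show "norm (complex_of_real (b n)) \<le> norm (complex_of_real C * complex_of_real (ln (real n)))"
    proof (cases "n = 0")
      case False
      have "b n \<le> C * ln (real n)" using A_le[of n] False by (simp add: b_def divide_le_eq mult_ac)
      thus ?thesis using b0[of n] by (simp flip: of_real_mult)
    qed (simp add: b_def)
  qed (use C0 in simp)
  have suba: "subpoly (\<lambda>n. of_real (a n))"
  proof (rule subpoly_le[OF subpoly_mult[OF subpoly_bounded[of "\<lambda>_. of_real C" "C"] subpoly_ln]])
    fix n :: nat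
    show "norm (complex_of_real (a n)) \<le> norm (complex_of_real C * complex_of_real (ln (real n)))"
      using a0[of n] al[of n] az by (cases "n = 0") (simp_all flip: of_real_mult)
  qed (use C0 in simp)
  \<comment> \<open>The n-th term is A n times the error of replacing n powr -s - (n + 1) powr -s by
    s * n powr (-s - 1). As \<open>A n\<close> is at most C n ln n, the series converges for Re s >
    0.\<close>
  define R where "R s = (\<Sum>n. of_real (A n) * hterm 1 n (s + 1))" for s
  define S where "S = {s. Re s > 0}"
  have S: "open S" unfolding S_def by (rule open_halfspace_Re_gt)
  have term_le: "norm (of_real (A n) * hterm 1 n (s + 1)) \<le> norm s * norm (s + 1) * C * (ln (real n) * real n powr (-Re s - 1))"
    if "Re s > -1" for s n
  proof (cases "n = 0")
    case False
    have "norm (hterm 1 n (s + 1)) \<le> norm (s + 1 - 1) * norm (s + 1) * real 1 * real n powr (-Re (s + 1) - 1)"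
      using that False by (intro norm_hterm_le) auto
    hence "norm (of_real (A n) * hterm 1 n (s + 1)) \<le> (C * real n * ln (real n)) * (norm s * norm (s + 1) * real n powr (-Re s - 2))"
      unfolding norm_mult using A_le[of n] A_nonneg[of n] by (intro mult_mono) (auto simp: algebra_simps)
    also have "real n powr (-Re s - 2) = real n powr (-Re s - 1) / real n"
      using False powr_diff[of "real n" "-Re s - 1" 1] by (simp add: algebra_simps)
    finally show ?thesis using False by (simp add: mult_ac)
  qed (simp add: A0)
  have term_holo: "(\<lambda>s. of_real (A n) * hterm 1 n (s + 1)) holomorphic_on S" for n
  proof (cases "n = 0")
    case False
    have "(\<lambda>s. hterm 1 n (s + 1)) holomorphic_on S"
      by (rule holomorphic_on_compose_gen[of "\<lambda>s. s + 1" S "hterm 1 n" UNIV, unfolded o_def])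
         (use False in \<open>auto intro!: holomorphic_intros hterm_holomorphic\<close>)
    thus ?thesis by (intro holomorphic_intros)
  qed (simp add: A0)
    have term_dom: "\<exists>d>0. \<exists>h. summable h \<and> (\<forall>n. \<forall>y\<in>ball x d \<inter> S. norm (of_real (A n) * hterm 1 n (y + 1)) \<le> h n)"
      if x: "x \<in> S" for x
    proof -
      define d where "d = Re x / 2"
      have d: "d > 0" using x by (simp add: d_def S_def)
      define M where "M = (norm x + d) * (norm x + d + 1) * C"
      have "summable (\<lambda>n. norm (of_real (ln (real n)) * of_nat n powr (-of_real (1 + d)) :: complex))"
        using d by (intro dseries_summable_norm subpoly_ln) auto
      also have "(\<lambda>n. norm (of_real (ln (real n)) * of_nat n powr (-of_real (1 + d)) :: complex)) = (\<lambda>n. ln (real n) * real n powr (-1 - d))"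
      proof
        fix n :: nat
        show "norm (of_real (ln (real n)) * of_nat n powr (-of_real (1 + d)) :: complex) = ln (real n) * real n powr (-1 - d)"
          by (cases "n = 0") (simp_all add: norm_mult norm_of_nat_powr)
      qed
      finally have sh: "summable (\<lambda>n. M * (ln (real n) * real n powr (-1 - d)))" by (rule summable_mult)
      have le: "norm (of_real (A n) * hterm 1 n (y + 1)) \<le> M * (ln (real n) * real n powr (-1 - d))" if y: "y \<in> ball x d \<inter> S" for n y
      proof (cases "n = 0")
        case False
        have "norm (y - x) < d" using y by (auto simp: dist_norm norm_minus_commute)
        hence ny: "norm y \<le> norm x + d" "norm (y + 1) \<le> norm x + d + 1" "\<bar>Re (y - x)\<bar> < d"
          using norm_triangle_ineq[of "y - x" x] norm_triangle_ineq[of y 1] abs_Re_le_cmod[of "y - x"] by auto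
        have Rey: "Re y \<ge> d" using ny(3) by (simp add: d_def abs_if split: if_splits)
        have "norm (of_real (A n) * hterm 1 n (y + 1)) \<le> norm y * norm (y + 1) * C * (ln (real n) * real n powr (-Re y - 1))"
          using Rey d by (intro term_le) auto
        also have "\<dots> \<le> M * (ln (real n) * real n powr (-1 - d))"
          unfolding M_def using ny d C0 Rey False
          by (intro mult_mono powr_mono) auto
        finally show ?thesis .
      qed (simp add: A0)
      show ?thesis using d sh le by blast
    qed
  have R_holo: "R holomorphic_on S"
    unfolding R_def by (rule dominated_series_holomorphic(1)[OF S term_holo term_dom])
  have R_summable: "summable (\<lambda>n. of_real (A n) * hterm 1 n (s + 1))" if "s \<in> S" for s
    by (rule dominated_series_holomorphic(2)[OF S term_holo term_dom that])
  have abel: "s * dseries (\<lambda>n. of_real (b n)) s = dseries (\<lambda>n. of_real (a n)) s + R s" if s: "Re s > 1" for s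
  proof -
    define w where "w n = complex_of_nat n powr (-s)" for n
    have part: "(\<Sum>n<N. of_real (A n) * (w n - w (Suc n))) = (\<Sum>n<N. of_real (a n) * w n) - of_real (A N) * w N + of_real (a N) * w N" for N
    proof (induction N)
      case (Suc N)
      have "A (Suc N) = A N + a (Suc N)" by (simp add: A_def)
      thus ?case using Suc by (simp add: algebra_simps)
    qed (simp add: w_def)
    have lim: "(\<lambda>N. of_real (A N) * w N) \<longlonglongrightarrow> 0"
    proof (rule Lim_null_comparison)
      show "\<forall>\<^sub>F N in sequentially. norm (of_real (A N) * w N) \<le> C * (ln (real N) * real N powr (1 - Re s))"
        using eventually_gt_at_top[of 0]
      proof eventually_elim
        case (elim N)
        have "norm (of_real (A N) * w N) \<le> (C * real N * ln (real N)) * real N powr (-Re s)"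
          using A_le[of N] A_nonneg[of N] by (simp add: norm_mult w_def norm_of_nat_powr mult_right_mono)
        also have "real N powr (1 - Re s) = real N * real N powr (-Re s)"
          using elim powr_add[of "real N" 1 "-Re s"] by simp
        hence "(C * real N * ln (real N)) * real N powr (-Re s) = C * (ln (real N) * real N powr (1 - Re s))"
          by (simp only: mult_ac)
        finally show ?case .
      qed
      have "(\<lambda>N. ln (real N) * real N powr (1 - Re s)) \<longlonglongrightarrow> 0" using s by real_asymp
      from tendsto_mult_left[OF this, of C] show "(\<lambda>N. C * (ln (real N) * real N powr (1 - Re s))) \<longlonglongrightarrow> 0" by simp
    qed
    have "(\<lambda>n. of_real (a n) * w n) sums dseries (\<lambda>n. of_real (a n)) s"
      unfolding dseries_def w_def by (intro summable_sums dseries_summable suba s)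
    moreover from this have "(\<lambda>N. of_real (a N) * w N) \<longlonglongrightarrow> 0"
      by (intro summable_LIMSEQ_zero) (rule sums_summable)
    ultimately have "(\<lambda>N. (\<Sum>n<N. of_real (a n) * w n) - of_real (A N) * w N + of_real (a N) * w N)
        \<longlonglongrightarrow> dseries (\<lambda>n. of_real (a n)) s - 0 + 0"
      unfolding sums_def by (intro tendsto_intros lim)
    hence 1: "(\<lambda>n. of_real (A n) * (w n - w (Suc n))) sums dseries (\<lambda>n. of_real (a n)) s"
      unfolding sums_def part by simp
    have 2: "(\<lambda>n. of_real (A n) * hterm 1 n (s + 1)) sums R s"
      unfolding R_def using s by (intro summable_sums R_summable) (auto simp: S_def)
    have 3: "of_real (A n) * (w n - w (Suc n)) + of_real (A n) * hterm 1 n (s + 1) = s * (of_real (b n) * w n)" for n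
    proof (cases "n = 0")
      case False
      have "complex_of_nat n powr (- (s + 1)) = w n / of_nat n"
        using False powr_diff[of "complex_of_nat n" "-s" 1] by (simp add: w_def)
      thus ?thesis using False by (simp add: hterm_def w_def b_def field_simps)
    qed (simp add: A0 b_def)
    have "(\<lambda>n. s * (of_real (b n) * w n)) sums (s * dseries (\<lambda>n. of_real (b n)) s)"
      unfolding dseries_def w_def by (intro sums_mult summable_sums dseries_summable subb s)
    with sums_add[OF 1 2] show ?thesis unfolding 3 using sums_unique2 by blast
  qed
  obtain Z where Z: "Z holomorphic_on {s. Re s > 0}" "\<And>s. Re s > 1 \<Longrightarrow> zeta_series s = 1 / (s - 1) + Z s"
    using zeta_series_pole by blast
  have sub: "{s. Re s \<ge> 1} \<subseteq> {s. Re s > 0}" by auto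
  note cont = continuous_on_subset[OF holomorphic_on_imp_continuous_on sub]
  have "b \<longlonglongrightarrow> 1"
  proof (rule tauberian[OF b0 mono subb])
    \<comment> \<open>From s * zeta_series s = zeta_series s + (s - 1) * zeta_series s: the first
      summand goes into \<open>E\<close>, and in the second the factor s - 1 removes the
      pole.\<close>
    show "continuous_on {s. Re s \<ge> 1} (\<lambda>s. (E s - (1 + (s - 1) * Z s) + R s) / s)"
      using R_holo unfolding S_def by (intro continuous_intros E cont Z) auto
    fix s assume s: "Re s > 1"
    have s0: "s \<noteq> 0" "s - 1 \<noteq> 0" using s by auto
    have "dseries (\<lambda>n. of_real (b n) + (-1)) s = dseries (\<lambda>n. of_real (b n)) s + dseries (\<lambda>n. -1 * 1) s"
      using dseries_add[OF subb subpoly_bounded[of "\<lambda>_. -1" 1] s] by simp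
    also have "dseries (\<lambda>n. -1 * 1) s = -1 * zeta_series s"
      unfolding zeta_series_def by (rule dseries_cmult[OF subpoly_bounded[of _ 1] s]) simp
    finally have "dseries (\<lambda>n. of_real (b n - 1)) s = dseries (\<lambda>n. of_real (b n)) s - zeta_series s"
      by simp
    hence "s * dseries (\<lambda>n. of_real (b n - 1)) s = s * dseries (\<lambda>n. of_real (b n)) s - s * zeta_series s"
      by (simp only: right_diff_distrib)
    also have "\<dots> = (dseries (\<lambda>n. of_real (a n)) s + R s) - s * zeta_series s" by (simp only: abel[OF s])
    also have "\<dots> = E s - (s - 1) * zeta_series s + R s" by (simp add: E_eq[OF s] algebra_simps)
    also have "(s - 1) * zeta_series s = 1 + (s - 1) * Z s" using s0 by (simp add: Z(2)[OF s] ring_distribs)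
    finally show "(E s - (1 + (s - 1) * Z s) + R s) / s = dseries (\<lambda>n. of_real (b n - 1)) s"
      using s0 by (simp add: field_simps)
  qed
  thus ?thesis unfolding b_def[abs_def] A_def .
qed

section \<open>Primes in residue classes\<close>

text \<open>The indicator of the class sums to 1 over a period, so its series has residue 1 /
  totient m at 1. Scaling by \<open>totient m\<close> gives the residue 1 that the Tauberian theorem
  requires.\<close>

lemma psi_residue_class:
  assumes m: "m \<ge> 1" and a: "coprime a m"
  shows "(\<lambda>n. (\<Sum>k\<le>n. if [k = a] (mod m) then mangoldt k else 0) / real n) \<longlonglongrightarrow> 1 / real (totient m)"
proof -
  define f where "f k = (if [k = a] (mod m) then 1 else 0 :: complex)" for k
  have "coprime x m" if "[x = a] (mod m)" for x
    using that a cong_imp_coprime cong_sym by blast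
  hence "unit_function m f" by (auto simp: unit_function_def f_def)
  from boundary_regular_unit_function[OF m this]
  obtain E where E: "continuous_on {s. Re s \<ge> 1} E"
    "\<And>s. Re s > 1 \<Longrightarrow> E s = dseries (\<lambda>n. mangoldt n * f n) s - (\<Sum>r=1..m. f r) / of_nat (totient m) * zeta_series s"
    unfolding boundary_regular_def by blast
  have sum1: "(\<Sum>r=1..m. f r) = 1"
  proof -
    define r0 where "r0 = (if a mod m = 0 then m else a mod m)"
    have r0: "r0 \<in> {1..m}" "[r0 = a] (mod m)" using m by (auto simp: r0_def cong_def)
    have uniq: "r = r0" if "r \<in> {1..m}" "[r = a] (mod m)" for r
    proof (cases "r = m")
      case True
      hence "a mod m = 0" using that(2) by (simp add: cong_def)
      thus ?thesis using True by (simp add: r0_def)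
    next
      case False
      hence "a mod m = r" using that by (simp add: cong_def)
      thus ?thesis using that(1) by (auto simp: r0_def)
    qed
    have "(\<Sum>r=1..m. f r) = (\<Sum>r\<in>{r0}. f r)"
    proof (rule sum.mono_neutral_right)
      show "\<forall>r\<in>{1..m} - {r0}. f r = 0"
      proof
        fix r assume "r \<in> {1..m} - {r0}"
        hence "\<not> [r = a] (mod m)" using uniq[of r] by blast
        thus "f r = 0" by (simp add: f_def)
      qed
    qed (use r0(1) in auto)
    thus ?thesis using r0 by (simp add: f_def)
  qed
  define t where "t = real (totient m)"
  have t: "t > 0" using m by (simp add: t_def)
  define c where "c n = t * (if [n = a] (mod m) then mangoldt n else 0)" for n :: nat
  have "(\<lambda>n. (\<Sum>k\<le>n. c k) / real n) \<longlonglongrightarrow> 1"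
  proof (rule tauberian_nonneg_series)
    show "c n \<ge> 0" for n using t by (simp add: c_def mangoldt_nonneg)
    show "c 0 = 0" by (simp add: c_def)
    show "c n \<le> t * ln (real n)" if "n \<ge> 1" for n
      using that t mangoldt_le[of n] by (simp add: c_def)
    show "continuous_on {s. Re s \<ge> 1} (\<lambda>s. of_real t * E s)" by (intro continuous_intros E)
    fix s assume s: "Re s > 1"
    have "subpoly (\<lambda>n. mangoldt n * f n)"
      by (rule subpoly_mult[OF subpoly_mangoldt subpoly_bounded[of _ 1]]) (simp add: f_def)
    from dseries_cmult[OF this s, of "of_real t"]
    have "of_real t * dseries (\<lambda>n. mangoldt n * f n) s = dseries (\<lambda>n. of_real t * (mangoldt n * f n)) s" by simp
    also have "(\<lambda>n. of_real t * (mangoldt n * f n)) = (\<lambda>n. complex_of_real (c n))"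
      by (auto simp: c_def f_def fun_eq_iff)
    finally show "of_real t * E s = dseries (\<lambda>n. complex_of_real (c n)) s - zeta_series s"
      using t unfolding E(2)[OF s] sum1 by (simp add: t_def ring_distribs)
  qed
  from tendsto_mult_left[OF this, of "1 / t"]
  show ?thesis using t by (simp add: c_def[abs_def] sum_distrib_left[symmetric] t_def)
qed

section \<open>From the Chebyshev function to counting primes\<close>

definition primes_class :: "nat \<Rightarrow> nat \<Rightarrow> nat \<Rightarrow> nat set" where
  "primes_class m a n = {p. prime p \<and> p \<le> n \<and> [p = a] (mod m)}"

lemma finite_primes_class [simp, intro]: "finite (primes_class m a n)"
  by (rule finite_subset[of _ "{..n}"]) (auto simp: primes_class_def)

text \<open>A proper prime power p ^ j up to n has p at most sqrt n and j at most log 2 n, and it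
  contributes at most ln n.\<close>

lemma sum_mangoldt_nonprime_le:
  fixes n :: nat
  assumes n: "n \<ge> 1"
  shows "(\<Sum>k\<in>{k. k \<le> n \<and> primepow k \<and> \<not> prime k}. mangoldt k :: real) \<le> sqrt n * log 2 n * ln n"
proof -
  define I where "I = {1..nat \<lfloor>sqrt n\<rfloor>} \<times> {1..nat \<lfloor>log 2 n\<rfloor>}"
  define K where "K = {k. k \<le> n \<and> primepow k \<and> \<not> prime k}"
  have sub: "K \<subseteq> (\<lambda>(p, j). p ^ j) ` I"
  proof
    fix k assume k: "k \<in> K"
    then obtain p j where pj: "prime p" "j > 0" "k = p ^ j" unfolding K_def primepow_def by blast
    have "j \<noteq> 1" using k pj by (auto simp: K_def)
    hence j: "j \<ge> 2" using pj by auto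
    have p2: "p \<ge> 2" using pj prime_ge_2_nat by blast
    have "p ^ 2 \<le> p ^ j" using j p2 by (intro power_increasing) auto
    hence "p ^ 2 \<le> n" using k pj by (auto simp: K_def)
    hence "real p ^ 2 \<le> real n" by (simp flip: of_nat_power)
    hence "real p \<le> sqrt n" by (rule real_le_rsqrt)
    hence 1: "p \<le> nat \<lfloor>sqrt n\<rfloor>" by (simp add: le_nat_floor)
    have "2 ^ j \<le> p ^ j" using p2 by (intro power_mono) auto
    moreover have "p ^ j \<le> n" using k pj by (simp add: K_def)
    ultimately have "2 ^ j \<le> n" by (rule order_trans)
    hence "(2::real) ^ j \<le> real n" by (metis of_nat_le_iff of_nat_numeral of_nat_power)
    hence "real j \<le> log 2 n" using n by (subst le_log_iff) (auto simp: powr_realpow)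
    hence 2: "j \<le> nat \<lfloor>log 2 n\<rfloor>" by (simp add: le_nat_floor)
    show "k \<in> (\<lambda>(p, j). p ^ j) ` I"
      using 1 2 pj p2 by (intro image_eqI[of _ _ "(p, j)"]) (auto simp: I_def)
  qed
  have "card K \<le> card ((\<lambda>(p, j). p ^ j) ` I)" by (intro card_mono sub) (auto simp: I_def)
  also have "\<dots> \<le> card I" by (intro card_image_le) (auto simp: I_def)
  also have "\<dots> = nat \<lfloor>sqrt n\<rfloor> * nat \<lfloor>log 2 n\<rfloor>" by (simp add: I_def)
  finally have "card K \<le> nat \<lfloor>sqrt n\<rfloor> * nat \<lfloor>log 2 n\<rfloor>" .
  hence "real (card K) \<le> real (nat \<lfloor>sqrt n\<rfloor> * nat \<lfloor>log 2 n\<rfloor>)" by (simp only: of_nat_le_iff)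
  also have "\<dots> = real (nat \<lfloor>sqrt n\<rfloor>) * real (nat \<lfloor>log 2 n\<rfloor>)" by (rule of_nat_mult)
  also have "\<dots> \<le> sqrt n * log 2 n"
    using n by (intro mult_mono) (auto simp: zero_le_log_cancel_iff intro!: of_nat_floor)
  finally have card: "real (card K) \<le> sqrt n * log 2 n" .
  have "(\<Sum>k\<in>K. mangoldt k :: real) \<le> (\<Sum>k\<in>K. ln n)"
  proof (intro sum_mono)
    fix k assume k: "k \<in> K"
    hence "k > 0" by (auto simp: K_def intro!: Nat.gr0I)
    hence "mangoldt k \<le> ln (real k)" by (rule mangoldt_le)
    also have "\<dots> \<le> ln n" using k \<open>k > 0\<close> by (auto simp: K_def)
    finally show "mangoldt k \<le> ln (real n)" .
  qed
  also have "\<dots> = real (card K) * ln n" by simp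
  also have "\<dots> \<le> sqrt n * log 2 n * ln n" using card n by (intro mult_right_mono) auto
  finally show ?thesis by (simp add: K_def)
qed

text \<open>The count is squeezed. A prime contributes at most ln n to the Chebyshev sum and proper
  prime powers are negligible. Conversely, primes beyond y = n / (ln n)^2 contribute at least ln y,
  which is asymptotic to ln n, while y is negligible against n / ln n.\<close>

lemma prime_number_theorem_residue_class:
  assumes m: "m \<ge> 1" and a: "coprime a m"
  shows "(\<lambda>n. real (card (primes_class m a n)) * ln n / n) \<longlonglongrightarrow> 1 / real (totient m)"
proof -
  define \<psi> where "\<psi> n = (\<Sum>k\<le>n. if [k = a] (mod m) then mangoldt k else 0 :: real)" for n
  define \<theta> where "\<theta> n = (\<Sum>p\<in>primes_class m a n. ln (real p))" for n
  define P where "P n = real (card (primes_class m a n))" for n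
  have \<psi>: "(\<lambda>n. \<psi> n / real n) \<longlonglongrightarrow> 1 / real (totient m)"
    using psi_residue_class[OF m a] by (simp add: \<psi>_def)
  have \<theta>_le_\<psi>: "\<theta> n \<le> \<psi> n" for n
  proof -
    have "\<theta> n = (\<Sum>p\<in>primes_class m a n. if [p = a] (mod m) then mangoldt p else 0)"
      unfolding \<theta>_def by (intro sum.cong) (auto simp: primes_class_def)
    also have "\<dots> \<le> \<psi> n" unfolding \<psi>_def
      by (intro sum_mono2) (auto simp: primes_class_def mangoldt_nonneg)
    finally show ?thesis .
  qed
  have \<psi>_le: "\<psi> n \<le> P n * ln n + sqrt n * log 2 n * ln n" if n: "n \<ge> 1" for n
  proof -
    define K where "K = {k. k \<le> n \<and> primepow k \<and> \<not> prime k}"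
    have finK: "finite K" by (rule finite_subset[of _ "{..n}"]) (auto simp: K_def)
    have "\<psi> n = (\<Sum>k\<in>primes_class m a n \<union> (K \<inter> {k. [k = a] (mod m)}). mangoldt k)"
      unfolding \<psi>_def by (rule sum.mono_neutral_cong_right)
        (auto simp: primes_class_def K_def mangoldt_def)
    also have "\<dots> \<le> (\<Sum>k\<in>primes_class m a n \<union> K. mangoldt k)"
      using finK by (intro sum_mono2) (auto simp: mangoldt_nonneg)
    also have "\<dots> = (\<Sum>k\<in>primes_class m a n. mangoldt k) + (\<Sum>k\<in>K. mangoldt k)"
      using finK by (intro sum.union_disjoint) (auto simp: primes_class_def K_def)
    also have "(\<Sum>k\<in>primes_class m a n. mangoldt k) \<le> (\<Sum>k\<in>primes_class m a n. ln n)"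
    proof (intro sum_mono)
      fix k assume k: "k \<in> primes_class m a n"
      hence "k > 0" by (auto simp: primes_class_def prime_gt_0_nat)
      hence "mangoldt k \<le> ln (real k)" by (rule mangoldt_le)
      also have "\<dots> \<le> ln n" using k \<open>k > 0\<close> by (auto simp: primes_class_def)
      finally show "mangoldt k \<le> ln (real n)" .
    qed
    also have "\<dots> = P n * ln n" by (simp add: P_def)
    also have "(\<Sum>k\<in>K. mangoldt k) \<le> sqrt n * log 2 n * ln n"
      unfolding K_def by (rule sum_mangoldt_nonprime_le[OF n])
    finally show ?thesis by simp
  qed
  have P_le: "P n \<le> real n / (ln n)\<^sup>2 + \<psi> n / (ln n - 2 * ln (ln n))"
    if n: "ln n - 2 * ln (ln (real n)) > 0" "ln (real n) > 1" for n
  proof -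
    define y where "y = real n / (ln n)\<^sup>2"
    have n0: "real n > 0" using n(2) by (cases "n = 0") auto
    have "ln (real n) > 0" using n(2) by linarith
    hence y0: "y > 0" unfolding y_def using n0 by (intro divide_pos_pos zero_less_power)
    have lny: "ln y = ln n - 2 * ln (ln n)" using n n0 by (simp add: y_def ln_div ln_realpow)
    have "primes_class m a n \<subseteq> {1..nat \<lfloor>y\<rfloor>} \<union> {p\<in>primes_class m a n. real p > y}"
    proof
      fix p assume p: "p \<in> primes_class m a n"
      hence "p \<ge> 1" by (auto simp: primes_class_def dest: prime_ge_1_nat)
      thus "p \<in> {1..nat \<lfloor>y\<rfloor>} \<union> {p\<in>primes_class m a n. real p > y}"
        using p by (cases "real p \<le> y") (auto simp: le_nat_floor)
    qed
    hence "card (primes_class m a n) \<le> card ({1..nat \<lfloor>y\<rfloor>} \<union> {p\<in>primes_class m a n. real p > y})"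
      by (rule card_mono[rotated]) auto
    also have "\<dots> \<le> card {1..nat \<lfloor>y\<rfloor>} + card {p\<in>primes_class m a n. real p > y}"
      by (rule card_Un_le)
    finally have "P n \<le> real (nat \<lfloor>y\<rfloor>) + real (card {p\<in>primes_class m a n. real p > y})"
      unfolding P_def by (simp flip: of_nat_add)
    also have "real (nat \<lfloor>y\<rfloor>) \<le> y" using y0 by (intro of_nat_floor) auto
    also have "real (card {p\<in>primes_class m a n. real p > y}) \<le> \<psi> n / ln y"
    proof -
      have "real (card {p\<in>primes_class m a n. real p > y}) * ln y = (\<Sum>p\<in>{p\<in>primes_class m a n. real p > y}. ln y)"
        by simp
      also have "\<dots> \<le> (\<Sum>p\<in>{p\<in>primes_class m a n. real p > y}. ln (real p))"
        using y0 by (intro sum_mono) auto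
      also have "\<dots> \<le> \<theta> n" unfolding \<theta>_def
        by (intro sum_mono2) (auto simp: primes_class_def intro!: ln_ge_zero dest: prime_ge_1_nat)
      also have "\<dots> \<le> \<psi> n" by (rule \<theta>_le_\<psi>)
      finally show ?thesis using n lny by (simp add: pos_le_divide_eq)
    qed
    finally have "P n \<le> y + \<psi> n / ln y" by simp
    thus ?thesis unfolding lny unfolding y_def .
  qed
  have lim1: "(\<lambda>n. \<psi> n / n - sqrt n * log 2 n * ln n / n) \<longlonglongrightarrow> 1 / real (totient m) - 0"
    by (intro tendsto_diff \<psi>) real_asymp
  have "(\<lambda>n. 1 / ln (real n) + (\<psi> n / n) * (ln n / (ln n - 2 * ln (ln n)))) \<longlonglongrightarrow> 0 + 1 / real (totient m) * 1"
    by (intro tendsto_add tendsto_mult \<psi>) real_asymp+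
  hence lim2: "(\<lambda>n. 1 / ln (real n) + (\<psi> n / n) * (ln n / (ln n - 2 * ln (ln n)))) \<longlonglongrightarrow> 1 / real (totient m)"
    by simp
  have "(\<lambda>n. P n * ln n / n) \<longlonglongrightarrow> 1 / real (totient m)"
  proof (rule tendsto_sandwich[OF _ _ lim1[unfolded diff_zero] lim2])
    show "\<forall>\<^sub>F n in sequentially. \<psi> n / n - sqrt n * log 2 n * ln n / n \<le> P n * ln n / n"
      using eventually_ge_at_top[of 1]
    proof eventually_elim
      case (elim n)
      have "(\<psi> n - sqrt n * log 2 n * ln n) / n \<le> P n * ln n / n"
        using \<psi>_le[OF elim] by (intro divide_right_mono) auto
      thus ?case by (simp add: diff_divide_distrib)
    qed
    have "\<forall>\<^sub>F n in sequentially. ln (real n) - 2 * ln (ln (real n)) > 0" by real_asymp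
    moreover have "\<forall>\<^sub>F n in sequentially. ln (real n) > 1" by real_asymp
    ultimately show "\<forall>\<^sub>F n in sequentially. P n * ln n / n \<le> 1 / ln (real n) + (\<psi> n / n) * (ln n / (ln n - 2 * ln (ln n)))"
    proof eventually_elim
      case (elim n)
      have n0: "real n > 0" using elim(2) by (cases "n = 0") auto
      have "P n * ln n / n \<le> (real n / (ln n)\<^sup>2 + \<psi> n / (ln n - 2 * ln (ln n))) * ln n / n"
        using P_le[OF elim] elim by (intro divide_right_mono mult_right_mono) auto
      also have "\<dots> = 1 / ln (real n) + (\<psi> n / n) * (ln n / (ln n - 2 * ln (ln n)))"
      proof -
        have alg: "(x / L\<^sup>2 + y / D) * L / x = 1 / L + (y / x) * (L / D)" if "x > 0" "L > 0" "D > 0" for x y L D :: real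
          using that by (simp add: field_simps power2_eq_square)
        show ?thesis by (rule alg) (use elim n0 in linarith)+
      qed
      finally show ?case .
    qed
  qed
  thus ?thesis by (simp add: P_def)
qed

lemma prime_density_nat:
  assumes m: "m \<ge> 1" and a: "coprime a m"
  shows "(\<lambda>n. real (card (primes_class m a n)) / real (card (primes_class 1 0 n))) \<longlonglongrightarrow> 1 / real (totient m)"
proof -
  have "(\<lambda>n. real (card (primes_class 1 0 n)) * ln n / n) \<longlonglongrightarrow> 1"
    using prime_number_theorem_residue_class[of 1 0] by simp
  from tendsto_divide[OF prime_number_theorem_residue_class[OF m a] this]
  have "(\<lambda>n. (real (card (primes_class m a n)) * ln n / n) / (real (card (primes_class 1 0 n)) * ln n / n)) \<longlonglongrightarrow> 1 / real (totient m)"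
    by simp
  moreover have "\<forall>\<^sub>F n in sequentially. (real (card (primes_class m a n)) * ln n / n) / (real (card (primes_class 1 0 n)) * ln n / n) =
     real (card (primes_class m a n)) / real (card (primes_class 1 0 n))"
    using eventually_gt_at_top[of 1] by eventually_elim simp
  ultimately show ?thesis by (rule Lim_transform_eventually)
qed

section \<open>A uniform bound for primes congruent to 1\<close>

text \<open>Modulo the part A of n! that is coprime to u, multiplying each factor k u + 1 by an inverse v of u gives
  a product of n consecutive integers.\<close>

lemma coprime_part_dvd_progression:
  fixes u n A :: nat
  assumes A: "A dvd fact n" "coprime A u"
  shows "A dvd (\<Prod>k=1..n. k * u + 1)"
proof -
  obtain v where v: "[u * v = 1] (mod A)" using A(2) cong_solve_coprime_nat[of u A] by (auto simp: coprime_commute)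
  have "[v ^ n * (\<Prod>k=1..n. k * u + 1) = (\<Prod>k=1..n. v + k)] (mod A)"
  proof -
    have "(\<Prod>k=1..n. v) = v ^ n" by simp
    hence "v ^ n * (\<Prod>k=1..n. k * u + 1) = (\<Prod>k=1..n. v * (k * u + 1))" by (simp only: prod.distrib)
    also have "[(\<Prod>k=1..n. v * (k * u + 1)) = (\<Prod>k=1..n. v + k)] (mod A)"
    proof (rule cong_prod)
      fix k
      have "[k * (u * v) + v = k * 1 + v] (mod A)" by (intro cong_add cong_mult cong_refl v)
      thus "[v * (k * u + 1) = v + k] (mod A)" by (simp add: algebra_simps)
    qed
    finally show ?thesis .
  qed
  moreover have "fact n dvd (\<Prod>k=1..n. v + k)"
  proof -
    have "(\<Prod>k=1..n. v + k) * fact v = fact (v + n)"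
    proof (induction n)
      case (Suc n)
      have "(\<Prod>k=1..Suc n. v + k) * fact v = ((\<Prod>k=1..n. v + k) * fact v) * (v + Suc n)"
        by (simp add: algebra_simps)
      also have "\<dots> = fact (v + n) * (v + Suc n)" by (simp only: Suc)
      also have "\<dots> = fact (v + Suc n)" by simp
      finally show ?case .
    qed simp
    moreover have "(v + n choose n) * (fact n * fact v) = (fact (v + n) :: nat)"
      using binomial_fact_lemma[of n "v + n"] by (simp add: mult_ac)
    ultimately have "(\<Prod>k=1..n. v + k) * fact v = ((v + n choose n) * fact n) * fact v" by (simp add: mult_ac)
    hence "(\<Prod>k=1..n. v + k) = (v + n choose n) * fact n" by simp
    thus ?thesis by simp
  qed
  hence "A dvd (\<Prod>k=1..n. v + k)" using A(1) dvd_trans by blast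
  ultimately have "A dvd v ^ n * (\<Prod>k=1..n. k * u + 1)" using cong_dvd_iff by blast
  moreover have "coprime A (v ^ n)"
  proof -
    have "coprime v A" using v by (metis cong_imp_coprime cong_sym coprime_1_left coprime_mult_left_iff)
    thus ?thesis by (simp add: coprime_commute)
  qed
  ultimately show ?thesis by (simp add: coprime_dvd_mult_right_iff)
qed

text \<open>With q = n div p, the multiples of p give the recursion v(n!) = q + v(q!), and 2 q is at
  most n. The bound lets u ^ n absorb the p-part of n! for every prime p dividing u.\<close>

lemma multiplicity_fact_less:
  fixes p n :: nat
  assumes p: "prime p"
  shows "multiplicity p (fact n :: nat) \<le> n"
proof (induction n rule: less_induct)
  case (less n)
  show ?case
  proof (cases "n = 0")
    case False
    have p2: "p \<ge> 2" using p prime_ge_2_nat by blast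
    define q where "q = n div p"
    have qn: "q < n" using False p2 by (simp add: q_def)
    have "multiplicity p (fact n :: nat) = (\<Sum>k=1..n. multiplicity p k)"
      unfolding fact_prod using p by (simp add: prime_elem_multiplicity_prod_distrib)
    also have "\<dots> = (\<Sum>k\<in>(\<lambda>j. p * j) ` {1..q}. multiplicity p k)"
    proof (rule sum.mono_neutral_right)
      show "(\<lambda>j. p * j) ` {1..q} \<subseteq> {1..n}"
      proof safe
        fix j assume j: "j \<in> {1..q}"
        have "p * j \<le> p * q" using j by simp
        also have "\<dots> \<le> n" by (simp add: q_def)
        finally show "p * j \<in> {1..n}" using j p2 by auto
      qed
      show "\<forall>k\<in>{1..n} - (\<lambda>j. p * j) ` {1..q}. multiplicity p k = 0"
      proof
        fix k assume k: "k \<in> {1..n} - (\<lambda>j. p * j) ` {1..q}"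
        have "\<not> p dvd k"
        proof
          assume "p dvd k"
          then obtain j where j: "k = p * j" by blast
          have "j \<ge> 1" using k j by (auto simp: Suc_le_eq intro!: Nat.gr0I)
          moreover have "j \<le> q" unfolding q_def using k j p2 by (simp add: less_eq_div_iff_mult_less_eq mult.commute)
          ultimately show False using k j by auto
        qed
        thus "multiplicity p k = 0" by (rule not_dvd_imp_multiplicity_0)
      qed
    qed auto
    also have "\<dots> = (\<Sum>j=1..q. multiplicity p (p * j))"
      using p2 by (subst sum.reindex) (auto simp: inj_on_def)
    also have "\<dots> = (\<Sum>j=1..q. 1 + multiplicity p j)"
      using p p2 by (intro sum.cong) (auto simp: multiplicity_times_same)
    also have "\<dots> = q + (\<Sum>j=1..q. multiplicity p j)" by (simp only: sum.distrib) simp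
    also have "(\<Sum>j=1..q. multiplicity p j) = multiplicity p (fact q :: nat)"
      unfolding fact_prod using p by (simp add: prime_elem_multiplicity_prod_distrib)
    also have "\<dots> \<le> q" by (rule less.IH[OF qn])
    also have "q + q \<le> n"
    proof -
      have "2 * q \<le> p * q" using p2 by simp
      also have "\<dots> \<le> n" by (simp add: q_def)
      finally show ?thesis by simp
    qed
    finally show ?thesis by simp
  qed auto
qed

text \<open>Take B to be the gcd of n! and u ^ n. For a prime p dividing u the exponent of p in n!
  is at most n, so B contains the whole p-part and A none of it.\<close>

lemma fact_split_coprime:
  fixes u n :: nat
  assumes u: "u \<ge> 1"
  obtains A B where "fact n = A * B" "coprime A u" "B dvd u ^ n"
proof -
  define B where "B = gcd (fact n) (u ^ n)"
  have B: "B dvd fact n" "B dvd u ^ n" "B > 0" by (auto simp: B_def)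
  from B(1) obtain A where "fact n = B * A" by (rule dvdE)
  hence A: "fact n = A * B" by (simp only: mult.commute)
  have "coprime A u"
  proof (rule ccontr)
    assume "\<not> coprime A u"
    hence "gcd A u \<noteq> 1" using coprime_iff_gcd_eq_1 by blast
    then obtain p where "prime p" "p dvd gcd A u" using prime_factor_nat by blast
    hence p: "prime p" "p dvd A" "p dvd u" by auto
    have "A * B \<noteq> 0" unfolding A[symmetric] by simp
    hence A0: "A > 0" by simp
    have u0: "u ^ n > 0" using u by simp
    have mA: "multiplicity p A \<ge> 1" using p A0 by (simp add: Suc_le_eq prime_multiplicity_gt_zero_iff)
    have mu: "multiplicity p u \<ge> 1" using p u by (simp add: Suc_le_eq prime_multiplicity_gt_zero_iff)
    have "multiplicity p (fact n) = multiplicity p A + multiplicity p B"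
      unfolding A using p(1) A0 B by (intro prime_elem_multiplicity_mult_distrib) auto
    moreover have "multiplicity p B = min (multiplicity p (fact n)) (multiplicity p (u ^ n))"
      unfolding B_def using u0 by (intro multiplicity_gcd) (auto simp: p)
    moreover have "multiplicity p (u ^ n) = n * multiplicity p u"
      using p u by (simp add: prime_elem_multiplicity_power_distrib)
    moreover have "n * 1 \<le> n * multiplicity p u" using mu by (intro mult_left_mono) auto
    ultimately show False using mA multiplicity_fact_less[OF p(1), of n] by simp
  qed
  thus ?thesis using that A B by blast
qed

lemma prod_primes_dvd:
  fixes P :: nat
  assumes "finite Q" "\<And>p. p \<in> Q \<Longrightarrow> prime p" "\<And>p. p \<in> Q \<Longrightarrow> p dvd P"
  shows "(\<Prod>p\<in>Q. p) dvd P"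
  using assms
proof (induction Q rule: finite_induct)
  case (insert p Q)
  have "coprime p (\<Prod>q\<in>Q. q)"
  proof (rule prod_coprime_right)
    fix q assume "q \<in> Q"
    thus "coprime p q" using insert by (intro primes_coprime) auto
  qed
  thus ?case using insert by (simp add: divides_mult)
qed auto

text \<open>Chebyshev's argument: these primes divide the product of the first n terms of the progression, and
  they still divide it after the part of n! coprime to u has been cancelled.\<close>

lemma prod_primes_progression_le:
  fixes u n :: nat
  assumes u: "u \<ge> 2"
  shows "(\<Prod>p\<in>{p. prime p \<and> p \<le> n * u + 1 \<and> [p = 1] (mod u) \<and> p > n}. p) \<le> (u * (u + 1)) ^ n"
proof -
  define Q where "Q = {p. prime p \<and> p \<le> n * u + 1 \<and> [p = 1] (mod u) \<and> p > n}"
  have finQ: "finite Q" by (rule finite_subset[of _ "{..n * u + 1}"]) (auto simp: Q_def)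
  define P where "P = (\<Prod>k=1..n. k * u + 1)"
  obtain A B where AB: "fact n = A * B" "coprime A u" "B dvd u ^ n"
    using fact_split_coprime[of u n] u by auto
  have "A dvd P" unfolding P_def using AB by (intro coprime_part_dvd_progression) auto
  moreover have "(\<Prod>p\<in>Q. p) dvd P"
  proof (rule prod_primes_dvd[OF finQ])
    fix p assume p: "p \<in> Q"
    hence "p > 1" using prime_gt_1_nat by (auto simp: Q_def)
    have "u dvd p - 1" using p \<open>p > 1\<close> by (auto simp: Q_def cong_altdef_nat)
    then obtain k where "p - 1 = u * k" by (rule dvdE)
    hence pk: "p = k * u + 1" using \<open>p > 1\<close> by (simp add: mult.commute)
    have "k * u \<le> n * u" using p pk by (simp add: Q_def)
    hence "k \<le> n" using u by simp
    moreover have "k \<noteq> 0" using pk \<open>p > 1\<close> by auto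
    ultimately have "k \<in> {1..n}" by simp
    hence "k * u + 1 dvd P" unfolding P_def by (intro dvd_prodI) auto
    thus "p dvd P" using pk by simp
  qed (auto simp: Q_def)
  moreover have "coprime (\<Prod>p\<in>Q. p) A"
  proof (rule prod_coprime_left)
    fix p assume p: "p \<in> Q"
    hence "\<not> p dvd fact n" by (auto simp: Q_def prime_dvd_fact_iff)
    hence "\<not> p dvd A" using AB(1) dvd_mult2[of p A B] by auto
    thus "coprime p A" using p by (intro prime_imp_coprime) (auto simp: Q_def)
  qed
  ultimately have dvd: "(\<Prod>p\<in>Q. p) * A dvd P" by (intro divides_mult) auto
  have Ppos: "P > 0" by (simp add: P_def)
  have B_le: "B \<le> u ^ n" using AB(3) u by (intro dvd_imp_le) auto
  have "P \<le> (\<Prod>k=1..n. k * (u + 1))" unfolding P_def by (intro prod_mono) (auto simp: algebra_simps)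
  also have "\<dots> = (\<Prod>k=1..n. k) * (\<Prod>k=1..n. u + 1)" by (rule prod.distrib)
  also have "\<dots> = fact n * (u + 1) ^ n" by (simp add: fact_prod)
  finally have P_le: "P \<le> fact n * (u + 1) ^ n" .
  \<comment> \<open>Multiplying by B completes A to n!, which can then be cancelled against the n!
    in the bound for P; the cost is u ^ n.\<close>
  have "(\<Prod>p\<in>Q. p) * fact n = ((\<Prod>p\<in>Q. p) * A) * B" by (simp add: AB(1))
  also have "\<dots> \<le> P * u ^ n" using dvd_imp_le[OF dvd Ppos] B_le by (rule mult_le_mono)
  also have "\<dots> \<le> (fact n * (u + 1) ^ n) * u ^ n" using P_le by (rule mult_le_mono1)
  also have "\<dots> = (u * (u + 1)) ^ n * fact n" by (simp only: power_mult_distrib mult_ac)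
  finally have "(\<Prod>p\<in>Q. p) * fact n \<le> (u * (u + 1)) ^ n * fact n" .
  hence "(\<Prod>p\<in>Q. p) \<le> (u * (u + 1)) ^ n"
    using fact_gt_zero[of n, where 'a = nat] by (simp only: mult_le_cancel2 simp_thms)
  thus ?thesis by (simp only: Q_def)
qed

text \<open>Primes up to N are counted without regard to the class. Each of the others exceeds N,
  and their product is at most u ^ (3 N).\<close>

lemma card_primes_progression_le:
  fixes u N n :: nat
  assumes u: "u \<ge> 2" and N: "N = n div u" "N \<ge> 2"
  shows "real (card (primes_class u 1 n)) \<le> real (card (primes_class 1 0 N)) + 3 * real N * ln (real u) / ln (real N)"
proof -
  define Q where "Q = {p. prime p \<and> p \<le> N * u + 1 \<and> [p = 1] (mod u) \<and> p > N}"
  have finQ: "finite Q" by (rule finite_subset[of _ "{..N * u + 1}"]) (auto simp: Q_def)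
  have "primes_class u 1 n \<subseteq> primes_class 1 0 N \<union> Q"
  proof
    fix p assume p: "p \<in> primes_class u 1 n"
    hence p1: "p > 1" by (auto simp: primes_class_def dest: prime_gt_1_nat)
    have "u dvd p - 1" using p p1 by (auto simp: primes_class_def cong_altdef_nat)
    then obtain k where "p - 1 = u * k" by (rule dvdE)
    hence pk: "p = k * u + 1" using p1 by (simp add: mult.commute)
    have "k * u \<le> n" using p pk by (simp add: primes_class_def)
    hence "k \<le> N" unfolding N(1) using u by (simp add: less_eq_div_iff_mult_less_eq)
    hence "p \<le> N * u + 1" using pk by simp
    thus "p \<in> primes_class 1 0 N \<union> Q" using p by (auto simp: primes_class_def Q_def)
  qed
  hence "card (primes_class u 1 n) \<le> card (primes_class 1 0 N \<union> Q)"
    using finQ by (intro card_mono) auto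
  also have "\<dots> \<le> card (primes_class 1 0 N) + card Q" by (rule card_Un_le)
  finally have 1: "real (card (primes_class u 1 n)) \<le> real (card (primes_class 1 0 N)) + real (card Q)"
    by (simp flip: of_nat_add)
  have "N ^ card Q = (\<Prod>p\<in>Q. N)" by simp
  also have "\<dots> \<le> (\<Prod>p\<in>Q. p)" by (intro prod_mono) (auto simp: Q_def)
  also have "\<dots> \<le> (u * (u + 1)) ^ N" unfolding Q_def by (rule prod_primes_progression_le[OF u])
  also have "\<dots> \<le> (u ^ 3) ^ N"
  proof (intro power_mono)
    have "u + 1 \<le> u * u" using u by (metis add_le_cancel_left le_trans mult_2 mult_le_mono1 one_le_numeral)
    hence "u * (u + 1) \<le> u * (u * u)" by (rule mult_le_mono2)
    thus "u * (u + 1) \<le> u ^ 3" by (simp add: power3_eq_cube)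
  qed auto
  finally have "real (N ^ card Q) \<le> real ((u ^ 3) ^ N)" by (simp only: of_nat_le_iff)
  hence "ln (real N ^ card Q) \<le> ln ((real u ^ 3) ^ N)" using N u by simp
  hence "real (card Q) * ln (real N) \<le> real N * (3 * ln (real u))" using N u by (simp add: ln_realpow)
  moreover have "ln (real N) > 0" using N by simp
  ultimately have "real (card Q) \<le> real N * (3 * ln (real u)) / ln (real N)" by (simp add: pos_le_divide_eq)
  with 1 show ?thesis by (simp add: mult_ac)
qed

lemma nat_div_bounds:
  fixes n u :: nat
  assumes u: "u \<ge> 1"
  shows "real (n div u) \<le> real n / real u" "real n / real u < real (n div u) + 1"
proof -
  have "real (n div u * u) \<le> real n" by (simp only: of_nat_le_iff div_times_less_eq_dividend)
  thus "real (n div u) \<le> real n / real u" using u by (simp add: pos_le_divide_eq)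
  have "n < u + n div u * u" by (rule dividend_less_div_times) (use u in simp)
  hence "real n < real (u + n div u * u)" by (simp only: of_nat_less_iff)
  thus "real n / real u < real (n div u) + 1" using u by (simp add: pos_divide_less_eq algebra_simps)
qed

text \<open>Trades ln u for u powr (1/4), which explains the exponent -3/4 of the uniform
  bound.\<close>

lemma ln_le_root4: "x \<ge> 1 \<Longrightarrow> ln x \<le> 4 * x powr (1/4)" for x :: real
proof -
  assume x: "x \<ge> 1"
  have "ln (x powr (1/4)) \<le> x powr (1/4)" using x by (intro ln_bound) auto
  thus ?thesis using x by (simp add: ln_powr)
qed

text \<open>For u^2 <= n the quotient N = n div u is at least sqrt n - 1, so ln N is comparable to
  ln n and Chebyshev's bound is strong enough. For u^2 > n the trivial count n / u suffices, because
  the factor ln n that it loses is at most 2 ln u. The threshold n0 is independent of u.\<close>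

lemma prime_progression_uniform_bound:
  "\<exists>C n0. \<forall>n\<ge>n0. \<forall>u\<ge>1. real (card (primes_class u 1 n)) \<le> C * real u powr (-3/4) * real (card (primes_class 1 0 n))"
proof -
  define P where "P n = real (card (primes_class 1 0 n))" for n
  have lim: "(\<lambda>n. P n * ln n / n) \<longlonglongrightarrow> 1"
    using prime_number_theorem_residue_class[of 1 0] by (simp add: P_def)
  have "\<forall>\<^sub>F n in sequentially. P n * ln n / n > 1 / 2" "\<forall>\<^sub>F n in sequentially. P n * ln n / n < 2"
    by (rule order_tendstoD[OF lim]; simp)+
  hence "\<forall>\<^sub>F n in sequentially. n \<ge> 3 \<and> P n * ln n / n > 1 / 2 \<and> P n * ln n / n < 2"
    using eventually_ge_at_top[of 3] by eventually_elim simp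
  then obtain n1 where n1: "\<And>n. n \<ge> n1 \<Longrightarrow> n \<ge> 3 \<and> P n * ln n / n > 1 / 2 \<and> P n * ln n / n < 2"
    by (auto simp: eventually_sequentially)
  have low: "real n \<le> 2 * P n * ln n" and upp: "P n \<le> 2 * real n / ln n" if "n \<ge> n1" for n
  proof -
    have n: "n \<ge> 3" "P n * ln n / n > 1 / 2" "P n * ln n / n < 2" using n1[OF that] by auto
    have "ln (real n) > 0" using n(1) by simp
    thus "real n \<le> 2 * P n * ln n" "P n \<le> 2 * real n / ln n" using n by (auto simp: field_simps)
  qed
  have "\<forall>\<^sub>F n in sequentially. sqrt (real n) - 1 \<ge> real n powr (1/4) \<and> sqrt (real n) - 1 \<ge> real (max n1 2) \<and> n \<ge> max n1 3"
    by (intro eventually_conj eventually_ge_at_top; real_asymp)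
  then obtain n0 where n0: "\<And>n. n \<ge> n0 \<Longrightarrow> sqrt (real n) - 1 \<ge> real n powr (1/4) \<and> sqrt (real n) - 1 \<ge> real (max n1 2) \<and> n \<ge> max n1 3"
    by (auto simp: eventually_sequentially)
  \<comment> \<open>112 = 14 * 4 * 2, with 14 = 2 + 3 * 4 from the two terms of the count, 4 from ln
    N >= ln n / 4, and 2 from n <= 2 * P n * ln n.\<close>
  have "real (card (primes_class u 1 n)) \<le> 112 * real u powr (-3/4) * P n" if n: "n \<ge> n0" and u1: "u \<ge> 1" for n u
  proof -
    have nn: "n \<ge> n1" "n \<ge> 3" using n0[OF n] by auto
    have lnn: "ln (real n) > 0" using nn by simp
    have P0: "P n \<ge> 0" by (simp add: P_def)
    have u34: "real u powr (-3/4) = real u powr (1/4) / real u"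
    proof -
      have "real u powr (1/4) / real u powr 1 = real u powr (1/4 - 1)" by (rule powr_diff[symmetric])
      thus ?thesis using u1 by simp
    qed
    have lnu: "ln (real u) \<le> 4 * real u powr (1/4)" using u1 by (intro ln_le_root4) auto
    have one: "1 \<le> real u powr (1/4)" using u1 by (intro ge_one_powr_ge_zero) auto
    consider "u = 1" | "u \<ge> 2" "u * u \<le> n" | "u \<ge> 2" "u * u > n" using u1 by linarith
    thus ?thesis
    proof cases
      case 1
      have "card (primes_class u 1 n) \<le> card (primes_class 1 0 n)"
        by (intro card_mono) (auto simp: primes_class_def)
      hence "real (card (primes_class u 1 n)) \<le> P n" by (simp add: P_def)
      also have "\<dots> \<le> 112 * real u powr (-3/4) * P n" using 1 P0 by simp
      finally show ?thesis .
    next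
      case 2
      define N where "N = n div u"
      have "(real u)\<^sup>2 \<le> real n" using 2(2) by (metis of_nat_le_iff of_nat_mult power2_eq_square)
      hence us: "real u \<le> sqrt (real n)" by (rule real_le_rsqrt)
      have "sqrt (real n) * real u \<le> sqrt (real n) * sqrt (real n)" using us by (intro mult_left_mono) auto
      hence "sqrt (real n) \<le> real n / real u" using 2 by (simp add: pos_le_divide_eq)
      also have "real n / real u < real N + 1" unfolding N_def by (rule nat_div_bounds(2)[OF u1])
      finally have Ns: "real N \<ge> sqrt (real n) - 1" by simp
      have N1: "N \<ge> n1" "N \<ge> 2" using n0[OF n] Ns by auto
      have Nu: "real N \<le> real n / real u" unfolding N_def by (rule nat_div_bounds(1)[OF u1])
      have "real n powr (1/4) \<le> real N" using n0[OF n] Ns by linarith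
      hence "ln (real n powr (1/4)) \<le> ln (real N)" using nn N1 by (subst ln_le_cancel_iff) auto
      hence lnN: "ln (real n) / 4 \<le> ln (real N)" using nn by (simp add: ln_powr)
      have lnN0: "ln (real N) > 0" using N1 by simp
      have "real (card (primes_class u 1 n)) \<le> P N + 3 * real N * ln (real u) / ln (real N)"
        unfolding P_def by (rule card_primes_progression_le[OF 2(1) N_def N1(2)])
      also have "\<dots> \<le> 2 * real N / ln N + 3 * real N * ln (real u) / ln (real N)" using upp[OF N1(1)] by simp
      also have "\<dots> = (2 + 3 * ln (real u)) * real N / ln (real N)" by (simp add: add_divide_distrib ring_distribs mult_ac)
      also have "\<dots> \<le> (14 * real u powr (1/4)) * (real n / real u) / (ln (real n) / 4)"
      proof (rule frac_le)
        show "(2 + 3 * ln (real u)) * real N \<le> (14 * real u powr (1/4)) * (real n / real u)"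
          using lnu one Nu u1 by (intro mult_mono) auto
      qed (use lnN lnn in auto)
      also have "\<dots> = 56 * real u powr (-3/4) * (real n / ln (real n))" unfolding u34 by simp
      also have "\<dots> \<le> 56 * real u powr (-3/4) * (2 * P n)"
        using low[OF nn(1)] lnn by (intro mult_left_mono) (auto simp: divide_le_eq)
      finally show ?thesis by simp
    next
      case 3
      have "primes_class u 1 n \<subseteq> (\<lambda>k. k * u + 1) ` {1..n div u}"
      proof
        fix p assume p: "p \<in> primes_class u 1 n"
        hence p1: "p > 1" by (auto simp: primes_class_def dest: prime_gt_1_nat)
        have "u dvd p - 1" using p p1 by (auto simp: primes_class_def cong_altdef_nat)
        then obtain k where "p - 1 = u * k" by (rule dvdE)
        hence pk: "p = k * u + 1" using p1 by (simp add: mult.commute)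
        have "k * u \<le> n" using p pk by (simp add: primes_class_def)
        hence "k \<le> n div u" using 3 by (simp add: less_eq_div_iff_mult_less_eq)
        moreover have "k \<noteq> 0" using pk p1 by auto
        ultimately show "p \<in> (\<lambda>k. k * u + 1) ` {1..n div u}" using pk by auto
      qed
      hence "card (primes_class u 1 n) \<le> card {1..n div u}" by (rule surj_card_le[rotated]) auto
      hence "real (card (primes_class u 1 n)) \<le> real (n div u)" by simp
      also have "\<dots> \<le> real n / real u" by (rule nat_div_bounds(1)[OF u1])
      also have "\<dots> \<le> (2 * P n * ln n) / real u" using low[OF nn(1)] by (intro divide_right_mono) auto
      also have "\<dots> \<le> (2 * P n * (8 * real u powr (1/4))) / real u"
      proof (intro divide_right_mono mult_left_mono)
        have "real n \<le> real u ^ 2" using 3(2) by (metis less_imp_le of_nat_le_iff of_nat_mult power2_eq_square)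
        hence "ln (real n) \<le> ln (real u ^ 2)" using nn 3 by (subst ln_le_cancel_iff) auto
        also have "\<dots> = 2 * ln (real u)" using 3 by (simp add: ln_realpow)
        finally show "ln (real n) \<le> 8 * real u powr (1/4)" using lnu by linarith
      qed (use P0 in auto)
      also have "\<dots> = 16 * real u powr (-3/4) * P n" unfolding u34 by simp
      also have "\<dots> \<le> 112 * real u powr (-3/4) * P n" using P0 by (intro mult_right_mono) auto
      finally show ?thesis .
    qed
  qed
  thus ?thesis unfolding P_def by blast
qed

section \<open>Averages over primes\<close>

abbreviation primes_le :: "nat \<Rightarrow> nat set" where
  "primes_le n \<equiv> primes_class 1 0 n"

lemma primes_le_iff: "p \<in> primes_class (Suc 0) 0 n \<longleftrightarrow> prime p \<and> p \<le> n"
  by (simp add: primes_class_def)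

lemma card_primes_le_at_top: "filterlim (\<lambda>n. real (card (primes_le n))) at_top sequentially"
proof -
  have lim: "(\<lambda>n. real (card (primes_le n)) * ln n / n) \<longlonglongrightarrow> 1"
    using prime_number_theorem_residue_class[of 1 0] by simp
  have "filterlim (\<lambda>n. (real (card (primes_le n)) * ln n / n) * (n / ln n)) at_top sequentially"
    by (rule filterlim_tendsto_pos_mult_at_top[OF lim]) (simp, real_asymp)
  moreover have "\<forall>\<^sub>F n in sequentially. (real (card (primes_le n)) * ln n / n) * (n / ln n) = real (card (primes_le n))"
    using eventually_gt_at_top[of 1] by eventually_elim simp
  ultimately show ?thesis by (rule filterlim_cong[OF refl refl, THEN iffD1, rotated])
qed

definition prime_mean :: "(nat \<Rightarrow> real) \<Rightarrow> nat \<Rightarrow> real" where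
  "prime_mean g n = (\<Sum>p\<in>primes_le n. g p) / real (card (primes_le n))"

text \<open>Dominated exchange of limit and sum: the uniform bound for primes congruent to 1 mod u k
  majorises the k-th term by a multiple of |c k| * u k powr (-3/4), for all large n at once.\<close>

lemma prime_mean_tendsto_suminf:
  fixes c e :: "nat \<Rightarrow> real" and u :: "nat \<Rightarrow> nat" and A :: "nat \<Rightarrow> nat set" and g :: "nat \<Rightarrow> real"
  assumes u: "\<And>k. u k \<ge> 1" and sub: "\<And>k p. p \<in> A k \<Longrightarrow> [p = 1] (mod u k)"
    and dens: "\<And>k. (\<lambda>n. real (card (primes_le n \<inter> A k)) / real (card (primes_le n))) \<longlonglongrightarrow> e k"
    and summ: "summable (\<lambda>k. \<bar>c k\<bar> * real (u k) powr (-3/4))"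
    and g: "\<And>p. prime p \<Longrightarrow> (\<lambda>k. if p \<in> A k then c k else 0) sums g p"
  shows "prime_mean g \<longlonglongrightarrow> (\<Sum>k. c k * e k)"
proof -
  obtain C n0 where C: "\<And>n u. n \<ge> n0 \<Longrightarrow> u \<ge> 1 \<Longrightarrow> real (card (primes_class u 1 n)) \<le> C * real u powr (-3/4) * real (card (primes_le n))"
    using prime_progression_uniform_bound by blast
  define D where "D = max C 0"
  define a where "a k n = c k * (real (card (primes_le n \<inter> A k)) / real (card (primes_le n)))" for k n
  have sums: "(\<lambda>k. a k n) sums prime_mean g n" for n
  proof -
    have "(\<lambda>k. \<Sum>p\<in>primes_le n. if p \<in> A k then c k else 0) sums (\<Sum>p\<in>primes_le n. g p)"
      by (intro sums_sum g) (simp add: primes_le_iff)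
    moreover have "(\<Sum>p\<in>primes_le n. if p \<in> A k then c k else 0) = c k * real (card (primes_le n \<inter> A k))" for k
      by (subst sum.inter_restrict[symmetric]) auto
    ultimately have "(\<lambda>k. c k * real (card (primes_le n \<inter> A k)) / real (card (primes_le n))) sums prime_mean g n"
      unfolding prime_mean_def by (intro sums_divide) simp
    thus ?thesis by (simp add: a_def)
  qed
  have "(\<lambda>n. \<Sum>k. a k n) \<longlonglongrightarrow> (\<Sum>k. c k * e k)"
  proof (rule tannerys_theorem[THEN conjunct2, THEN conjunct2])
    show "a k \<longlonglongrightarrow> c k * e k" for k unfolding a_def by (intro tendsto_intros dens)
    show "summable (\<lambda>k. D * (\<bar>c k\<bar> * real (u k) powr (-3/4)))" by (intro summable_mult summ)
    have le: "norm (a k n) \<le> D * (\<bar>c k\<bar> * real (u k) powr (-3/4))" if "n \<ge> n0" for k n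
    proof -
      have "card (primes_le n \<inter> A k) \<le> card (primes_class (u k) 1 n)"
        using sub by (intro card_mono) (auto simp: primes_class_def)
      hence "real (card (primes_le n \<inter> A k)) \<le> real (card (primes_class (u k) 1 n))" by simp
      also have "\<dots> \<le> C * real (u k) powr (-3/4) * real (card (primes_le n))" by (rule C[OF that u])
      also have "\<dots> \<le> D * real (u k) powr (-3/4) * real (card (primes_le n))"
        by (intro mult_right_mono) (auto simp: D_def)
      finally have *: "real (card (primes_le n \<inter> A k)) \<le> D * real (u k) powr (-3/4) * real (card (primes_le n))" .
      have "real (card (primes_le n \<inter> A k)) / real (card (primes_le n)) \<le> D * real (u k) powr (-3/4)"
      proof (cases "card (primes_le n) = 0")
        case False
        thus ?thesis using * by (subst pos_divide_le_eq) auto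
      next
        case True
        have "0 \<le> D * real (u k) powr (-3/4)" by (simp add: D_def)
        thus ?thesis unfolding True by simp
      qed
      hence "\<bar>c k\<bar> * (real (card (primes_le n \<inter> A k)) / real (card (primes_le n))) \<le> \<bar>c k\<bar> * (D * real (u k) powr (-3/4))"
        by (intro mult_left_mono) auto
      moreover have "norm (a k n) = \<bar>c k\<bar> * (real (card (primes_le n \<inter> A k)) / real (card (primes_le n)))"
        by (simp add: a_def abs_mult)
      ultimately show ?thesis by (simp only: mult_ac)
    qed
    have "eventually (\<lambda>k::nat. True) sequentially" "eventually (\<lambda>n. n \<ge> n0) sequentially"
      by (simp, rule eventually_ge_at_top)
    thus "\<forall>\<^sub>F (k, n) in sequentially \<times>\<^sub>F sequentially. norm (a k n) \<le> D * (\<bar>c k\<bar> * real (u k) powr (-3/4))"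
      unfolding eventually_prod_filter using le by blast
  qed auto
  moreover have "(\<lambda>n. \<Sum>k. a k n) = prime_mean g" using sums by (auto simp: sums_iff)
  ultimately show ?thesis by simp
qed

lemma N_count_eq_prime_mean:
  assumes "x \<ge> 0"
  shows "N_count a d x / real (prime_pi x) = prime_mean (\<lambda>p. delta_p p a d) (nat \<lfloor>x\<rfloor>)"
proof -
  have "{p. prime p \<and> real p \<le> x} = primes_le (nat \<lfloor>x\<rfloor>)"
    using assms by (auto simp: primes_le_iff le_nat_floor le_nat_iff le_floor_iff)
  thus ?thesis by (simp add: N_count_def prime_pi_def prime_mean_def)
qed

lemma has_deltaI:
  assumes "prime_mean (\<lambda>p. delta_p p a d) \<longlonglongrightarrow> L"
  shows "has_delta a d L"
  unfolding has_delta_def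
proof (rule Lim_transform_eventually)
  show "((\<lambda>x. prime_mean (\<lambda>p. delta_p p a d) (nat \<lfloor>x\<rfloor>)) \<longlongrightarrow> L) at_top"
    by (rule filterlim_compose[OF assms filterlim_compose[OF filterlim_nat_sequentially filterlim_floor_sequentially]])
  show "\<forall>\<^sub>F x in at_top. prime_mean (\<lambda>p. delta_p p a d) (nat \<lfloor>x\<rfloor>) = N_count a d x / real (prime_pi x)"
    using eventually_ge_at_top[of 0] by eventually_elim (simp add: N_count_eq_prime_mean)
qed

lemma has_delta_imp_delta: "has_delta a d L \<Longrightarrow> delta a d = L"
  unfolding has_delta_def delta_def by (rule tendsto_Lim) auto

section \<open>Multiplicative orders divisible by d\<close>

lemma card_ord_eq_sum_totient:
  assumes p: "prime p"
  shows "card {x \<in> {1..p-1}. P (ord p x)} = (\<Sum>j | j dvd p - 1 \<and> P j. totient j)"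
proof -
  have p1: "p > 1" using p prime_gt_1_nat by auto
  have tot: "{1..p-1} = totatives p" using p p1 by (auto simp: totatives_prime)
  have dvd: "ord p x dvd p - 1" if "x \<in> totatives p" for x
    using that order_divides_totient[of p x] p by (auto simp: totatives_def coprime_commute totient_prime)
  have fin: "finite {j. j dvd p - 1 \<and> P j}" using p1 by (intro finite_subset[OF _ finite_divisors_nat[of "p - 1"]]) auto
  have "{x \<in> {1..p-1}. P (ord p x)} = (\<Union>j\<in>{j. j dvd p - 1 \<and> P j}. {x\<in>totatives p. ord p x = j})"
    unfolding tot using dvd by blast
  hence "card {x \<in> {1..p-1}. P (ord p x)} = (\<Sum>j | j dvd p - 1 \<and> P j. card {x\<in>totatives p. ord p x = j})"
    using fin by (simp only:) (subst card_UN_disjoint, auto)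
  also have "\<dots> = (\<Sum>j | j dvd p - 1 \<and> P j. totient j)"
    using prime_card_elements_with_ord_eq_totient[OF p1 p] by (intro sum.cong) auto
  finally show ?thesis .
qed

lemma common_prime_factor:
  fixes a b :: nat
  assumes "\<not> coprime a b"
  obtains q where "prime q" "q dvd a" "q dvd b"
proof -
  have "gcd a b \<noteq> 1" using assms coprime_iff_gcd_eq_1 by blast
  then obtain q where "prime q" "q dvd gcd a b" using prime_factor_nat by blast
  thus ?thesis using that by auto
qed

text \<open>M1 is the largest divisor of M composed of primes of d; a prime common to M2 and d could
  be moved into it.\<close>

lemma split_coprime_part:
  fixes M d :: nat
  assumes M: "M > 0" and d: "d > 0"
  obtains M1 M2 where "M = M1 * M2" "prime_factors M1 \<subseteq> prime_factors d" "coprime M2 d"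
proof -
  define S where "S = {m. m dvd M \<and> prime_factors m \<subseteq> prime_factors d}"
  have fin: "finite S" unfolding S_def using M by (intro finite_subset[OF _ finite_divisors_nat[of M]]) auto
  have "1 \<in> S" by (simp add: S_def)
  hence "Max S \<in> S" "\<And>x. x \<in> S \<Longrightarrow> x \<le> Max S" using fin by (auto intro: Max_in)
  then obtain M1 where M1: "M1 \<in> S" "\<And>x. x \<in> S \<Longrightarrow> x \<le> M1" by blast
  have M1': "M1 dvd M" "prime_factors M1 \<subseteq> prime_factors d" using M1(1) by (simp_all add: S_def)
  from M1'(1) obtain M2 where M2: "M = M1 * M2" by (rule dvdE)
  have pos: "M1 > 0" "M2 > 0" using M M2 by auto
  have "coprime M2 d"
  proof (rule ccontr)
    assume "\<not> coprime M2 d"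
    then obtain q where q: "prime q" "q dvd M2" "q dvd d" by (rule common_prime_factor)
    have "M1 * q dvd M1 * M2" using q by (intro mult_dvd_mono) auto
    hence "M1 * q dvd M" by (subst M2)
    moreover have "prime_factors (M1 * q) \<subseteq> prime_factors d"
    proof
      fix x assume "x \<in> prime_factors (M1 * q)"
      hence x: "prime x" "x dvd M1 * q" by (auto simp: in_prime_factors_iff)
      hence "x dvd M1 \<or> x dvd q" by (simp add: prime_dvd_mult_iff)
      thus "x \<in> prime_factors d"
      proof
        assume "x dvd M1"
        hence "x \<in> prime_factors (M1)" using x pos by (simp add: in_prime_factors_iff)
        thus ?thesis using M1'(2) by blast
      next
        assume "x dvd q"
        hence "x dvd d" using q dvd_trans by blast
        thus ?thesis using x d by (simp add: in_prime_factors_iff)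
      qed
    qed
    ultimately have "M1 * q \<in> S" by (simp add: S_def)
    hence "M1 * q \<le> M1" by (rule M1(2))
    thus False using pos prime_gt_1_nat[OF q(1)] by simp
  qed
  from that[OF M2 M1'(2) this] show ?thesis .
qed

lemma gcd_coprime_parts:
  fixes M1 M2 n r :: nat
  assumes "coprime M1 M2" "n dvd M1" "r dvd M2"
  shows "gcd (n * r) M1 = n" "gcd (n * r) M2 = r" "coprime n r"
proof -
  show "coprime n r" using assms coprime_divisors by blast
  have "coprime M1 r" "coprime M2 n" using assms coprime_divisors[of M1 M1 r M2] coprime_divisors[of n M1 M2 M2]
    by (simp_all add: coprime_commute)
  thus "gcd (n * r) M1 = n" "gcd (n * r) M2 = r"
    using assms by (simp_all add: gcd_mult_left_right_cancel gcd_mult_left_left_cancel gcd_nat.absorb1)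
qed

lemma totient_same_prime_factors:
  assumes "d > 0" "n > 0" "prime_factors n = prime_factors d"
  shows "real (totient n) = real n * real (totient d) / real d"
  using assms by (simp add: totient_formula2)

definition smooth_multiples :: "nat \<Rightarrow> nat set" where
  "smooth_multiples d = {n. n > 0 \<and> d dvd n \<and> prime_factors n \<subseteq> prime_factors d}"

lemma smooth_multiples_prime_factors:
  assumes "n \<in> smooth_multiples d"
  shows "prime_factors n = prime_factors d"
  using assms dvd_prime_factors[of n d] by (auto simp: smooth_multiples_def)

text \<open>Every divisor j of M divisible by d is n * r with n built from the primes of d and r coprime to d;
  the final step reindexes by n -> M1 * d / n.\<close>

lemma sum_totient_multiples:
  fixes M d :: nat
  assumes M: "M > 0" and d: "d > 0"
  shows "real (\<Sum>j | j dvd M \<and> d dvd j. totient j) = real M * (\<Sum>n\<in>{n\<in>smooth_multiples d. n dvd M}. real (totient d) / real n)"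
proof -
  obtain M1 M2 where MM: "M = M1 * M2" and pf: "prime_factors M1 \<subseteq> prime_factors d" and cop: "coprime M2 d"
    using split_coprime_part[OF M d] by blast
  have pos: "M1 > 0" "M2 > 0" using M MM by auto
  have cop12: "coprime M1 M2"
  proof (rule ccontr)
    assume "\<not> coprime M1 M2"
    then obtain q where q: "prime q" "q dvd M1" "q dvd M2" by (rule common_prime_factor)
    hence "q \<in> prime_factors M1" using pos by (simp add: in_prime_factors_iff)
    hence "q dvd d" using pf by auto
    thus False using q cop coprime_common_divisor[of M2 d q] by (simp add: prime_nat_iff)
  qed
  define N where "N = {n. n dvd M1 \<and> d dvd n}"
  have finN: "finite N" unfolding N_def using pos by (intro finite_subset[OF _ finite_divisors_nat[of M1]]) auto
  have N_eq: "{n\<in>smooth_multiples d. n dvd M} = N"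
  proof (intro equalityI subsetI)
    fix n assume n: "n \<in> {n\<in>smooth_multiples d. n dvd M}"
    have "coprime n M2"
    proof (rule ccontr)
      assume "\<not> coprime n M2"
      then obtain q where q: "prime q" "q dvd n" "q dvd M2" by (rule common_prime_factor)
      hence "q \<in> prime_factors n" using n by (simp add: in_prime_factors_iff smooth_multiples_def)
      hence "q dvd d" using n by (auto simp: smooth_multiples_def)
      thus False using q cop coprime_common_divisor[of M2 d q] by (simp add: prime_nat_iff)
    qed
    hence "n dvd M1" using n MM by (simp add: coprime_dvd_mult_left_iff)
    thus "n \<in> N" using n by (simp add: N_def smooth_multiples_def)
  next
    fix n assume n: "n \<in> N"
    hence "n dvd M1" by (simp add: N_def)
    hence "n > 0" "prime_factors n \<subseteq> prime_factors M1"
      using pos dvd_prime_factors[of M1 n] by (auto intro!: Nat.gr0I)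
    thus "n \<in> {n\<in>smooth_multiples d. n dvd M}" using n pf MM by (auto simp: N_def smooth_multiples_def)
  qed
  have "(\<Sum>j | j dvd M \<and> d dvd j. totient j) = (\<Sum>(n,r)\<in>N \<times> {r. r dvd M2}. totient n * totient r)"
  proof (rule sum.reindex_bij_witness[of _ "\<lambda>(n,r). n * r" "\<lambda>j. (gcd j M1, gcd j M2)"])
    fix j assume j: "j \<in> {j. j dvd M \<and> d dvd j}"
    have "j dvd M1 * M2" using j MM by simp
    then obtain n r where nr: "j = n * r" "n dvd M1" "r dvd M2" using division_decomp by blast
    have g: "gcd j M1 = n" "gcd j M2 = r" "coprime n r"
      using gcd_coprime_parts[OF cop12 nr(2,3)] by (simp_all add: nr(1))
    show "(case (gcd j M1, gcd j M2) of (n, r) \<Rightarrow> n * r) = j" unfolding g by (simp add: nr(1))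
    have "coprime d r" using cop nr(3) coprime_divisors[of r M2 d d] by (simp add: coprime_commute)
    hence "d dvd n" using j nr(1) by (simp add: coprime_dvd_mult_left_iff)
    thus "(gcd j M1, gcd j M2) \<in> N \<times> {r. r dvd M2}" unfolding g using nr by (simp add: N_def)
    show "(case (gcd j M1, gcd j M2) of (n, r) \<Rightarrow> totient n * totient r) = totient j"
      unfolding g using nr(1) totient_mult_coprime[OF g(3)] by simp
  next
    fix x assume "x \<in> N \<times> {r. r dvd M2}"
    then obtain n r where x: "x = (n, r)" "n dvd M1" "d dvd n" "r dvd M2" by (auto simp: N_def)
    show "(gcd (case x of (n, r) \<Rightarrow> n * r) M1, gcd (case x of (n, r) \<Rightarrow> n * r) M2) = x"
      using gcd_coprime_parts[OF cop12 x(2,4)] by (simp add: x(1))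
    show "(case x of (n, r) \<Rightarrow> n * r) \<in> {j. j dvd M \<and> d dvd j}" using x MM by (auto intro: mult_dvd_mono)
  qed
  also have "\<dots> = (\<Sum>n\<in>N. totient n) * (\<Sum>r | r dvd M2. totient r)"
    by (simp add: sum_product sum.cartesian_product)
  also have "(\<Sum>r | r dvd M2. totient r) = M2" by (rule totient_divisor_sum)
  finally have 1: "real (\<Sum>j | j dvd M \<and> d dvd j. totient j) = (\<Sum>n\<in>N. real (totient n)) * real M2" by simp
  have "(\<Sum>n\<in>N. real (totient n)) = (\<Sum>n\<in>N. real n * real (totient d) / real d)"
  proof (intro sum.cong refl)
    fix n assume "n \<in> N"
    hence "n \<in> smooth_multiples d" using N_eq by auto
    thus "real (totient n) = real n * real (totient d) / real d"
      using d by (intro totient_same_prime_factors smooth_multiples_prime_factors) (auto simp: smooth_multiples_def)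
  qed
  also have "\<dots> = (\<Sum>n\<in>N. real M1 * (real (totient d) / real n))"
  proof -
    have inv: "M1 * d div (M1 * d div n) = n \<and> M1 * d div n \<in> N \<and>
      real M1 * (real (totient d) / real (M1 * d div n)) = real n * real (totient d) / real d" if n: "n \<in> N" for n
    proof -
      obtain i k where ik: "n = d * i" "M1 = n * k" using n by (auto simp: N_def elim!: dvdE)
      have p0: "i > 0" "k > 0" "d > 0" using pos ik d by auto
      have div: "M1 * d div n = k * d" unfolding ik using p0 by (simp add: mult.assoc)
      have "M1 * d div (k * d) = n" unfolding ik using p0 by (simp add: mult_ac)
      moreover have "k * d \<in> N" unfolding N_def unfolding ik by (auto simp: mult_ac)
      moreover have "real M1 * (real (totient d) / real (k * d)) = real n * real (totient d) / real d"
        unfolding ik using p0 by (simp add: field_simps)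
      ultimately show ?thesis unfolding div by blast
    qed
    show ?thesis
      by (rule sum.reindex_bij_witness[of _ "\<lambda>n. M1 * d div n" "\<lambda>n. M1 * d div n"]) (use inv in blast)+
  qed
  finally show ?thesis unfolding 1 N_eq by (simp add: MM sum_distrib_left mult_ac)
qed

text \<open>Induction on S: a number corresponds to its exponent at the new prime together with the
  cofactor, and the sum over the exponent is geometric.\<close>

lemma euler_product_finite:
  assumes "finite S" "\<And>p. p \<in> S \<Longrightarrow> prime p"
  shows "((\<lambda>k. 1 / (real k)\<^sup>2) has_sum (\<Prod>p\<in>S. 1 / (1 - 1 / (real p)\<^sup>2))) {k. k > 0 \<and> prime_factors k \<subseteq> S}"
  using assms
proof (induction S rule: finite_induct)
  case empty
  have "{k::nat. k > 0 \<and> prime_factors k \<subseteq> {}} = {1}"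
    by (auto simp: prime_factorization_empty_iff)
  thus ?case by (simp add: has_sum_finite_iff)
next
  case (insert p S)
  define T where "T = {k::nat. k > 0 \<and> prime_factors k \<subseteq> S}"
  define X where "X = (\<Prod>p\<in>S. 1 / (1 - 1 / (real p)\<^sup>2))"
  define r where "r = 1 / (real p)\<^sup>2"
  have p: "prime p" using insert by auto
  have p1: "p > 1" using p prime_gt_1_nat by auto
  have "1 < (real p)\<^sup>2" using p1 by simp
  hence r: "0 \<le> r" "r < 1" unfolding r_def by (simp_all add: divide_less_eq)
  have IH: "((\<lambda>k. 1 / (real k)\<^sup>2) has_sum X) T" unfolding T_def X_def using insert by auto
  have inner: "((\<lambda>k. r ^ i * (1 / (real k)\<^sup>2)) has_sum r ^ i * X) T" for i :: nat by (intro has_sum_cmult_right IH)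
  have "((\<lambda>i::nat. r ^ i) has_sum (1 / (1 - r))) UNIV"
  proof (rule norm_summable_imp_has_sum)
    show "summable (\<lambda>i. norm (r ^ i))" using r by (simp add: norm_power summable_geometric)
    show "(\<lambda>i. r ^ i) sums (1 / (1 - r))" using r by (intro geometric_sums) simp
  qed
  hence outer: "((\<lambda>i::nat. r ^ i * X) has_sum (1 / (1 - r)) * X) UNIV" by (rule has_sum_cmult_left)
  have "(\<lambda>(i::nat, k). r ^ i * (1 / (real k)\<^sup>2)) summable_on UNIV \<times> T"
    by (rule summable_on_SigmaI[where g = "\<lambda>i. r ^ i * X"])
       (use inner outer r in \<open>auto intro: has_sum_imp_summable\<close>)
  hence "((\<lambda>(i::nat, k). r ^ i * (1 / (real k)\<^sup>2)) has_sum (1 / (1 - r)) * X) (UNIV \<times> T)"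
    by (intro has_sum_SigmaI[where g = "\<lambda>i. r ^ i * X"]) (use inner outer in auto)
  also have "((\<lambda>(i::nat, k). r ^ i * (1 / (real k)\<^sup>2)) has_sum (1 / (1 - r)) * X) (UNIV \<times> T) \<longleftrightarrow>
    ((\<lambda>k. 1 / (real k)\<^sup>2) has_sum (1 / (1 - r)) * X) {k. k > 0 \<and> prime_factors k \<subseteq> insert p S}"
  proof (rule has_sum_reindex_bij_witness[of _ "\<lambda>n. (multiplicity p n, n div p ^ multiplicity p n)" "\<lambda>(i, k). p ^ i * k"])
    fix x :: "nat \<times> nat" assume "x \<in> UNIV \<times> T"
    then obtain i k where x: "x = (i, k)" "k > 0" "prime_factors k \<subseteq> S" by (auto simp: T_def)
    have "p \<notin> prime_factors k" using x insert by auto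
    hence "\<not> p dvd k" using p x by (simp add: in_prime_factors_iff)
    hence mult: "multiplicity p (p ^ i * k) = i" using p1 by (intro multiplicity_decomposeI) auto
    show "(multiplicity p (case x of (i, k) \<Rightarrow> p ^ i * k), (case x of (i, k) \<Rightarrow> p ^ i * k) div p ^ multiplicity p (case x of (i, k) \<Rightarrow> p ^ i * k)) = x"
      using p1 by (simp add: x(1) mult)
    have "q \<in> insert p S" if "q \<in> prime_factors (p ^ i * k)" for q
    proof -
      have q: "prime q" "q dvd p ^ i * k" using that by (auto simp: in_prime_factors_iff)
      hence "q dvd p ^ i \<or> q dvd k" by (simp add: prime_dvd_mult_iff)
      thus ?thesis
      proof
        assume "q dvd p ^ i"
        hence "q dvd p" using q(1) prime_dvd_power by blast
        thus ?thesis using q(1) p primes_dvd_imp_eq by blast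
      next
        assume "q dvd k"
        hence "q \<in> prime_factors k" using q(1) x by (simp add: in_prime_factors_iff)
        thus ?thesis using x by blast
      qed
    qed
    thus "(case x of (i, k) \<Rightarrow> p ^ i * k) \<in> {k. k > 0 \<and> prime_factors k \<subseteq> insert p S}"
      using x p1 by auto
    show "1 / (real (case x of (i, k) \<Rightarrow> p ^ i * k))\<^sup>2 = (case x of (i, k) \<Rightarrow> r ^ i * (1 / (real k)\<^sup>2))"
      by (simp add: x(1) r_def power_mult_distrib power_divide power_mult[symmetric] mult.commute)
  next
    fix n assume n: "n \<in> {k. k > 0 \<and> prime_factors k \<subseteq> insert p S}"
    have n0: "n \<noteq> 0" "\<not> is_unit p" using n p1 by auto
    define k where "k = n div p ^ multiplicity p n"
    have nk: "n = p ^ multiplicity p n * k" unfolding k_def by (simp add: multiplicity_dvd)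
    have "k > 0" using nk n0 by (intro Nat.gr0I) auto
    have "\<not> p dvd k" unfolding k_def using multiplicity_decompose[OF n0] .
    have "prime_factors k \<subseteq> S"
    proof
      fix q assume q: "q \<in> prime_factors k"
      hence qq: "prime q" "q dvd k" by (auto simp: in_prime_factors_iff)
      have "k dvd n" by (subst nk) simp
      hence "q dvd n" using qq(2) dvd_trans by blast
      hence "q \<in> prime_factors n" using qq(1) n0 by (simp add: in_prime_factors_iff)
      moreover have "q \<noteq> p" using qq(2) \<open>\<not> p dvd k\<close> by auto
      ultimately show "q \<in> S" using n by auto
    qed
    thus "(multiplicity p n, n div p ^ multiplicity p n) \<in> UNIV \<times> T" using \<open>k > 0\<close> by (simp add: T_def k_def)
    show "(case (multiplicity p n, n div p ^ multiplicity p n) of (i, k) \<Rightarrow> p ^ i * k) = n"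
      using nk by (simp add: k_def)
  qed auto
  finally have "((\<lambda>k. 1 / (real k)\<^sup>2) has_sum (1 / (1 - r)) * X) {k. k > 0 \<and> prime_factors k \<subseteq> insert p S}" .
  thus ?case using insert by (simp add: X_def r_def)
qed

section \<open>The density of orders divisible by d\<close>

definition order_density :: "nat \<Rightarrow> real" where
  "order_density d = (1 / real d) * (\<Prod>p\<in>prime_factors d. 1 / (1 - 1 / (real p)\<^sup>2))"

text \<open>The term d / n^2 is the weight totient d / n times the density 1 / totient n of primes
  congruent to 1 mod n, as n and d have the same prime factors. Writing n = d k leaves an Euler
  product.\<close>

lemma smooth_multiples_has_sum:
  assumes d: "d > 0"
  shows "((\<lambda>n. real d / (real n)\<^sup>2) has_sum order_density d) (smooth_multiples d)"
proof -
  have "((\<lambda>k. (1 / real d) * (1 / (real k)\<^sup>2)) has_sum order_density d) {k. k > 0 \<and> prime_factors k \<subseteq> prime_factors d}"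
    unfolding order_density_def by (intro has_sum_cmult_right euler_product_finite) (auto simp: in_prime_factors_iff)
  also have "((\<lambda>k. (1 / real d) * (1 / (real k)\<^sup>2)) has_sum order_density d) {k. k > 0 \<and> prime_factors k \<subseteq> prime_factors d} \<longleftrightarrow> ?thesis"
  proof (rule has_sum_reindex_bij_witness[of _ "\<lambda>n. n div d" "\<lambda>k. d * k"])
    fix k assume k: "k \<in> {k. k > 0 \<and> prime_factors k \<subseteq> prime_factors d}"
    show "d * k div d = k" using d by simp
    show "d * k \<in> smooth_multiples d" using k d by (auto simp: smooth_multiples_def prime_factors_product)
    show "real d / (real (d * k))\<^sup>2 = (1 / real d) * (1 / (real k)\<^sup>2)" using d by (simp add: power2_eq_square)
  next
    fix n assume n: "n \<in> smooth_multiples d"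
    then obtain k where k: "n = d * k" "k > 0" by (auto simp: smooth_multiples_def)
    show "d * (n div d) = n" using k d by simp
    have "prime_factors k \<subseteq> prime_factors n" using k d dvd_prime_factors[of n k] by simp
    thus "n div d \<in> {k. k > 0 \<and> prime_factors k \<subseteq> prime_factors d}"
      using n k d by (auto simp: smooth_multiples_def)
  qed auto
  finally show ?thesis .
qed

lemma cong_one_iff_dvd: "prime p \<Longrightarrow> [p = 1] (mod n) \<longleftrightarrow> n dvd p - 1" for p n :: nat
  using prime_ge_1_nat[of p] by (simp add: cong_altdef_nat)

lemma delta_p_eq_sum:
  assumes p: "prime p"
  shows "delta_p p a d = real (\<Sum>j | j dvd p - 1 \<and> [int j = a] (mod int d). totient j) / real (p - 1)"
  unfolding delta_p_def by (subst card_ord_eq_sum_totient[OF p]) simp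

text \<open>\<open>max 1 n\<close> gives index 0, whose coefficient is 0, a positive
  modulus.\<close>

lemma delta_p_0_sums:
  assumes p: "prime p" and d: "d > 0"
  shows "(\<lambda>n. if p \<in> {p. [p = 1] (mod max 1 n)} then (if n \<in> smooth_multiples d then real (totient d) / real n else 0) else 0)
    sums delta_p p 0 d"
proof -
  have p1: "p > 1" using p prime_gt_1_nat by auto
  define F where "F = {n\<in>smooth_multiples d. n dvd p - 1}"
  have fin: "finite F" unfolding F_def using p1 by (intro finite_subset[OF _ finite_divisors_nat[of "p - 1"]]) auto
  have "delta_p p 0 d = real (\<Sum>j | j dvd p - 1 \<and> d dvd j. totient j) / real (p - 1)"
    unfolding delta_p_eq_sum[OF p] by (simp add: cong_0_iff)
  also have "\<dots> = (\<Sum>n\<in>F. real (totient d) / real n)"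
    using p1 unfolding F_def by (subst sum_totient_multiples) (use d in auto)
  finally have "(\<lambda>n. if n \<in> F then real (totient d) / real n else 0) sums delta_p p 0 d"
    using sums_If_finite_set[OF fin, of "\<lambda>n. real (totient d) / real n"] by simp
  also have "(\<lambda>n. if n \<in> F then real (totient d) / real n else 0) =
    (\<lambda>n. if p \<in> {p. [p = 1] (mod max 1 n)} then (if n \<in> smooth_multiples d then real (totient d) / real n else 0) else 0)"
    using p by (auto simp: F_def smooth_multiples_def cong_one_iff_dvd[unfolded One_nat_def] fun_eq_iff max_def)
  finally show ?thesis .
qed

lemma prime_mean_order_divisible:
  assumes d: "d > 0"
  shows "prime_mean (\<lambda>p. delta_p p 0 d) \<longlonglongrightarrow> order_density d"
proof -
  define c where "c n = (if n \<in> smooth_multiples d then real (totient d) / real n else 0)" for n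
  define A where "A n = {p. [p = 1] (mod max 1 n)}" for n :: nat
  have "prime_mean (\<lambda>p. delta_p p 0 d) \<longlonglongrightarrow> (\<Sum>n. c n * (1 / real (totient (max 1 n))))"
  proof (rule prime_mean_tendsto_suminf[where u = "\<lambda>n. max 1 n" and A = A])
    show "(\<lambda>n. real (card (primes_le n \<inter> A k)) / real (card (primes_le n))) \<longlonglongrightarrow> 1 / real (totient (max 1 k))" for k
    proof -
      have "primes_le n \<inter> A k = primes_class (max 1 k) 1 n" for n by (auto simp: primes_class_def A_def)
      thus ?thesis using prime_density_nat[of "max 1 k" 1] by simp
    qed
    show "summable (\<lambda>k. \<bar>c k\<bar> * real (max 1 k) powr (-3/4))"
    \<comment> \<open>The exponent -7/4 is -1 from the weight and -3/4 from the uniform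
      bound.\<close>
    proof (rule summable_comparison_test'[of "\<lambda>k. real (totient d) * real k powr (-7/4)" 0])
      show "summable (\<lambda>k. real (totient d) * real k powr (-7/4))"
        by (intro summable_mult) (simp add: summable_real_powr_iff)
      fix k :: nat
      show "norm (\<bar>c k\<bar> * real (max 1 k) powr (-3/4)) \<le> real (totient d) * real k powr (-7/4)"
      proof (cases "k \<in> smooth_multiples d")
        case True
        hence k: "k \<ge> 1" by (simp add: smooth_multiples_def)
        have "real k powr (-7/4) = real k powr (-3/4) / real k"
          using k powr_diff[of "real k" "-3/4" 1] by simp
        thus ?thesis using True k by (simp add: c_def max_def)
      qed (simp add: c_def)
    qed
    show "(\<lambda>k. if p \<in> A k then c k else 0) sums delta_p p 0 d" if "prime p" for p
      unfolding A_def c_def by (rule delta_p_0_sums[OF that d])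
  qed (auto simp: A_def)
  also have "(\<Sum>n. c n * (1 / real (totient (max 1 n)))) = order_density d"
  proof -
    have "((\<lambda>n. real d / (real n)\<^sup>2) has_sum order_density d) (smooth_multiples d) \<longleftrightarrow>
      ((\<lambda>n. c n * (1 / real (totient (max 1 n)))) has_sum order_density d) UNIV"
    proof (rule has_sum_cong_neutral)
      fix n assume "n \<in> smooth_multiples d \<inter> UNIV"
      hence n: "n \<in> smooth_multiples d" "n > 0" by (auto simp: smooth_multiples_def)
      have "real (totient n) = real n * real (totient d) / real d"
        by (rule totient_same_prime_factors[OF d n(2) smooth_multiples_prime_factors[OF n(1)]])
      moreover have "max 1 n = n" using n by simp
      ultimately show "real d / (real n)\<^sup>2 = c n * (1 / real (totient (max 1 n)))"
        using n d by (simp add: c_def power2_eq_square)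
    qed (auto simp: c_def)
    hence "((\<lambda>n. c n * (1 / real (totient (max 1 n)))) has_sum order_density d) UNIV"
      using smooth_multiples_has_sum[OF d] by simp
    thus ?thesis by (simp add: has_sum_imp_sums sums_unique[symmetric])
  qed
  finally show ?thesis .
qed

lemma prime_mean_diff: "prime_mean (\<lambda>p. f p - g p) n = prime_mean f n - prime_mean g n"
  by (simp add: prime_mean_def sum_subtractf diff_divide_distrib)

lemma prime_mean_sum: "prime_mean (\<lambda>p. \<Sum>i\<in>I. f i p) n = (\<Sum>i\<in>I. prime_mean (f i) n)"
  unfolding prime_mean_def by (subst sum.swap) (simp add: sum_divide_distrib)

lemma odd_multiple_iff: "[int k = int d] (mod int (2 * d)) \<longleftrightarrow> d dvd k \<and> \<not> 2 * d dvd k" if "d > 0" for k d :: nat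
proof -
  have "[int k = int d] (mod int (2 * d)) \<longleftrightarrow> [k = d] (mod 2 * d)" by (rule cong_int_iff)
  also have "\<dots> \<longleftrightarrow> k mod (2 * d) = d" using that by (simp add: cong_def)
  also have "k mod (2 * d) = d \<longleftrightarrow> d dvd k \<and> \<not> 2 * d dvd k"
  proof
    assume *: "k mod (2 * d) = d"
    have "k = d * (2 * (k div (2 * d)) + 1)" using div_mult_mod_eq[of k "2 * d"] * by (simp add: algebra_simps)
    hence "d dvd k" by (metis dvd_triv_left)
    moreover have "\<not> 2 * d dvd k" using * that by (simp add: dvd_eq_mod_eq_0)
    ultimately show "d dvd k \<and> \<not> 2 * d dvd k" ..
  next
    assume *: "d dvd k \<and> \<not> 2 * d dvd k"
    then obtain i where i: "k = d * i" by blast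
    have "odd i" using * i by (auto simp: mult.commute)
    then obtain l where "i = 2 * l + 1" by (elim oddE)
    hence "k = d + 2 * d * l" using i by (simp add: algebra_simps)
    thus "k mod (2 * d) = d" using that by simp
  qed
  finally show ?thesis .
qed

lemma delta_p_odd_multiple:
  assumes d: "d > 0"
  shows "delta_p p (int d) (2 * d) = delta_p p 0 d - delta_p p 0 (2 * d)"
proof -
  define X where "X k = {x::nat \<in> {1..p-1}. k dvd ord p x}" for k
  have "{x::nat \<in> {1..p-1}. [int (ord p x) = int d] (mod int (2 * d))} = X d - X (2 * d)"
    unfolding X_def using odd_multiple_iff[OF d] by auto
  moreover have "X (2 * d) \<subseteq> X d" unfolding X_def by (auto dest: dvd_mult_right)
  moreover have "finite (X d)" unfolding X_def by auto
  ultimately have "real (card {x::nat \<in> {1..p-1}. [int (ord p x) = int d] (mod int (2 * d))}) = real (card (X d)) - real (card (X (2 * d)))"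
    by (simp add: card_Diff_subset finite_subset card_mono of_nat_diff)
  moreover have "X k = {x::nat \<in> {1..p-1}. [int (ord p x) = 0] (mod int k)}" for k
    by (simp add: X_def cong_0_iff)
  ultimately show ?thesis by (simp only: delta_p_def diff_divide_distrib)
qed

lemma prime_mean_odd_multiple:
  assumes d: "d > 0"
  shows "prime_mean (\<lambda>p. delta_p p (int d) (2 * d)) \<longlonglongrightarrow> order_density d - order_density (2 * d)"
proof -
  have "(\<lambda>n. prime_mean (\<lambda>p. delta_p p 0 d) n - prime_mean (\<lambda>p. delta_p p 0 (2 * d)) n) \<longlonglongrightarrow> order_density d - order_density (2 * d)"
    using d by (intro tendsto_diff prime_mean_order_divisible) auto
  thus ?thesis by (simp only: delta_p_odd_multiple[OF d] flip: prime_mean_diff)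
qed

text \<open>Doubling an odd d brings in 1/2 * 1 / (1 - 1/4) = 2/3, while doubling an even one leaves
  the primes unchanged. So the difference of the densities for d and 2 d is half of the latter in
  the odd case and equal to it in the even case.\<close>

lemma order_density_double:
  assumes d: "d > 0"
  shows "order_density (2 * d) = (if odd d then 2 / 3 * order_density d else order_density d / 2)"
proof -
  have pf: "prime_factors (2 * d) = insert 2 (prime_factors d)"
    using d by (auto simp: prime_factors_product prime_factorization_prime)
  show ?thesis
  proof (cases "odd d")
    case True
    hence "2 \<notin> prime_factors d" by (auto simp: in_prime_factors_iff)
    thus ?thesis using True by (simp add: order_density_def pf)
  next
    case False
    hence "2 \<in> prime_factors d" using d by (simp add: in_prime_factors_iff)
    thus ?thesis using False by (simp add: order_density_def pf insert_absorb)
  qed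
qed

section \<open>Multiplicative orders modulo powers of two\<close>

text \<open>This is mu e / e, with sign and denominator collected in one product.\<close>

definition moebius_weight :: "nat \<Rightarrow> real" where
  "moebius_weight e = (if squarefree e then \<Prod>p\<in>prime_factors e. - (1 / real p) else 0)"

lemma prime_factorization_prod_primes:
  assumes "finite X" "\<And>p. p \<in> X \<Longrightarrow> prime (p :: nat)"
  shows "prime_factorization (\<Prod>X) = mset_set X"
  using assms
proof (induction X rule: finite_induct)
  case (insert p X)
  have "0 \<notin> X" using insert(4)[of 0] by auto
  hence "prime_factorization (p * \<Prod>X) = prime_factorization p + prime_factorization (\<Prod>X)"
    using insert(1) insert(4)[of p] by (intro prime_factorization_mult) (auto simp: prime_gt_0_nat)
  thus ?case using insert by (simp add: prime_factorization_prime)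
qed auto

lemma prod_prime_factors_squarefree:
  fixes n :: nat
  assumes "squarefree n"
  shows "\<Prod>(prime_factors n) = n"
proof -
  have n: "n > 0" using assms by (intro Nat.gr0I) auto
  have "(\<Prod>p\<in>prime_factors n. p ^ multiplicity p n) = (\<Prod>p\<in>prime_factors n. p)"
    using assms n squarefree_factorial_semiring'[of n] by (intro prod.cong) auto
  thus ?thesis using prime_factorization_nat[OF n] by simp
qed

text \<open>Expanding the product of 1 - 1 / p over the primes of n gives one term for each subset
  of them, that is, for each squarefree divisor.\<close>

lemma sum_moebius_weight:
  assumes n: "n > 0"
  shows "(\<Sum>e | e dvd n. moebius_weight e) = real (totient n) / real n"
proof -
  define S where "S = prime_factors n"
  have S: "finite S" "\<And>p. p \<in> S \<Longrightarrow> prime p" unfolding S_def by (auto simp: in_prime_factors_iff)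
  have "real (totient n) / real n = (\<Prod>p\<in>S. 1 - 1 / real p)"
    using n by (simp add: totient_formula2 S_def)
  also have "\<dots> = (\<Prod>p\<in>S. - (1 / real p) + 1)" by simp
  also have "\<dots> = (\<Sum>X\<in>Pow S. \<Prod>p\<in>X. - (1 / real p))"
    by (subst prod_add[OF S(1)]) simp
  also have "\<dots> = (\<Sum>e\<in>{e. e dvd n \<and> squarefree e}. moebius_weight e)"
  proof (rule sum.reindex_bij_witness[of _ prime_factors "\<lambda>X. \<Prod>X"])
    fix X assume X: "X \<in> Pow S"
    have fX: "finite X" "\<And>p. p \<in> X \<Longrightarrow> prime p" using X S finite_subset by auto
    have pf: "prime_factorization (\<Prod>X) = mset_set X" by (rule prime_factorization_prod_primes[OF fX])
    have pfX: "prime_factors (\<Prod>X) = X" using fX(1) by (simp add: pf)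
    thus "prime_factors (\<Prod>X) = X" .
    have "0 \<notin> X" using fX(2)[of 0] by auto
    hence nz: "\<Prod>X \<noteq> 0" using fX(1) by simp
    have mult: "multiplicity p (\<Prod>X) = 1" if "p \<in> X" for p
      using that fX by (simp add: count_prime_factorization_prime[symmetric] pf)
    have sq: "squarefree (\<Prod>X)"
      unfolding squarefree_factorial_semiring'[OF nz] pfX using mult by blast
    have "(\<Prod>p\<in>X. p) dvd n"
      using fX X by (intro prod_primes_dvd) (auto simp: S_def)
    thus "\<Prod>X \<in> {e. e dvd n \<and> squarefree e}" using sq by simp
    show "moebius_weight (\<Prod>X) = (\<Prod>p\<in>X. - (1 / real p))"
      using sq by (simp add: moebius_weight_def pfX)
  next
    fix e assume e: "e \<in> {e. e dvd n \<and> squarefree e}"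
    show "\<Prod>(prime_factors e) = e" using e by (intro prod_prime_factors_squarefree) simp
    show "prime_factors e \<in> Pow S" unfolding S_def using e n dvd_prime_factors[of n e] by simp
  qed
  also have "\<dots> = (\<Sum>e | e dvd n. moebius_weight e)"
    using n by (intro sum.mono_neutral_left) (auto simp: moebius_weight_def intro: finite_divisors_nat)
  finally show ?thesis by simp
qed

lemma abs_moebius_weight_le: "\<bar>moebius_weight e\<bar> \<le> 1 / real e"
proof (cases "squarefree e")
  case True
  have "\<bar>moebius_weight e\<bar> = (\<Prod>p\<in>prime_factors e. 1 / real p)"
    using True by (simp add: moebius_weight_def abs_prod)
  also have "\<dots> = 1 / real (\<Prod>(prime_factors e))" by (simp add: prod_dividef)
  finally show ?thesis by (simp add: prod_prime_factors_squarefree[OF True])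
qed (simp add: moebius_weight_def)

text \<open>The pair (t, e) stands for elements of index t, with e coming from the expansion of totient ((p - 1) / t).\<close>

definition index_class :: "nat \<Rightarrow> int \<Rightarrow> nat \<Rightarrow> nat \<Rightarrow> nat set" where
  "index_class d a t e = {p. p \<ge> 1 \<and> t * e > 0 \<and> t * e dvd p - 1 \<and> [int ((p - 1) div t) = a] (mod int d)}"

text \<open>If the two conditions on (p - 1) / t are compatible, they fix one residue of p mod
  \<open>t * lcm d e\<close>. For even d and odd t * a that residue is even, so it contains at most
  the prime 2 and has density 0.\<close>

definition index_density :: "nat \<Rightarrow> int \<Rightarrow> nat \<Rightarrow> nat \<Rightarrow> real" where
  "index_density d a t e = (if t * e > 0 \<and> (\<exists>n. [int n = a] (mod int d) \<and> e dvd n) \<and> even (int t * a)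
     then 1 / real (totient (t * lcm d e)) else 0)"

text \<open>With j = (p - 1) / t the contribution of j is totient j / j divided by t, and totient j
  / j is expanded over the divisors e of j. \<open>prod_decode\<close> arranges the pairs (t, e) in
  one series.\<close>

lemma delta_p_index_sums:
  assumes p: "prime p"
  shows "(\<lambda>k. if p \<in> (case prod_decode k of (t, e) \<Rightarrow> index_class d a t e)
     then (case prod_decode k of (t, e) \<Rightarrow> moebius_weight e / real t) else 0) sums delta_p p a d"
proof -
  define M where "M = p - 1"
  have M: "M > 0" using p prime_gt_1_nat by (auto simp: M_def)
  have p1: "p \<ge> 1" using p prime_ge_1_nat by auto
  define T where "T = {t. t dvd M \<and> [int (M div t) = a] (mod int d)}"
  define F where "F = (SIGMA t:T. {e. e dvd M div t})"
  have finT: "finite T" unfolding T_def using M by (intro finite_subset[OF _ finite_divisors_nat[of M]]) auto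
  have Mt: "M div t > 0" if "t \<in> T" for t
    using that M by (auto simp: T_def dvd_div_eq_0_iff)
  have fine: "finite {e. e dvd M div t}" if "t \<in> T" for t using Mt[OF that] by (intro finite_divisors_nat) auto
  have finF: "finite F" unfolding F_def using finT fine by (intro finite_SigmaI) auto
  have F_iff: "(t, e) \<in> F \<longleftrightarrow> p \<in> index_class d a t e" for t e
  proof
    assume "(t, e) \<in> F"
    hence te: "t dvd M" "e dvd M div t" "[int (M div t) = a] (mod int d)" by (auto simp: F_def T_def)
    have "t * e dvd t * (M div t)" using te by (intro mult_dvd_mono) auto
    hence dvd: "t * e dvd M" using te by simp
    moreover have "t * e > 0" using dvd M by (intro Nat.gr0I) auto
    ultimately show "p \<in> index_class d a t e" using te p1 by (simp add: index_class_def M_def)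
  next
    assume "p \<in> index_class d a t e"
    hence te: "t * e dvd M" "t * e > 0" "[int (M div t) = a] (mod int d)" by (simp_all add: index_class_def M_def)
    have "t dvd M" using te(1) by (rule dvd_mult_left)
    moreover from this te have "e dvd M div t" by (metis dvd_mult_div_cancel mult_dvd_mono nat_mult_dvd_cancel1 nat_0_less_mult_iff)
    ultimately show "(t, e) \<in> F" using te by (simp add: F_def T_def)
  qed
  have "real (\<Sum>j | j dvd M \<and> [int j = a] (mod int d). totient j) / real M = (\<Sum>j | j dvd M \<and> [int j = a] (mod int d). real (totient j) / real M)"
    by (simp add: sum_divide_distrib)
  also have "\<dots> = (\<Sum>t\<in>T. real (totient (M div t)) / real M)"
    by (rule sum.reindex_bij_witness[of _ "\<lambda>t. M div t" "\<lambda>j. M div j"])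
       (use M in \<open>auto simp: T_def div_div_eq_right dvd_div_eq_mult\<close>)
  also have "\<dots> = (\<Sum>t\<in>T. \<Sum>e | e dvd M div t. moebius_weight e / real t)"
  proof (intro sum.cong refl)
    fix t assume t: "t \<in> T"
    then obtain k where k: "M = t * k" by (auto simp: T_def elim: dvdE)
    have t0: "t > 0" "k > 0" using k M by auto
    have "(\<Sum>e | e dvd M div t. moebius_weight e / real t) = (\<Sum>e | e dvd M div t. moebius_weight e) / real t"
      by (rule sum_divide_distrib[symmetric])
    also have "\<dots> = real (totient (M div t)) / real (M div t) / real t" by (simp add: sum_moebius_weight[OF Mt[OF t]])
    also have "\<dots> = real (totient (M div t)) / real M" using t0 by (simp add: k)
    finally show "real (totient (M div t)) / real M = (\<Sum>e | e dvd M div t. moebius_weight e / real t)" by simp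
  qed
  also have "\<dots> = (\<Sum>(t, e)\<in>F. moebius_weight e / real t)"
    unfolding F_def using finT fine by (intro sum.Sigma) auto
  also have "\<dots> = (\<Sum>k\<in>prod_encode ` F. case prod_decode k of (t, e) \<Rightarrow> moebius_weight e / real t)"
    by (subst sum.reindex) (auto intro: inj_on_subset[OF inj_prod_encode])
  finally have "delta_p p a d = (\<Sum>k\<in>prod_encode ` F. case prod_decode k of (t, e) \<Rightarrow> moebius_weight e / real t)"
    unfolding delta_p_eq_sum[OF p] M_def[symmetric] .
  moreover have "(\<lambda>k. if k \<in> prod_encode ` F then (case prod_decode k of (t, e) \<Rightarrow> moebius_weight e / real t) else 0) sums
      (\<Sum>k\<in>prod_encode ` F. case prod_decode k of (t, e) \<Rightarrow> moebius_weight e / real t)"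
    using finF by (intro sums_If_finite_set) auto
  moreover have "k \<in> prod_encode ` F \<longleftrightarrow> p \<in> (case prod_decode k of (t, e) \<Rightarrow> index_class d a t e)" for k
  proof -
    obtain t e where te: "prod_decode k = (t, e)" by fastforce
    hence k: "k = prod_encode (t, e)" by (metis prod_decode_inverse)
    have "k \<in> prod_encode ` F \<longleftrightarrow> (t, e) \<in> F" unfolding k using inj_prod_encode by (auto simp: inj_on_def)
    thus ?thesis using F_iff te by simp
  qed
  ultimately show ?thesis by simp
qed

text \<open>Writing p - 1 = t * n, the conditions on n are a congruence mod d and divisibility by e.
  They are contradictory or describe one class mod \<open>lcm d e\<close>, so that p lies in one
  class mod t times this.\<close>

lemma index_class_density:
  assumes s: "s \<ge> 1"
  shows "(\<lambda>n. real (card (primes_le n \<inter> index_class (2 ^ s) a t e)) / real (card (primes_le n)))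
    \<longlonglongrightarrow> index_density (2 ^ s) a t e"
proof -
  define d where "d = (2 :: nat) ^ s"
  have "even d" using s by (simp add: d_def)
  have "(\<lambda>n. real (card (primes_le n \<inter> index_class d a t e)) / real (card (primes_le n)))
    \<longlonglongrightarrow> index_density d a t e"
  proof -
    consider "t * e = 0" | "t * e > 0" "\<not> (\<exists>n. [int n = a] (mod int d) \<and> e dvd n)"
      | "t * e > 0" "odd (int t * a)"
      | n0 where "t * e > 0" "even (int t * a)" "[int n0 = a] (mod int d)" "e dvd n0" by blast
    thus ?thesis
    proof cases
      case 1
      hence "index_class d a t e = {}" "index_density d a t e = 0"
        unfolding index_class_def index_density_def by auto
      thus ?thesis by simp
    next
      case 2
      have "p \<notin> index_class d a t e" for p
      proof
        assume p: "p \<in> index_class d a t e"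
        have "t * e dvd p - 1" "[int ((p - 1) div t) = a] (mod int d)" using p by (auto simp: index_class_def)
        moreover from this have "e dvd (p - 1) div t" using 2(1) by (auto elim!: dvdE)
        ultimately show False using 2(2) by blast
      qed
      hence "index_class d a t e = {}" by blast
      moreover have "index_density d a t e = 0" unfolding index_density_def using 2(2) by (simp only: if_False simp_thms)
      ultimately show ?thesis by simp
    next
      case 3
      \<comment> \<open>Here p - 1 is the product of the odd numbers t and (p - 1) div t, so p is
        even.\<close>
      have sub: "primes_le n \<inter> index_class d a t e \<subseteq> {2}" for n
      proof
        fix p assume "p \<in> primes_le n \<inter> index_class d a t e"
        hence p: "prime p" "t * e dvd p - 1" "[int ((p - 1) div t) = a] (mod int d)" "p \<ge> 1"
          by (auto simp: index_class_def primes_class_def)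
        have "2 dvd int d" using \<open>even d\<close> by simp
        hence "[int ((p - 1) div t) = a] (mod 2)" using p(3) cong_dvd_modulus by blast
        hence "odd ((p - 1) div t)" using 3 cong_dvd_iff[of "int ((p - 1) div t)" a 2] by simp
        moreover have "odd t" using 3 by simp
        moreover have "p - 1 = t * ((p - 1) div t)" using p(2) by (metis dvd_mult_div_cancel dvd_mult_left)
        ultimately have "odd (p - 1)" by (metis even_mult_iff)
        hence "even p" using p(4) by simp
        thus "p \<in> {2}" using p(1) primes_dvd_imp_eq two_is_prime_nat by blast
      qed
      have "(\<lambda>n. real (card (primes_le n \<inter> index_class d a t e)) / real (card (primes_le n))) \<longlonglongrightarrow> 0"
      proof (rule tendsto_sandwich[of "\<lambda>_. 0" _ _ "\<lambda>n. 1 / real (card (primes_le n))"])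
        show "(\<lambda>n. 1 / real (card (primes_le n))) \<longlonglongrightarrow> 0"
          by (rule tendsto_divide_0[OF tendsto_const filterlim_at_top_imp_at_infinity[OF card_primes_le_at_top]])
        show "\<forall>\<^sub>F n in sequentially. real (card (primes_le n \<inter> index_class d a t e)) / real (card (primes_le n)) \<le> 1 / real (card (primes_le n))"
        proof (intro always_eventually allI divide_right_mono)
          fix n
          have "card (primes_le n \<inter> index_class d a t e) \<le> card {2::nat}" by (rule card_mono[OF _ sub]) simp
          thus "real (card (primes_le n \<inter> index_class d a t e)) \<le> 1" by simp
        qed auto
      qed auto
      thus ?thesis using 3 by (simp add: index_density_def)
    next
      case (4 n0)
      define L where "L = lcm d e"
      have pos: "t > 0" "e > 0" "d > 0" using 4 by (auto simp: d_def)
      have L: "L > 0" using pos by (simp add: L_def lcm_pos_nat)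
      have iff: "p \<in> index_class d a t e \<longleftrightarrow> [p = 1 + t * n0] (mod t * L)" if p: "p \<ge> 1" for p
      proof -
        have "[p = 1 + t * n0] (mod t * L) \<longleftrightarrow> [1 + (p - 1) = 1 + t * n0] (mod t * L)" using p by simp
        also have "\<dots> \<longleftrightarrow> [p - 1 = t * n0] (mod t * L)" by (rule cong_add_lcancel_nat)
        also have "\<dots> \<longleftrightarrow> p \<in> index_class d a t e"
        proof
          assume *: "[p - 1 = t * n0] (mod t * L)"
          hence "[p - 1 = t * n0] (mod t)" using cong_modulus_mult_nat by blast
          hence "t dvd p - 1" using cong_dvd_iff by (metis dvd_triv_left)
          then obtain n where n: "p - 1 = t * n" by (rule dvdE)
          have "[n = n0] (mod L)" using * pos unfolding n by (simp add: cong_mult_lcancel_nat cong_def mult_mod_right[symmetric])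
          hence nd: "[n = n0] (mod d)" "[n = n0] (mod e)" unfolding L_def by (auto intro: cong_dvd_modulus_nat)
          have "e dvd n" using nd(2) 4(4) cong_dvd_iff by blast
          moreover have "[int n = int n0] (mod int d)" using nd(1) by (simp add: cong_int_iff)
          hence "[int n = a] (mod int d)" using 4(3) cong_trans by blast
          ultimately show "p \<in> index_class d a t e" using p pos 4(1) n by (simp add: index_class_def)
        next
          assume "p \<in> index_class d a t e"
          hence te: "t * e dvd p - 1" "[int ((p - 1) div t) = a] (mod int d)" by (auto simp: index_class_def)
          then obtain k where k: "p - 1 = t * e * k" by (auto elim: dvdE)
          define n where "n = e * k"
          have n: "p - 1 = t * n" using k by (simp add: n_def mult.assoc)
          have "[int n = int n0] (mod int d)" using te(2) 4(3) pos unfolding n by (simp add: cong_def)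
          hence "[n = n0] (mod d)" by (simp add: cong_int_iff)
          moreover have "[n = n0] (mod e)" using 4(4) by (simp add: cong_def n_def)
          ultimately have "[n = n0] (mod L)" unfolding L_def by (rule cong_cong_lcm_nat)
          thus "[p - 1 = t * n0] (mod t * L)" unfolding n by (simp add: cong_def mult_mod_right[symmetric])
        qed
        finally show ?thesis by simp
      qed
      have "primes_le n \<inter> index_class d a t e = primes_class (t * L) (1 + t * n0) n" for n
        using iff by (auto simp: primes_class_def dest: prime_ge_1_nat)
      \<comment> \<open>A common prime cannot divide t * n0, hence divides neither t nor e, since e
        divides n0. So it divides d, and as d is a power of 2 it is 2; but the parity condition
        makes 1 + t * n0 odd.\<close>
      moreover have "coprime (1 + t * n0) (t * L)"
      proof (rule ccontr)
        assume "\<not> coprime (1 + t * n0) (t * L)"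
        then obtain q where q: "prime q" "q dvd 1 + t * n0" "q dvd t * L" by (rule common_prime_factor)
        have not: "\<not> q dvd t * n0"
        proof
          assume "q dvd t * n0"
          hence "q dvd 1" using q(2) dvd_add_left_iff by blast
          thus False using q(1) by simp
        qed
        have "q dvd d * e"
        proof -
          have "q dvd L" using q(1,3) not by (auto simp: prime_dvd_mult_iff)
          thus ?thesis unfolding L_def using dvd_trans lcm_least by (metis dvd_triv_left dvd_triv_right)
        qed
        hence "q dvd d" using q(1) not 4(4) dvd_trans[of q e n0] by (auto simp: prime_dvd_mult_iff)
        hence "q dvd 2" unfolding d_def using q(1) prime_dvd_power by blast
        hence q2: "q = 2" using q(1) primes_dvd_imp_eq two_is_prime_nat by blast
        have "2 dvd int d" using \<open>even d\<close> by simp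
        hence "[int n0 = a] (mod 2)" using 4(3) cong_dvd_modulus by blast
        hence "even (int n0) \<longleftrightarrow> even a" by (rule cong_dvd_iff)
        hence "even (t * n0)" using 4(2) by simp
        thus False using not q2 by simp
      qed
      moreover have "t * L \<ge> 1" using pos L by simp
      moreover have "index_density d a t e = 1 / real (totient (t * L))"
        using 4 by (auto simp: index_density_def L_def)
      ultimately show ?thesis using prime_density_nat[of "t * L" "1 + t * n0"] by simp
    qed
  qed
  thus ?thesis by (simp only: d_def)
qed

text \<open>The factor 1 / (t e) of the weight and the exponent -3/4 of the uniform bound give at
  most t powr (-7/4) * e powr (-7/4), a product of terms of convergent series.\<close>

lemma summable_index_weights:
  "summable (\<lambda>k. \<bar>case prod_decode k of (t, e) \<Rightarrow> moebius_weight e / real t\<bar> * real (case prod_decode k of (t, e) \<Rightarrow> max 1 (t * e)) powr (-3/4))"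
proof -
  define h where "h n = real n powr (-7/4)" for n :: nat
  have h0: "h n \<ge> 0" for n by (simp add: h_def)
  have "summable (\<lambda>n. norm (h n))" by (simp add: h_def summable_real_powr_iff)
  moreover from this have "h sums suminf h" by (intro summable_sums) (rule summable_norm_cancel)
  ultimately have hs: "(h has_sum suminf h) UNIV" by (rule norm_summable_imp_has_sum)
  have "(\<lambda>(t, e). h t * h e) summable_on UNIV \<times> UNIV"
  proof (rule summable_on_SigmaI[where g = "\<lambda>t. h t * suminf h"])
    show "((\<lambda>e. case (t, e) of (t, e) \<Rightarrow> h t * h e) has_sum h t * suminf h) UNIV" for t
      using has_sum_cmult_right[OF hs, of "h t"] by simp
    show "(\<lambda>t. h t * suminf h) summable_on UNIV"
      using has_sum_cmult_left[OF hs, of "suminf h"] by (rule has_sum_imp_summable)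
  qed (use h0 in auto)
  hence "(\<lambda>k. case prod_decode k of (t, e) \<Rightarrow> h t * h e) summable_on UNIV"
    using summable_on_reindex_bij_betw[OF bij_prod_decode, of "\<lambda>(t, e). h t * h e"] by simp
  hence "summable (\<lambda>k. case prod_decode k of (t, e) \<Rightarrow> h t * h e)" by (rule summable_on_imp_summable)
  thus ?thesis
  proof (rule summable_comparison_test'[of _ 0])
    fix k
    obtain t e where te: "prod_decode k = (t, e)" by fastforce
    have "\<bar>moebius_weight e / real t\<bar> * real (max 1 (t * e)) powr (-3/4) \<le> h t * h e"
    proof (cases "t * e = 0")
      case False
      hence pos: "real t > 0" "real e > 0" by auto
      have pw: "x powr (-7/4) = 1 / x * x powr (-3/4)" if "x > 0" for x :: real
        using powr_diff[of x "-3/4" 1] that by simp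
      have "\<bar>moebius_weight e / real t\<bar> \<le> (1 / real e) / real t"
        using divide_right_mono[OF abs_moebius_weight_le[of e], of "real t"] by simp
      hence "\<bar>moebius_weight e / real t\<bar> * (real t * real e) powr (-3/4) \<le> (1 / real e) / real t * (real t * real e) powr (-3/4)"
        by (rule mult_right_mono) simp
      also have "\<dots> = h t * h e" unfolding h_def pw[OF pos(1)] pw[OF pos(2)] using pos by (simp add: powr_mult)
      finally show ?thesis using False by (simp add: max_def)
    qed (auto simp: h_def moebius_weight_def)
    thus "norm (\<bar>case prod_decode k of (t, e) \<Rightarrow> moebius_weight e / real t\<bar> * real (case prod_decode k of (t, e) \<Rightarrow> max 1 (t * e)) powr (-3/4))
      \<le> (case prod_decode k of (t, e) \<Rightarrow> h t * h e)" by (simp add: te)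
  qed
qed

text \<open>All that is read off from this series is that the limit exists and that it depends on a
  only through \<open>index_density\<close>.\<close>

definition order_class_density :: "nat \<Rightarrow> int \<Rightarrow> real" where
  "order_class_density d a = (\<Sum>k. case prod_decode k of (t, e) \<Rightarrow> moebius_weight e / real t * index_density d a t e)"

lemma prime_mean_order_class:
  assumes s: "s \<ge> 1"
  shows "prime_mean (\<lambda>p. delta_p p a (2 ^ s)) \<longlonglongrightarrow> order_class_density (2 ^ s) a"
proof -
  define c where "c k = (case prod_decode k of (t, e) \<Rightarrow> moebius_weight e / real t)" for k
  define e where "e k = (case prod_decode k of (t, e) \<Rightarrow> index_density (2 ^ s) a t e)" for k
  have "prime_mean (\<lambda>p. delta_p p a (2 ^ s)) \<longlonglongrightarrow> (\<Sum>k. c k * e k)"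
  proof (rule prime_mean_tendsto_suminf[where u = "\<lambda>k. case prod_decode k of (t, e) \<Rightarrow> max 1 (t * e)"
        and A = "\<lambda>k. case prod_decode k of (t, e) \<Rightarrow> index_class (2 ^ s) a t e"])
    show "(case prod_decode k of (t, e) \<Rightarrow> max 1 (t * e)) \<ge> 1" for k by (simp split: prod.split)
    show "[p = 1] (mod (case prod_decode k of (t, e) \<Rightarrow> max 1 (t * e)))"
      if "p \<in> (case prod_decode k of (t, e) \<Rightarrow> index_class (2 ^ s) a t e)" for k p
      using that by (auto simp: index_class_def cong_altdef_nat max_def split: prod.splits)
    show "(\<lambda>n. real (card (primes_le n \<inter> (case prod_decode k of (t, e) \<Rightarrow> index_class (2 ^ s) a t e))) / real (card (primes_le n))) \<longlonglongrightarrow> e k" for k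
      using index_class_density[OF s, of a "fst (prod_decode k)" "snd (prod_decode k)"]
      by (simp add: e_def case_prod_unfold)
    show "summable (\<lambda>k. \<bar>c k\<bar> * real (case prod_decode k of (t, e) \<Rightarrow> max 1 (t * e)) powr (-3/4))"
      unfolding c_def by (rule summable_index_weights)
    show "(\<lambda>k. if p \<in> (case prod_decode k of (t, e) \<Rightarrow> index_class (2 ^ s) a t e) then c k else 0) sums delta_p p a (2 ^ s)"
      if "prime p" for p unfolding c_def by (rule delta_p_index_sums[OF that])
  qed
  thus ?thesis by (simp add: order_class_density_def c_def e_def case_prod_unfold)
qed

text \<open>Multiplying a by an odd number permutes the solutions of the congruences, so the density only sees the 2-part of a.\<close>

lemma order_class_density_odd_mult:
  assumes s: "s \<ge> 1" and w: "[w * v = 1] (mod int (2 ^ s))" and b: "[b = w * a] (mod int (2 ^ s))"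
  shows "order_class_density (2 ^ s) b = order_class_density (2 ^ s) a"
proof -
  define d where "d = (2 :: nat) ^ s"
  have dpos: "int d > 0" by (simp add: d_def)
  have two: "2 dvd int d" using s by (simp add: d_def)
  have a: "[a = v * b] (mod int d)"
  proof -
    have "[v * b = v * (w * a)] (mod int d)" using b by (intro cong_mult cong_refl) (simp add: d_def)
    also have "v * (w * a) = (w * v) * a" by (simp add: mult_ac)
    also have "[(w * v) * a = 1 * a] (mod int d)" using w by (intro cong_mult cong_refl) (simp add: d_def)
    finally show ?thesis by (simp add: cong_sym_eq)
  qed
  \<comment> \<open>A solution for x, multiplied by the residue of z, becomes one for z * x and
    keeps its divisibility by e. Applied to w and to its inverse v, this gives both
    directions.\<close>
  have sol: "\<exists>n. [int n = y] (mod int d) \<and> e dvd n"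
    if ex: "\<exists>n. [int n = x] (mod int d) \<and> e dvd n" and yz: "[y = z * x] (mod int d)" for x y z e
  proof -
    obtain n where n: "[int n = x] (mod int d)" "e dvd n" using ex by blast
    define m where "m = nat (z mod int d) * n"
    have "int m = (z mod int d) * int n" using dpos by (simp add: m_def)
    also have "[(z mod int d) * int n = z * x] (mod int d)" using n(1) by (intro cong_mult) (simp_all add: cong_def)
    also have "[z * x = y] (mod int d)" using yz by (simp add: cong_sym_eq)
    finally have "[int m = y] (mod int d)" .
    moreover have "e dvd m" using n(2) by (simp add: m_def)
    ultimately show ?thesis by blast
  qed
  have "odd w"
  proof -
    have "[w * v = 1] (mod 2)" using w two unfolding d_def by (rule cong_dvd_modulus)
    hence "even (w * v) \<longleftrightarrow> even (1 :: int)" by (rule cong_dvd_iff)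
    thus ?thesis by simp
  qed
  have "[b = w * a] (mod 2)" using b two unfolding d_def by (rule cong_dvd_modulus)
  hence "even b \<longleftrightarrow> even (w * a)" by (rule cong_dvd_iff)
  hence par: "even b \<longleftrightarrow> even a" using \<open>odd w\<close> by simp
  have "index_density d b t e = index_density d a t e" for t e
  proof -
    have "(\<exists>n. [int n = b] (mod int d) \<and> e dvd n) \<longleftrightarrow> (\<exists>n. [int n = a] (mod int d) \<and> e dvd n)"
      using sol[OF _ a, of e] sol[OF _ b[folded d_def], of e] by argo
    thus ?thesis using par by (simp add: index_density_def)
  qed
  thus ?thesis by (simp add: order_class_density_def d_def)
qed

lemma card_odd_below_power: "card {c \<in> {..<2 ^ Suc i}. odd (c::nat)} = 2 ^ i"
proof -
  have "{c \<in> {..<2 ^ Suc i}. odd (c::nat)} = (\<lambda>k. 2 * k + 1) ` {..<2 ^ i}"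
    by (auto elim!: oddE)
  thus ?thesis by (simp add: card_image inj_on_def)
qed

text \<open>Both sides single out the orders 2 ^ j * q with q odd; the right-hand side sorts them by
  q mod 2 ^ (s - j), which is again odd because j < s.\<close>

lemma delta_p_split_odd_classes:
  assumes "j < s"
  shows "delta_p p (int (2 ^ j)) (2 * 2 ^ j) = (\<Sum>c\<in>{c \<in> {..<2 ^ (s - j)}. odd c}. delta_p p (int (2 ^ j * c)) (2 ^ s))"
proof -
  define I where "I = {c \<in> {..<2 ^ (s - j)}. odd (c::nat)}"
  define Y where "Y c = {x::nat \<in> {1..p-1}. [int (ord p x) = int (2 ^ j * c)] (mod int (2 ^ s))}" for c :: nat
  have sj: "(2::nat) ^ s = 2 ^ j * 2 ^ (s - j)" using assms by (simp flip: power_add)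
  have iff: "[int k = int (2 ^ j * c)] (mod int (2 ^ s)) \<longleftrightarrow> 2 ^ j dvd k \<and> (k div 2 ^ j) mod 2 ^ (s - j) = c" if c: "c \<in> I" for k c :: nat
  proof -
    have "[int k = int (2 ^ j * c)] (mod int (2 ^ s)) \<longleftrightarrow> [k = 2 ^ j * c] (mod 2 ^ j * 2 ^ (s - j))"
      unfolding sj by (rule cong_int_iff)
    also have "\<dots> \<longleftrightarrow> 2 ^ j dvd k \<and> (k div 2 ^ j) mod 2 ^ (s - j) = c"
    proof
      assume *: "[k = 2 ^ j * c] (mod 2 ^ j * 2 ^ (s - j))"
      hence "[k = 2 ^ j * c] (mod 2 ^ j)" using cong_modulus_mult_nat by blast
      hence dvd: "2 ^ j dvd k" using cong_dvd_iff by (metis dvd_triv_left)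
      then obtain q where q: "k = 2 ^ j * q" by (rule dvdE)
      have "2 ^ j * (q mod 2 ^ (s - j)) = 2 ^ j * (c mod 2 ^ (s - j))"
        using * unfolding q cong_def by (simp only: mult_mod_right)
      hence "q mod 2 ^ (s - j) = c" using c by (simp add: I_def)
      thus "2 ^ j dvd k \<and> (k div 2 ^ j) mod 2 ^ (s - j) = c" using dvd by (simp add: q)
    next
      assume *: "2 ^ j dvd k \<and> (k div 2 ^ j) mod 2 ^ (s - j) = c"
      then obtain q where q: "k = 2 ^ j * q" by blast
      have "q mod 2 ^ (s - j) = c mod 2 ^ (s - j)" using * c by (simp add: q I_def)
      thus "[k = 2 ^ j * c] (mod 2 ^ j * 2 ^ (s - j))" unfolding q cong_def by (simp only: mult_mod_right[symmetric])
    qed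
    finally show ?thesis .
  qed
  have "{x::nat \<in> {1..p-1}. [int (ord p x) = int (2 ^ j)] (mod int (2 * 2 ^ j))} = (\<Union>c\<in>I. Y c)"
  proof (intro equalityI subsetI)
    fix x assume "x \<in> {x::nat \<in> {1..p-1}. [int (ord p x) = int (2 ^ j)] (mod int (2 * 2 ^ j))}"
    hence x: "x \<in> {1..p-1}" "2 ^ j dvd ord p x" "\<not> 2 * 2 ^ j dvd ord p x" using odd_multiple_iff[of "2 ^ j"] by auto
    define q where "q = ord p x div 2 ^ j"
    have oq: "ord p x = 2 ^ j * q" using x(2) by (simp add: q_def)
    have "odd q" using x(3) unfolding oq by (auto elim!: evenE simp: mult_ac)
    moreover have "even ((2::nat) ^ (s - j))" using assms by simp
    ultimately have "odd (q mod 2 ^ (s - j))" by (simp add: dvd_mod_iff)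
    hence "q mod 2 ^ (s - j) \<in> I" by (simp add: I_def)
    moreover have "x \<in> Y (q mod 2 ^ (s - j))" using iff[OF calculation] x by (simp add: Y_def q_def)
    ultimately show "x \<in> (\<Union>c\<in>I. Y c)" by blast
  next
    fix x assume "x \<in> (\<Union>c\<in>I. Y c)"
    then obtain c where c: "c \<in> I" "x \<in> Y c" by blast
    hence x: "x \<in> {1..p-1}" "2 ^ j dvd ord p x" "(ord p x div 2 ^ j) mod 2 ^ (s - j) = c" using iff[OF c(1)] by (auto simp: Y_def)
    have "even ((2::nat) ^ (s - j))" using assms by simp
    hence "odd (ord p x div 2 ^ j)" using c(1) x(3) by (auto simp: I_def dvd_mod_iff)
    hence "\<not> 2 * 2 ^ j dvd ord p x" using x(2) by (metis dvd_div_mult_self dvd_mult_cancel2 dvd_mult_div_cancel mult.commute nat_mult_dvd_cancel_disj power_not_zero zero_neq_numeral)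
    thus "x \<in> {x::nat \<in> {1..p-1}. [int (ord p x) = int (2 ^ j)] (mod int (2 * 2 ^ j))}"
      using x odd_multiple_iff[of "2 ^ j"] by auto
  qed
  moreover have "Y c \<inter> Y c' = {}" if "c \<in> I" "c' \<in> I" "c \<noteq> c'" for c c'
    using iff[OF that(1)] iff[OF that(2)] that(3) by (auto simp: Y_def)
  ultimately have "card {x::nat \<in> {1..p-1}. [int (ord p x) = int (2 ^ j)] (mod int (2 * 2 ^ j))} = (\<Sum>c\<in>I. card (Y c))"
    by (simp only:) (rule card_UN_disjoint, auto simp: I_def Y_def)
  thus ?thesis unfolding delta_p_def I_def[symmetric] Y_def[symmetric] by (simp add: sum_divide_distrib)
qed

lemma order_density_power_2: "order_density (2 ^ j) = (if j = 0 then 1 else 4 / 3 / 2 ^ j)"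
proof (induction j)
  case (Suc j)
  thus ?case using order_density_double[of "2 ^ j"] by auto
qed (simp add: order_density_def)

text \<open>The 2 ^ (s - Suc j) classes 2 ^ j * c with c odd are related by invertible multipliers
  mod 2 ^ s and so have equal density. Together they make up the orders divisible by 2 ^ j and not
  by 2 ^ (j + 1), whose density is known.\<close>

lemma order_class_density_value:
  assumes j: "j < s" and b: "odd b"
  shows "order_class_density (2 ^ s) (2 ^ j * b) = (order_density (2 ^ j) - order_density (2 * 2 ^ j)) / 2 ^ (s - Suc j)"
proof -
  define L where "L = order_class_density (2 ^ s) (2 ^ j * b)"
  define I where "I = {c \<in> {..<2 ^ (s - j)}. odd (c::nat)}"
  have s: "s \<ge> 1" using j by simp
  have inv: "\<exists>v. [c * v = 1] (mod int (2 ^ s))" if "odd c" for c :: int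
    using that by (intro cong_solve_coprime_int) simp
  obtain v where v: "[b * v = 1] (mod int (2 ^ s))" using inv[OF b] by blast
  have "order_class_density (2 ^ s) (int (2 ^ j * c)) = L" if c: "c \<in> I" for c
  proof -
    have "odd (int c)" using c by (simp add: I_def)
    then obtain u where u: "[int c * u = 1] (mod int (2 ^ s))" using inv by blast
    \<comment> \<open>As v inverts b, the multiplier c * v carries 2 ^ j * b to 2 ^ j * c; its own
      inverse is b * u.\<close>
    have 1: "[(int c * v) * (b * u) = 1] (mod int (2 ^ s))"
      using cong_mult[OF u v] by (simp add: mult_ac)
    have 2: "[int (2 ^ j * c) = (int c * v) * (2 ^ j * b)] (mod int (2 ^ s))"
      using cong_mult[OF cong_refl[of "2 ^ j * int c"] cong_sym[OF v]] by (simp add: mult_ac)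
    show ?thesis unfolding L_def by (rule order_class_density_odd_mult[OF s 1 2])
  qed
  hence "(\<lambda>n. \<Sum>c\<in>I. prime_mean (\<lambda>p. delta_p p (int (2 ^ j * c)) (2 ^ s)) n) \<longlonglongrightarrow> (\<Sum>c\<in>I. L)"
    by (intro tendsto_sum) (metis prime_mean_order_class[OF s])
  moreover have "prime_mean (\<lambda>p. delta_p p (int (2 ^ j)) (2 * 2 ^ j)) = (\<lambda>n. \<Sum>c\<in>I. prime_mean (\<lambda>p. delta_p p (int (2 ^ j * c)) (2 ^ s)) n)"
    unfolding delta_p_split_odd_classes[OF j] I_def[symmetric] prime_mean_sum[abs_def] ..
  ultimately have "prime_mean (\<lambda>p. delta_p p (int (2 ^ j)) (2 * 2 ^ j)) \<longlonglongrightarrow> (\<Sum>c\<in>I. L)" by simp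
  moreover have "prime_mean (\<lambda>p. delta_p p (int (2 ^ j)) (2 * 2 ^ j)) \<longlonglongrightarrow> order_density (2 ^ j) - order_density (2 * 2 ^ j)"
    by (rule prime_mean_odd_multiple) simp
  ultimately have "(\<Sum>c\<in>I. L) = order_density (2 ^ j) - order_density (2 * 2 ^ j)" by (rule LIMSEQ_unique)
  moreover have "card I = 2 ^ (s - Suc j)"
    unfolding I_def using card_odd_below_power[of "s - Suc j"] j by (simp add: Suc_diff_Suc)
  ultimately show ?thesis by (simp add: L_def field_simps)
qed

lemma int_two_part:
  fixes a :: int
  assumes "a \<noteq> 0"
  obtains j b where "a = 2 ^ j * b" "odd b"
proof -
  have "\<not> is_unit (2 :: int)" by simp
  from multiplicity_decompose'[OF assms this] obtain b where "a = 2 ^ multiplicity 2 a * b" "\<not> 2 dvd b" by blast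
  thus ?thesis by (rule that)
qed

theorem theorem1:
  shows "(\<forall>d::nat. d \<ge> 1 \<longrightarrow>
            has_delta 0 d ((1 / real d) * (\<Prod>p\<in>prime_factors d. 1 / (1 - 1 / (real p)^2)))
          \<and> has_delta (int d) (2*d) (if odd d then delta 0 (2*d) / 2 else delta 0 (2*d)))
       \<and> (\<forall>(s::nat) (a::int). s \<ge> 1 \<longrightarrow>
            has_delta a (2^s) (if even a then 2 powr (2 - real s) / 3 else 2 powr (1 - real s) / 3))"
proof (intro conjI allI impI)
  fix d :: nat assume "d \<ge> 1"
  hence d: "d > 0" by simp
  show "has_delta 0 d ((1 / real d) * (\<Prod>p\<in>prime_factors d. 1 / (1 - 1 / (real p)^2)))"
    using has_deltaI[OF prime_mean_order_divisible[OF d]] by (simp add: order_density_def)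
  have "delta 0 (2 * d) = order_density (2 * d)"
    using d by (intro has_delta_imp_delta has_deltaI prime_mean_order_divisible) simp
  hence "(if odd d then delta 0 (2*d) / 2 else delta 0 (2*d)) = order_density d - order_density (2 * d)"
    using order_density_double[OF d] by auto
  thus "has_delta (int d) (2*d) (if odd d then delta 0 (2*d) / 2 else delta 0 (2*d))"
    using has_deltaI[OF prime_mean_odd_multiple[OF d]] by simp
next
  fix s :: nat and a :: int
  assume s: "s \<ge> 1"
  have pw: "2 powr (x - real s) = 2 powr x / 2 ^ s" for x :: real
    by (simp add: powr_diff powr_realpow)
  show "has_delta a (2^s) (if even a then 2 powr (2 - real s) / 3 else 2 powr (1 - real s) / 3)"
  proof (cases "2 ^ s dvd a")
    \<comment> \<open>In this case the class is that of the orders divisible by 2 ^ s, which the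
      decomposition with j < s does not reach.\<close>
    case True
    have "even a" using True s dvd_trans[of 2 "2 ^ s" a] by simp
    have "[k = a] (mod int (2 ^ s)) \<longleftrightarrow> [k = 0] (mod int (2 ^ s))" for k
      using True by (simp add: cong_def)
    hence "delta_p p a (2 ^ s) = delta_p p 0 (2 ^ s)" for p by (simp only: delta_p_def)
    hence "has_delta a (2 ^ s) (order_density (2 ^ s))"
      using has_deltaI[of a "2 ^ s"] prime_mean_order_divisible[of "2 ^ s"] by simp
    thus ?thesis using \<open>even a\<close> s by (simp add: order_density_power_2 pw mult.commute)
  next
    case False
    hence "a \<noteq> 0" by auto
    then obtain j b where jb: "a = 2 ^ j * b" "odd b" by (rule int_two_part)
    have js: "j < s"
    proof (rule ccontr)
      assume "\<not> j < s"
      hence "(2::int) ^ s dvd 2 ^ j" by (intro le_imp_power_dvd) simp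
      thus False using False jb(1) by simp
    qed
    have "has_delta a (2 ^ s) ((order_density (2 ^ j) - order_density (2 * 2 ^ j)) / 2 ^ (s - Suc j))"
      unfolding order_class_density_value[OF js jb(2), symmetric] jb(1)[symmetric]
      by (rule has_deltaI[OF prime_mean_order_class[OF s]])
    also have "(order_density (2 ^ j) - order_density (2 * 2 ^ j)) / 2 ^ (s - Suc j) =
       (if even a then 2 powr (2 - real s) / 3 else 2 powr (1 - real s) / 3)"
    proof -
      \<comment> \<open>For j > 0 the difference is (2/3) / 2 ^ j, and division by 2 ^ (s - Suc j)
        removes the dependence on j. For j = 0 it is 1/3, since the density at 2 ^ 0 is 1 and not
        4/3. So only the parity of a remains.\<close>
      have p: "(2::real) ^ s = 2 ^ (s - Suc j) * 2 ^ Suc j" using js by (simp add: power_add[symmetric] del: power_Suc)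
      have "even a \<longleftrightarrow> j \<noteq> 0" using jb by simp
      moreover have "order_density (2 * 2 ^ j) = 4 / 3 / (2 * 2 ^ j)" using order_density_power_2[of "Suc j"] by simp
      ultimately show ?thesis
        unfolding order_density_power_2[of j] pw p by (cases "j = 0") (simp_all add: field_simps)
    qed
    finally show ?thesis .
  qed
qed

end
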